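(* Let $n\ge2$ and $N=2n-1$. There exists an admissible flag $Y_\bullet$ on $\mathbb{P}^N$, with associated flag valuation $\nu_{\mathrm{flag}}$, such that $\nu_{\mathrm{flag}}(H_N)=\mathbf 1=(1,\dots,1)$, where $H_N=p_0p_N\prod_{r=1}^{n-1}F_r$, and such that for every integer $k\ge0$ $$\sigma\Bigl(\bigl\{\nu_{\mathrm{flag}}(s)-k\mathbf 1:\ 0\ne s\in H^0(\mathbb{P}^N,\mathcal{O}((N+1)k))\bigr\}\Bigr)=kP_n^\vee\cap\mathbb{Z}^{2n-1}.$$
   Context: We work over $\mathbb{C}$; $[p_0:\cdots:p_N]$ are homogeneous coordinates on $\mathbb{P}^N$, and for $1\le r\le n-1$, $F_r=\sum_{j=0}^r(-1)^jp_{r-j}p_{N-r+j}$. Admissible flag: a chain of closed subvarieties $X=Y_0\supset Y_1\supset\cdots\supset Y_d=\{\mathrm{pt}\}$, $d=\dim X$, with each $Y_i$ irreducible of codimension $i$ and smooth at the point $Y_d$. Flag valuation: for a nonzero section $s$ of a line bundle, $\nu_{\mathrm{flag}}(s)=(\nu_1,\dots,\nu_d)\in\mathbb{Z}_{\ge0}^d$, where $\nu_1=\operatorname{ord}_{Y_1}(s)$; one divides $s$ by the $\nu_1$-th power of a local equation of $Y_1$ and restricts to $Y_1$; $\nu_2$ is the order of vanishing of the result along $Y_2$; and so on successively. Coordinates on the value lattice $\mathbb{Z}^{2n-1}$ are named $(B,A_{n-1},C_{n-1},\dots,A_1,C_1)$, and $\sigma:\mathbb{Z}^{2n-1}\to\mathbb{Z}^{2n-1}$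 is the coordinate permutation $$\sigma(B,A_{n-1},C_{n-1},\dots,A_1,C_1)=(B,A_1,C_1,\dots,A_{n-1},C_{n-1}).$$ The polytope $P_n^\vee\subset\mathbb{R}^{2n-1}$, in coordinates $(B,A_1,C_1,\dots,A_{n-1},C_{n-1})$, is defined by $B\ge-1$, $A_m\ge-1$, $C_m\ge-1$ for $1\le m\le n-1$, together with $$A_1+2B+\sum_{m=2}^{n-1}(A_m+C_m)\le1,\qquad C_1+2B+\sum_{m=2}^{n-1}(A_m+C_m)\le1.$$ *)

theory Defs
  imports "HOL-Analysis.Analysis" "HOL-Library.Poly_Mapping" "HOL-Library.Extended_Nat"
    "HOL-Library.Function_Algebras"
begin

section \<open>Homogeneous forms\<close>

text \<open>Polynomials over the complex numbers: finitely supported maps from monomials (exponent vectors)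
  to coefficients, with the convolution product of \<^theory>\<open>HOL-Library.Poly_Mapping\<close>.\<close>

type_synonym cpoly = "(nat \<Rightarrow>\<^sub>0 nat) \<Rightarrow>\<^sub>0 complex"

definition pvar :: "nat \<Rightarrow> cpoly" where
  "pvar i = Poly_Mapping.single (Poly_Mapping.single i 1) 1"

definition peval :: "cpoly \<Rightarrow> (nat \<Rightarrow> complex) \<Rightarrow> complex" where
  "peval f v = (\<Sum>m\<in>Poly_Mapping.keys f. Poly_Mapping.lookup f m *
     (\<Prod>i\<in>Poly_Mapping.keys m. v i ^ Poly_Mapping.lookup m i))"

text \<open>The space of forms of degree \<open>d\<close> in \<open>p\<^sub>0, \<dots>, p\<^sub>N\<close> (including 0), which is
  the space of global sections of the line bundle of degree \<open>d\<close> on projective \<open>N\<close>-space.\<close>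

definition forms_deg :: "nat \<Rightarrow> nat \<Rightarrow> cpoly set" where
  "forms_deg N d = {f. \<forall>m\<in>Poly_Mapping.keys f. Poly_Mapping.keys m \<subseteq> {..N} \<and>
     (\<Sum>i\<in>Poly_Mapping.keys m. Poly_Mapping.lookup m i) = d}"

definition forms :: "nat \<Rightarrow> cpoly set" where
  "forms N = (\<Union>d. forms_deg N d)"

section \<open>Projective space and its closed subvarieties\<close>

text \<open>A point is the set of all its homogeneous coordinate vectors.  A coordinate vector of a point
  of projective \<open>N\<close>-space is a function vanishing at all indices above \<open>N\<close>.\<close>

type_synonym ppoint = "(nat \<Rightarrow> complex) set"

definition coord_vectors :: "nat \<Rightarrow> (nat \<Rightarrow> complex) set" where
  "coord_vectors N = {v. (\<exists>i. v i \<noteq> 0) \<and> (\<forall>i>N. v i = 0)}"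

definition proj_space :: "nat \<Rightarrow> ppoint set" where
  "proj_space N = coord_vectors N //
     {(v, w). v \<in> coord_vectors N \<and> w \<in> coord_vectors N \<and> (\<exists>c. c \<noteq> 0 \<and> w = (\<lambda>i. c * v i))}"

definition vanishes_on :: "cpoly \<Rightarrow> ppoint set \<Rightarrow> bool" where
  "vanishes_on f Z \<longleftrightarrow> (\<forall>P\<in>Z. \<forall>v\<in>P. peval f v = 0)"

definition zariski_closed :: "nat \<Rightarrow> ppoint set \<Rightarrow> bool" where
  "zariski_closed N Z \<longleftrightarrow>
     (\<exists>F \<subseteq> forms N. Z = {P \<in> proj_space N. \<forall>f\<in>F. vanishes_on f {P}})"

definition irreducible_set :: "nat \<Rightarrow> ppoint set \<Rightarrow> bool" where
  "irreducible_set N Z \<longleftrightarrow> Z \<noteq> {} \<and>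
     (\<forall>A B. zariski_closed N A \<and> zariski_closed N B \<and> Z \<subseteq> A \<union> B \<longrightarrow> Z \<subseteq> A \<or> Z \<subseteq> B)"

definition closed_subvariety :: "nat \<Rightarrow> ppoint set \<Rightarrow> bool" where
  "closed_subvariety N Z \<longleftrightarrow> zariski_closed N Z \<and> irreducible_set N Z"

text \<open>Codimension of the closed subvariety \<open>Z\<close> in \<open>X\<close>: the supremum of the lengths of strict chains
  of closed subvarieties from \<open>Z\<close> up to \<open>X\<close>.\<close>

definition codim :: "nat \<Rightarrow> ppoint set \<Rightarrow> ppoint set \<Rightarrow> enat" where
  "codim N Z X = Sup {enat k | k. \<exists>C :: nat \<Rightarrow> ppoint set. C 0 = Z \<and> C k = X \<and>
     (\<forall>i\<le>k. closed_subvariety N (C i)) \<and> (\<forall>i<k. C i \<subset> C (Suc i))}"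

definition cscale :: "complex \<Rightarrow> (nat \<Rightarrow> complex) \<Rightarrow> (nat \<Rightarrow> complex)" where
  "cscale c w = (\<lambda>i. c * w i)"

interpretation cvec: vector_space cscale
  by unfold_locales (auto simp: cscale_def fun_eq_iff algebra_simps)

definition gradient :: "cpoly \<Rightarrow> (nat \<Rightarrow> complex) \<Rightarrow> (nat \<Rightarrow> complex)" where
  "gradient f v = (\<lambda>i. deriv (\<lambda>z. peval f (v(i := z))) (v i))"

text \<open>Jacobian criterion: the differentials at \<open>P\<close> of the forms in the ideal of \<open>Y\<close> span a space whose
  dimension is the codimension of \<open>Y\<close>.\<close>

definition smooth_at :: "nat \<Rightarrow> ppoint set \<Rightarrow> ppoint \<Rightarrow> bool" where
  "smooth_at N Y P \<longleftrightarrow> P \<in> Y \<and>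
     (\<forall>v\<in>P. enat (cvec.dim {gradient f v | f. f \<in> forms N \<and> vanishes_on f Y})
            = codim N Y (proj_space N))"

section \<open>Admissible flags and flag valuations on projective space\<close>

text \<open>Only \<open>Y 0, \<dots>, Y N\<close> matter; note that projective \<open>N\<close>-space has dimension \<open>N\<close>.\<close>

definition admissible_flag :: "nat \<Rightarrow> (nat \<Rightarrow> ppoint set) \<Rightarrow> bool" where
  "admissible_flag N Y \<longleftrightarrow>
     Y 0 = proj_space N \<and>
     (\<forall>i<N. Y (Suc i) \<subset> Y i) \<and>
     (\<forall>i\<le>N. closed_subvariety N (Y i) \<and> codim N (Y i) (proj_space N) = enat i) \<and>
     (\<exists>P. Y N = {P} \<and> (\<forall>i\<le>N. smooth_at N (Y i) P))"

text \<open>For subvarieties \<open>W \<subseteq> Y\<close>, elements of the local ring of \<open>Y\<close> at (the generic point of) \<open>W\<close> are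
  fractions \<open>f / u\<close> of forms of equal degree, \<open>u\<close> not vanishing identically on \<open>W\<close>, modulo forms
  vanishing on \<open>Y\<close>; sections of a line bundle near \<open>W\<close> are such fractions after trivialising by a
  form that does not vanish identically on \<open>W\<close>.  Below, a local section is represented by its
  numerator, which determines it up to a unit of the local ring, and identities in the local ring
  are written with cleared denominators.\<close>

definition local_unit :: "nat \<Rightarrow> ppoint set \<Rightarrow> cpoly \<Rightarrow> bool" where
  "local_unit N W u \<longleftrightarrow> u \<in> forms N \<and> \<not> vanishes_on u W"

text \<open>For \<open>W \<subseteq> Z \<subseteq> Y\<close>: \<open>g\<close> is an equation of \<open>Z\<close> in \<open>Y\<close> near \<open>W\<close>, i.e. it generates the ideal of
  \<open>Z\<close> in the local ring of \<open>Y\<close> at \<open>W\<close>.\<close>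

definition local_equation ::
  "nat \<Rightarrow> ppoint set \<Rightarrow> ppoint set \<Rightarrow> ppoint set \<Rightarrow> cpoly \<Rightarrow> bool" where
  "local_equation N Y Z W g \<longleftrightarrow> g \<in> forms N \<and> vanishes_on g Z \<and>
     (\<forall>f\<in>forms N. vanishes_on f Z \<longrightarrow>
        (\<exists>u t. local_unit N W u \<and> t \<in> forms N \<and> vanishes_on (u * f - g * t) Y))"

text \<open>The order of vanishing of \<open>s\<close>, not identically zero on \<open>Y\<close>, along the prime divisor \<open>Z\<close> of \<open>Y\<close>:
  the valuation of the discrete valuation ring of \<open>Y\<close> at the generic point of \<open>Z\<close>, so that
  \<open>s\<close> is a unit times the \<open>a\<close>-th power of a uniformiser \<open>g\<close>.\<close>

definition ord_along :: "nat \<Rightarrow> ppoint set \<Rightarrow> ppoint set \<Rightarrow> cpoly \<Rightarrow> nat" where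
  "ord_along N Y Z s = (THE a. \<exists>g u t. local_equation N Y Z Z g \<and>
     local_unit N Z u \<and> local_unit N Z t \<and> vanishes_on (u * s - g ^ a * t) Y)"

text \<open>\<open>t i\<close> is the section obtained on \<open>Y i\<close> after \<open>i\<close> steps: near the point \<open>Y N\<close>, it is divided by
  the appropriate power of an equation \<open>g\<close> of \<open>Y (i+1)\<close> in \<open>Y i\<close>, and the result \<open>t (i+1)\<close> is
  restricted to \<open>Y (i+1)\<close>.\<close>

definition is_flag_valuation :: "nat \<Rightarrow> (nat \<Rightarrow> ppoint set) \<Rightarrow> cpoly \<Rightarrow> nat list \<Rightarrow> bool" where
  "is_flag_valuation N Y s \<nu> \<longleftrightarrow> length \<nu> = N \<and>
     (\<exists>t :: nat \<Rightarrow> cpoly. t 0 = s \<and>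
       (\<forall>i<N. \<nu> ! i = ord_along N (Y i) (Y (Suc i)) (t i) \<and>
          local_unit N (Y (Suc i)) (t (Suc i)) \<and>
          (\<exists>g u. local_equation N (Y i) (Y (Suc i)) (Y N) g \<and> local_unit N (Y N) u \<and>
             vanishes_on (u * t i - g ^ (\<nu> ! i) * t (Suc i)) (Y i))))"

definition flag_valuation :: "nat \<Rightarrow> (nat \<Rightarrow> ppoint set) \<Rightarrow> cpoly \<Rightarrow> nat list" where
  "flag_valuation N Y s = (THE \<nu>. is_flag_valuation N Y s \<nu>)"

section \<open>The forms and the polytope\<close>

definition F_form :: "nat \<Rightarrow> nat \<Rightarrow> cpoly" where
  "F_form N r = (\<Sum>j=0..r. (- 1) ^ j * pvar (r - j) * pvar (N - r + j))"

definition H_form :: "nat \<Rightarrow> cpoly" where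
  "H_form n = pvar 0 * pvar (2 * n - 1) * (\<Prod>r=1..n-1. F_form (2 * n - 1) r)"

text \<open>The argument of \<open>coord_perm\<close> lists \<open>B, A\<^sub>n\<^sub>-\<^sub>1, C\<^sub>n\<^sub>-\<^sub>1, \<dots>, A\<^sub>1, C\<^sub>1\<close>, so \<open>A\<^sub>m\<close> and \<open>C\<^sub>m\<close> sit at positions
  \<open>2 (n - m) - 1\<close> and \<open>2 (n - m)\<close>.\<close>

definition coord_perm :: "nat \<Rightarrow> int list \<Rightarrow> int list" where
  "coord_perm n x = x ! 0 # concat (map (\<lambda>m. [x ! (2 * (n - m) - 1), x ! (2 * (n - m))]) [1..<n])"

text \<open>Points of the polytope are listed as \<open>B, A\<^sub>1, C\<^sub>1, \<dots>, A\<^sub>n\<^sub>-\<^sub>1, C\<^sub>n\<^sub>-\<^sub>1\<close>.\<close>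

definition P_dual :: "nat \<Rightarrow> real list set" where
  "P_dual n = {x. length x = 2 * n - 1 \<and>
     (let B = x ! 0; A = (\<lambda>m. x ! (2 * m - 1)); C = (\<lambda>m. x ! (2 * m)) in
        B \<ge> -1 \<and> (\<forall>m\<in>{1..n-1}. A m \<ge> -1 \<and> C m \<ge> -1) \<and>
        A 1 + 2 * B + (\<Sum>m=2..n-1. A m + C m) \<le> 1 \<and>
        C 1 + 2 * B + (\<Sum>m=2..n-1. A m + C m) \<le> 1)}"

definition dilate :: "nat \<Rightarrow> real list set \<Rightarrow> real list set" where
  "dilate k P = map (\<lambda>a. real k * a) ` P"

end

theory Submission
  imports Defs
begin

text \<open>On the chart \<open>p\<^sub>N = 1\<close> the functions \<open>F\<^sub>n\<^sub>-\<^sub>1, p\<^sub>n\<^sub>-\<^sub>1, p\<^sub>n, p\<^sub>n\<^sub>-\<^sub>2, p\<^sub>n\<^sub>+\<^sub>1, \<dots>, p\<^sub>1, p\<^sub>N\<^sub>-\<^sub>1\<close> are affine coordinates, and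
  the flag consists of the closures of the coordinate subspaces, so the flag valuation is the
  lexicographically smallest exponent in these coordinates.  Since
  \<open>F\<^sub>r = p\<^sub>r\<^sub>+\<^sub>1 p\<^sub>N\<^sub>-\<^sub>r\<^sub>-\<^sub>1 - F\<^sub>r\<^sub>+\<^sub>1\<close>, the value of \<open>F\<^sub>r\<close> is the sum of the unit vectors of \<open>A\<^sub>r\<^sub>+\<^sub>1\<close> and \<open>C\<^sub>r\<^sub>+\<^sub>1\<close> for
  \<open>r < n - 1\<close>; this includes \<open>F\<^sub>0 = p\<^sub>0 p\<^sub>N\<close>.  Rewriting \<open>p\<^sub>1 p\<^sub>N\<^sub>-\<^sub>1\<close> by means of \<open>F\<^sub>n\<^sub>-\<^sub>1\<close> and \<open>p\<^sub>0 p\<^sub>N\<close> shows that the forms of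
  degree \<open>d\<close> are spanned by the products of \<open>F\<^sub>n\<^sub>-\<^sub>1\<close> and the variables that are not divisible by
  \<open>p\<^sub>1 p\<^sub>N\<^sub>-\<^sub>1\<close>.  The values of these products are pairwise distinct, so they are all the values, and
  the degree bound \<open>d\<close> on the products is the system of inequalities of the polytope.\<close>

section \<open>Evaluation of polynomials\<close>

text \<open>Two features of the definitions shape the proof. Codimension is a supremum over all
  chains of closed subvarieties, so its upper bound rests on a count of linearly independent forms.
  Orders and values are definite descriptions over all local equations and denominators, so each
  value needs uniqueness as well as existence. Both are therefore translated to polynomial functions
  on coordinate subspaces of the chart, where powers of \<open>p_N\<close> adjust degrees freely:
  \<open>p_N\<close> is a unit at the last point. The two upper inequalities of the polytope come
  from the choice of products. Exchanging \<open>p_1 p_(N-1)\<close> for \<open>p_0\<close> keeps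
  the value and saves one degree, so exponents a and c of the last pair cost max a c instead of a +
  c, and a bound on a maximum is a pair of inequalities. The coefficient 2 of \<open>B\<close> is
  the degree of \<open>F_(n-1)\<close>. Since \<open>H_N\<close> has degree N + 1 and value (1, ...,
  1), subtracting k from each coordinate amounts to dividing by the k-th power of
  \<open>H_N\<close>, which turns the bound (N + 1) k into k.\<close>

lemma lookup_sum_atMost:
  assumes "Poly_Mapping.keys m \<subseteq> {..N::nat}"
  shows "(\<Sum>i\<in>Poly_Mapping.keys m. Poly_Mapping.lookup m i) = (\<Sum>i\<le>N. Poly_Mapping.lookup m i)"
  by (rule sum.mono_neutral_left) (use assms in \<open>auto simp: in_keys_iff\<close>)

definition mono_eval :: "(nat \<Rightarrow>\<^sub>0 nat) \<Rightarrow> (nat \<Rightarrow> complex) \<Rightarrow> complex" where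
  "mono_eval m v = (\<Prod>i\<in>Poly_Mapping.keys m. v i ^ Poly_Mapping.lookup m i)"

lemma mono_eval_superset:
  assumes "finite S" "Poly_Mapping.keys m \<subseteq> S"
  shows "mono_eval m v = (\<Prod>i\<in>S. v i ^ Poly_Mapping.lookup m i)"
  unfolding mono_eval_def
  by (rule prod.mono_neutral_left) (use assms in \<open>auto simp: in_keys_iff\<close>)

lemma mono_eval_zero [simp]: "mono_eval 0 v = 1"
  by (simp add: mono_eval_def)

lemma mono_eval_add: "mono_eval (m + m') v = mono_eval m v * mono_eval m' v"
proof -
  let ?S = "Poly_Mapping.keys m \<union> Poly_Mapping.keys m'"
  have "mono_eval (m + m') v = (\<Prod>i\<in>?S. v i ^ Poly_Mapping.lookup (m + m') i)"
    using keys_add[of m m'] by (intro mono_eval_superset) auto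
  also have "\<dots> = (\<Prod>i\<in>?S. v i ^ Poly_Mapping.lookup m i) * (\<Prod>i\<in>?S. v i ^ Poly_Mapping.lookup m' i)"
    by (simp add: lookup_add power_add prod.distrib)
  also have "\<dots> = mono_eval m v * mono_eval m' v"
    by (simp add: mono_eval_superset[of ?S])
  finally show ?thesis .
qed

lemma peval_superset:
  assumes "finite S" "Poly_Mapping.keys f \<subseteq> S"
  shows "peval f v = (\<Sum>m\<in>S. Poly_Mapping.lookup f m * mono_eval m v)"
  unfolding peval_def mono_eval_def
  by (rule sum.mono_neutral_left) (use assms in \<open>auto simp: in_keys_iff\<close>)

lemma peval_zero [simp]: "peval 0 v = 0"
  by (simp add: peval_def)

lemma peval_single [simp]: "peval (Poly_Mapping.single m c) v = c * mono_eval m v"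
  by (subst peval_superset[of "{m}"]) auto

lemma peval_one [simp]: "peval 1 v = 1"
  using peval_single[of 0 1 v] by simp

lemma peval_pvar [simp]: "peval (pvar i) v = v i"
  by (simp add: pvar_def mono_eval_def)

lemma peval_add [simp]: "peval (f + g) v = peval f v + peval g v"
proof -
  let ?S = "Poly_Mapping.keys f \<union> Poly_Mapping.keys g"
  have "peval (f + g) v = (\<Sum>m\<in>?S. Poly_Mapping.lookup (f + g) m * mono_eval m v)"
    using keys_add[of f g] by (intro peval_superset) auto
  also have "\<dots> = peval f v + peval g v"
    by (simp add: lookup_add algebra_simps sum.distrib peval_superset[of ?S])
  finally show ?thesis .
qed

lemma peval_uminus [simp]: "peval (- f) v = - peval f v"
  using peval_add[of f "- f" v] by (simp add: add_eq_0_iff)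

lemma peval_diff [simp]: "peval (f - g) v = peval f v - peval g v"
  using peval_add[of f "- g" v] by simp

lemma peval_sum [simp]: "peval (\<Sum>i\<in>S. f i) v = (\<Sum>i\<in>S. peval (f i) v)"
  by (induction S rule: infinite_finite_induct) auto

lemma poly_mapping_expand:
  "f = (\<Sum>m\<in>Poly_Mapping.keys f. Poly_Mapping.single m (Poly_Mapping.lookup f m))"
proof (rule poly_mapping_eqI)
  fix k
  have "(\<Sum>m\<in>Poly_Mapping.keys f. Poly_Mapping.lookup (Poly_Mapping.single m (Poly_Mapping.lookup f m)) k) =
      (\<Sum>m\<in>Poly_Mapping.keys f. if m = k then Poly_Mapping.lookup f k else 0)"
    by (rule sum.cong) (auto simp: lookup_single)
  then show "Poly_Mapping.lookup f k = Poly_Mapping.lookup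
      (\<Sum>m\<in>Poly_Mapping.keys f. Poly_Mapping.single m (Poly_Mapping.lookup f m)) k"
    by (auto simp: lookup_sum in_keys_iff)
qed

text \<open>Both factors are replaced by their monomial expansions, so that
  \<open>mult_single\<close> and \<open>mono_eval_add\<close> settle each pair of terms and the
  convolution is never unfolded.\<close>

lemma peval_mult [simp]: "peval (f * g) v = peval f v * peval g v"
proof -
  let ?e = "\<lambda>f :: cpoly. \<Sum>m\<in>Poly_Mapping.keys f. Poly_Mapping.single m (Poly_Mapping.lookup f m)"
  have "peval (?e f * ?e g) v = peval (?e f) v * peval (?e g) v"
    by (simp add: sum_product mult_single mono_eval_add algebra_simps)
  then show ?thesis by (simp flip: poly_mapping_expand)
qed

lemma peval_power [simp]: "peval (f ^ k) v = peval f v ^ k"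
  by (induction k) auto

lemma peval_prod [simp]: "peval (\<Prod>i\<in>S. f i) v = (\<Prod>i\<in>S. peval (f i) v)"
  by (induction S rule: infinite_finite_induct) auto

section \<open>The graded pieces\<close>

lemma forms_deg_iff:
  "f \<in> forms_deg N d \<longleftrightarrow> (\<forall>m\<in>Poly_Mapping.keys f.
     Poly_Mapping.keys m \<subseteq> {..N} \<and> (\<Sum>i\<le>N. Poly_Mapping.lookup m i) = d)"
  by (auto simp: forms_deg_def lookup_sum_atMost)

lemma forms_deg_formsI [intro]: "f \<in> forms_deg N d \<Longrightarrow> f \<in> forms N"
  by (auto simp: forms_def)

lemma forms_deg_zero [simp]: "0 \<in> forms_deg N d"
  by (simp add: forms_deg_def)

lemma forms_deg_add: "f \<in> forms_deg N d \<Longrightarrow> g \<in> forms_deg N d \<Longrightarrow> f + g \<in> forms_deg N d"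
  using keys_add[of f g] unfolding forms_deg_def by blast

lemma forms_deg_uminus: "f \<in> forms_deg N d \<Longrightarrow> - f \<in> forms_deg N d"
  unfolding forms_deg_def by (simp add: in_keys_iff)

lemma forms_deg_diff: "f \<in> forms_deg N d \<Longrightarrow> g \<in> forms_deg N d \<Longrightarrow> f - g \<in> forms_deg N d"
  using forms_deg_add[of f N d "- g"] forms_deg_uminus by simp

lemma forms_deg_sum: "(\<And>i. i \<in> S \<Longrightarrow> f i \<in> forms_deg N d) \<Longrightarrow> (\<Sum>i\<in>S. f i) \<in> forms_deg N d"
  by (induction S rule: infinite_finite_induct) (auto intro: forms_deg_add)

lemma forms_deg_mult:
  assumes "f \<in> forms_deg N a" "g \<in> forms_deg N b"
  shows "f * g \<in> forms_deg N (a + b)"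
  unfolding forms_deg_iff
proof
  fix m assume "m \<in> Poly_Mapping.keys (f * g)"
  then obtain x y where xy: "x \<in> Poly_Mapping.keys f" "y \<in> Poly_Mapping.keys g" "m = x + y"
    using keys_mult[of f g] by blast
  then show "Poly_Mapping.keys m \<subseteq> {..N} \<and> (\<Sum>i\<le>N. Poly_Mapping.lookup m i) = a + b"
    using assms keys_add[of x y] by (fastforce simp: forms_deg_iff lookup_add sum.distrib)
qed

lemma forms_deg_one: "1 \<in> forms_deg N 0"
  by (simp add: forms_deg_def)

lemma forms_deg_power: "f \<in> forms_deg N a \<Longrightarrow> f ^ k \<in> forms_deg N (k * a)"
  by (induction k) (auto intro: forms_deg_one forms_deg_mult)

lemma forms_deg_prod:
  "(\<And>i. i \<in> S \<Longrightarrow> f i \<in> forms_deg N (w i)) \<Longrightarrow> (\<Prod>i\<in>S. f i) \<in> forms_deg N (\<Sum>i\<in>S. w i)"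
  by (induction S rule: infinite_finite_induct) (auto intro: forms_deg_one forms_deg_mult)

lemma forms_deg_pvar: "i \<le> N \<Longrightarrow> pvar i \<in> forms_deg N 1"
  by (simp add: forms_deg_def pvar_def)

lemma forms_deg_const: "Poly_Mapping.single 0 c \<in> forms_deg N 0"
  by (simp add: forms_deg_def)

lemma forms_deg_scale: "f \<in> forms_deg N d \<Longrightarrow> Poly_Mapping.single 0 c * f \<in> forms_deg N d"
  using forms_deg_mult[OF forms_deg_const] by fastforce

lemma formsE:
  assumes "f \<in> forms N"
  obtains d where "f \<in> forms_deg N d"
  using assms by (auto simp: forms_def)

lemma forms_mult: "f \<in> forms N \<Longrightarrow> g \<in> forms N \<Longrightarrow> f * g \<in> forms N"
  using forms_deg_mult by (blast elim: formsE)

lemma forms_pvar: "i \<le> N \<Longrightarrow> pvar i \<in> forms N"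
  using forms_deg_pvar by blast

lemma forms_power: "f \<in> forms N \<Longrightarrow> f ^ k \<in> forms N"
  using forms_deg_power by (blast elim: formsE)

section \<open>Forms as functions: dependence on the coordinates, homogeneity, the zero form\<close>

lemma mono_eval_cong: "(\<And>i. i \<in> Poly_Mapping.keys m \<Longrightarrow> v i = w i) \<Longrightarrow> mono_eval m v = mono_eval m w"
  by (simp add: mono_eval_def)

lemma peval_conv_mono: "peval f v = (\<Sum>m\<in>Poly_Mapping.keys f. Poly_Mapping.lookup f m * mono_eval m v)"
  by (simp add: peval_def mono_eval_def)

lemma peval_form_cong:
  assumes "f \<in> forms N" "\<And>i. i \<le> N \<Longrightarrow> v i = w i"
  shows "peval f v = peval f w"
  unfolding peval_conv_mono
  by (intro sum.cong arg_cong2[where f = "(*)"] refl mono_eval_cong)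
    (use assms in \<open>auto simp: forms_def forms_deg_def subset_iff\<close>)

lemma peval_homogeneous:
  assumes "f \<in> forms_deg N d"
  shows "peval f (\<lambda>i. c * v i) = c ^ d * peval f v"
proof -
  have "mono_eval m (\<lambda>i. c * v i) = c ^ d * mono_eval m v" if "m \<in> Poly_Mapping.keys f" for m
  proof -
    have "(\<Sum>i\<in>Poly_Mapping.keys m. Poly_Mapping.lookup m i) = d"
      using assms that by (auto simp: forms_deg_def)
    then show ?thesis
      by (simp add: mono_eval_def power_mult_distrib prod.distrib flip: power_sum)
  qed
  then show ?thesis
    by (simp add: peval_conv_mono sum_distrib_left algebra_simps)
qed

text \<open>Induction on the number \<open>n\<close> of variables that suffice to tell the monomials in \<open>S\<close> apart:
  group the monomials by the exponent of the last one.\<close>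

lemma monomials_independent:
  fixes S :: "(nat \<Rightarrow> nat) set" and c :: "(nat \<Rightarrow> nat) \<Rightarrow> complex"
  assumes "finite S" "\<And>m m'. m \<in> S \<Longrightarrow> m' \<in> S \<Longrightarrow> (\<forall>i<n. m i = m' i) \<Longrightarrow> m = m'"
    and "\<And>v. (\<Sum>m\<in>S. c m * (\<Prod>i<n. v i ^ m i)) = 0"
    and "m \<in> S"
  shows "c m = 0"
  using assms
proof (induction n arbitrary: S m)
  case 0
  then have "S = {m}" by auto
  with 0 show ?case by simp
next
  case (Suc n)
  let ?k = "m n"
  let ?T = "\<lambda>k. {m \<in> S. m n = k}"
  obtain B where B: "\<And>m. m \<in> S \<Longrightarrow> m n \<le> B"
    using Suc.prems(1) finite_nat_set_iff_bounded_le[of "(\<lambda>m. m n) ` S"] by auto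
  have "(\<Sum>m\<in>?T ?k. c m * (\<Prod>i<n. v i ^ m i)) = 0" for v
  proof -
    let ?d = "\<lambda>k. \<Sum>m\<in>?T k. c m * (\<Prod>i<n. v i ^ m i)"
    have "(\<Sum>k\<le>B. ?d k * x ^ k) = 0" for x
    proof -
      have "(\<Sum>k\<le>B. ?d k * x ^ k) =
          (\<Sum>k\<le>B. \<Sum>m\<in>?T k. c m * (\<Prod>i<Suc n. (v(n := x)) i ^ m i))"
        by (auto simp: sum_distrib_right mult.assoc intro!: sum.cong)
      also have "\<dots> = (\<Sum>m\<in>S. c m * (\<Prod>i<Suc n. (v(n := x)) i ^ m i))"
        by (rule sum.group) (use Suc.prems(1) B in auto)
      also have "\<dots> = 0" by (rule Suc.prems(3))
      finally show ?thesis .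
    qed
    then show ?thesis
      using polyfun_eq_0[of ?d B] B[OF Suc.prems(4)] by blast
  qed
  moreover have "finite (?T ?k)" using Suc.prems(1) by simp
  moreover have "p = q" if "p \<in> ?T ?k" "q \<in> ?T ?k" "\<forall>i<n. p i = q i" for p q
    using that Suc.prems(2)[of p q] less_Suc_eq by auto
  ultimately show ?case
    using Suc.IH[of "?T ?k" m] Suc.prems(4) by blast
qed

text \<open>Independence of monomial functions over the infinite field; it is needed because the
  theorem speaks of nonzero formal polynomials while all later arguments concern their
  values.\<close>

lemma form_eq_zeroI:
  assumes f: "f \<in> forms_deg N d" and 0: "\<And>v. peval f v = 0"
  shows "f = 0"
proof -
  let ?S = "Poly_Mapping.lookup ` Poly_Mapping.keys f"
  have inj: "inj_on Poly_Mapping.lookup (Poly_Mapping.keys f)"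
    by (auto intro!: inj_onI poly_mapping_eqI)
  have supp: "Poly_Mapping.keys m \<subseteq> {..<Suc N}" if "m \<in> Poly_Mapping.keys f" for m
    using f that by (auto simp: forms_deg_def less_Suc_eq_le subset_iff)
  \<comment> \<open>Coefficients are indexed by plain exponent functions;
    \<open>Abs_poly_mapping\<close> is only relevant on \<open>?S\<close>, whose members are all of
    the form \<open>Poly_Mapping.lookup m\<close>.\<close>
  let ?c = "\<lambda>a. Poly_Mapping.lookup f (Abs_poly_mapping a)"
  have c: "?c (Poly_Mapping.lookup m) = Poly_Mapping.lookup f m" for m
    by simp
  have "?c a = 0" if "a \<in> ?S" for a
  proof (rule monomials_independent[where c = ?c and S = ?S and n = "Suc N"])
    show "p = q" if pq: "p \<in> ?S" "q \<in> ?S" "\<forall>i<Suc N. p i = q i" for p q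
    proof
      fix i show "p i = q i"
      proof (cases "i < Suc N")
        case False
        then have "p i = 0" "q i = 0"
          using pq(1,2) supp by (auto simp: in_keys_iff subset_iff)
        then show ?thesis by simp
      qed (use pq(3) in simp)
    qed
    show "(\<Sum>m\<in>?S. ?c m * (\<Prod>i<Suc N. v i ^ m i)) = 0" for v
    proof -
      have "(\<Sum>m\<in>?S. ?c m * (\<Prod>i<Suc N. v i ^ m i)) = peval f v"
        unfolding peval_conv_mono
        by (subst sum.reindex[OF inj])
          (auto intro!: sum.cong simp: mono_eval_superset[OF finite_lessThan supp])
      then show ?thesis by (simp add: 0)
    qed
  qed (use that in auto)
  then have "Poly_Mapping.keys f = {}"
    using c by (metis all_not_in_conv imageI in_keys_iff)
  then show ?thesis by simp
qed

section \<open>Points and closed subsets of projective space\<close>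

definition point_of :: "(nat \<Rightarrow> complex) \<Rightarrow> ppoint" where
  "point_of v = {w. \<exists>c. c \<noteq> 0 \<and> w = (\<lambda>i. c * v i)}"

lemma point_of_self: "v \<in> point_of v"
  by (auto simp: point_of_def intro: exI[of _ 1])

lemma coord_vectors_scale: "v \<in> coord_vectors N \<Longrightarrow> c \<noteq> 0 \<Longrightarrow> (\<lambda>i. c * v i) \<in> coord_vectors N"
  by (auto simp: coord_vectors_def)

lemma proj_space_conv: "proj_space N = point_of ` coord_vectors N"
proof -
  have "{(v, w). v \<in> coord_vectors N \<and> w \<in> coord_vectors N \<and> (\<exists>c. c \<noteq> 0 \<and> w = (\<lambda>i. c * v i))} `` {v}
      = point_of v" if "v \<in> coord_vectors N" for v
    using that by (auto simp: point_of_def coord_vectors_scale)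
  then show ?thesis
    unfolding proj_space_def quotient_def by auto
qed

lemma proj_spaceE:
  assumes "P \<in> proj_space N"
  obtains v where "v \<in> coord_vectors N" "P = point_of v"
  using assms by (auto simp: proj_space_conv)

lemma point_of_in_proj_space: "v \<in> coord_vectors N \<Longrightarrow> point_of v \<in> proj_space N"
  by (auto simp: proj_space_conv)

text \<open>By homogeneity one representative decides for all of them.\<close>

lemma vanishes_on_point_iff:
  assumes "f \<in> forms N"
  shows "vanishes_on f {point_of v} \<longleftrightarrow> peval f v = 0"
  using assms point_of_self[of v]
  by (auto simp: vanishes_on_def point_of_def peval_homogeneous elim!: formsE)

lemma vanishes_on_singletons: "vanishes_on f Z \<longleftrightarrow> (\<forall>P\<in>Z. vanishes_on f {P})"
  by (auto simp: vanishes_on_def)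

lemma zariski_closed_subset: "zariski_closed N Z \<Longrightarrow> Z \<subseteq> proj_space N"
  by (auto simp: zariski_closed_def)

lemma zariski_closed_hypersurface:
  "f \<in> forms N \<Longrightarrow> zariski_closed N {P \<in> proj_space N. vanishes_on f {P}}"
  unfolding zariski_closed_def by (rule exI[of _ "{f}"]) auto

lemma vanishes_on_mult_point:
  assumes "f \<in> forms N" "g \<in> forms N" "P \<in> proj_space N"
  shows "vanishes_on (f * g) {P} \<longleftrightarrow> vanishes_on f {P} \<or> vanishes_on g {P}"
proof -
  obtain v where "P = point_of v" using assms(3) by (rule proj_spaceE)
  then show ?thesis using assms(1,2) by (simp add: vanishes_on_point_iff[of _ N] forms_mult)
qed

text \<open>A point of \<open>W\<close> outside \<open>Z\<close> violates one of the forms that cut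
  out \<open>Z\<close>. Such forms enter both the irreducibility criterion and the bound on
  chains.\<close>

lemma closed_separating_form:
  assumes "zariski_closed N Z" "W \<subseteq> proj_space N" "\<not> W \<subseteq> Z"
  obtains f where "f \<in> forms N" "vanishes_on f Z" "\<not> vanishes_on f W"
proof -
  obtain F where F: "F \<subseteq> forms N" "Z = {P \<in> proj_space N. \<forall>f\<in>F. vanishes_on f {P}}"
    using assms(1) by (auto simp: zariski_closed_def)
  then obtain P f where "P \<in> W" "f \<in> F" "\<not> vanishes_on f {P}"
    using assms by blast
  then show ?thesis
    using that[of f] F vanishes_on_singletons[of f] by blast
qed

lemma irreducible_set_prime:
  assumes irr: "irreducible_set N Z" and Z: "Z \<subseteq> proj_space N"
    and f: "f \<in> forms N" and g: "g \<in> forms N" and van: "vanishes_on (f * g) Z"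
  shows "vanishes_on f Z \<or> vanishes_on g Z"
proof -
  let ?V = "\<lambda>f. {P \<in> proj_space N. vanishes_on f {P}}"
  have "Z \<subseteq> ?V f \<union> ?V g"
    using vanishes_on_mult_point[OF f g] van Z vanishes_on_singletons by blast
  then have "Z \<subseteq> ?V f \<or> Z \<subseteq> ?V g"
    using irr zariski_closed_hypersurface f g by (auto simp: irreducible_set_def)
  then show ?thesis
    using vanishes_on_singletons by blast
qed

text \<open>If two closed sets cover \<open>Z\<close> and neither contains it, separating forms for
  them have a product vanishing on \<open>Z\<close>, against primeness of the ideal of
  \<open>Z\<close>.\<close>

lemma irreducible_setI:
  assumes "Z \<noteq> {}" "Z \<subseteq> proj_space N"
    and prime: "\<And>f g. f \<in> forms N \<Longrightarrow> g \<in> forms N \<Longrightarrow> vanishes_on (f * g) Z \<Longrightarrow>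
      vanishes_on f Z \<or> vanishes_on g Z"
  shows "irreducible_set N Z"
  unfolding irreducible_set_def
proof (intro conjI allI impI)
  fix A B assume AB: "zariski_closed N A \<and> zariski_closed N B \<and> Z \<subseteq> A \<union> B"
  show "Z \<subseteq> A \<or> Z \<subseteq> B"
  proof (rule ccontr)
    assume "\<not> (Z \<subseteq> A \<or> Z \<subseteq> B)"
    then obtain f g where f: "f \<in> forms N" "vanishes_on f A" "\<not> vanishes_on f Z"
      and g: "g \<in> forms N" "vanishes_on g B" "\<not> vanishes_on g Z"
      using AB assms(2) closed_separating_form by (metis (no_types, lifting))
    have "vanishes_on (f * g) Z"
      using f(2) g(2) AB by (auto simp: vanishes_on_def)
    then show False using prime f g by blast
  qed
qed fact

section \<open>Chains of closed subvarieties\<close>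

abbreviation const_form :: "complex \<Rightarrow> cpoly" where
  "const_form c \<equiv> Poly_Mapping.single 0 c"

interpretation cpoly: vector_space "\<lambda>c (f :: cpoly). const_form c * f"
  by unfold_locales (auto simp: algebra_simps single_add mult_single simp flip: mult.assoc)

text \<open>Linear independence in the homogeneous coordinate ring of \<open>Z\<close>, that is,
  modulo the forms vanishing on \<open>Z\<close>. An indexed family lets products be counted by
  their index set.\<close>

definition independent_on :: "ppoint set \<Rightarrow> 'i set \<Rightarrow> ('i \<Rightarrow> cpoly) \<Rightarrow> bool" where
  "independent_on Z I b \<longleftrightarrow>
     (\<forall>c. vanishes_on (\<Sum>i\<in>I. const_form (c i) * b i) Z \<longrightarrow> (\<forall>i\<in>I. c i = 0))"

text \<open>The last exponent is determined by the degree and the other \<open>N\<close>, which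
  explains the power \<open>N\<close> for \<open>N + 1\<close> variables. The bound on chain lengths
  is sharp because of this saving.\<close>

lemma card_monomials_le:
  "finite {m. Poly_Mapping.keys m \<subseteq> {..N} \<and> (\<Sum>i\<le>N. Poly_Mapping.lookup m i) = K} \<and>
   card {m. Poly_Mapping.keys m \<subseteq> {..N} \<and> (\<Sum>i\<le>N. Poly_Mapping.lookup m i) = K} \<le> Suc K ^ N"
  (is "finite ?M \<and> card ?M \<le> _")
proof -
  let ?r = "\<lambda>m. restrict (Poly_Mapping.lookup m) {..<N}"
  have inj: "inj_on ?r ?M"
  proof (rule inj_onI)
    fix m m' assume m: "m \<in> ?M" and m': "m' \<in> ?M" and eq: "?r m = ?r m'"
    have lt: "Poly_Mapping.lookup m i = Poly_Mapping.lookup m' i" if "i < N" for i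
      using fun_cong[OF eq, of i] that by simp
    have "Poly_Mapping.lookup m N + (\<Sum>i<N. Poly_Mapping.lookup m i) =
        Poly_Mapping.lookup m' N + (\<Sum>i<N. Poly_Mapping.lookup m' i)"
      using m m' by (simp flip: lessThan_Suc_atMost)
    then have N: "Poly_Mapping.lookup m N = Poly_Mapping.lookup m' N"
      using lt by simp
    show "m = m'"
    proof (rule poly_mapping_eqI)
      fix i
      consider "i < N" | "i = N" | "i > N" by linarith
      then show "Poly_Mapping.lookup m i = Poly_Mapping.lookup m' i"
      proof cases
        case 3
        then have "i \<notin> Poly_Mapping.keys m" "i \<notin> Poly_Mapping.keys m'"
          using m m' by auto
        then show ?thesis by (simp add: in_keys_iff)
      qed (use lt N in auto)
    qed
  qed
  have le: "Poly_Mapping.lookup m i \<le> K" if "m \<in> ?M" "i < N" for m i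
    using that member_le_sum[of i "{..N}" "Poly_Mapping.lookup m"] by auto
  have sub: "?r ` ?M \<subseteq> (\<Pi>\<^sub>E i\<in>{..<N}. {..K})"
    using le by (auto simp: PiE_def)
  have fin: "finite (\<Pi>\<^sub>E i\<in>{..<N}. {..K})"
    by (intro finite_PiE) auto
  have "card ?M \<le> card (\<Pi>\<^sub>E i\<in>{..<N}. {..K})"
    by (rule card_inj_on_le[OF inj sub fin])
  also have "\<dots> = Suc K ^ N"
    by (simp add: card_PiE)
  finally show ?thesis
    using inj_on_finite[OF inj sub fin] by simp
qed

text \<open>Independence on \<open>Z\<close> implies independence as polynomials, so the number of
  monomials of degree \<open>K\<close> is a bound.\<close>

lemma independent_on_card_le:
  assumes ind: "independent_on Z I b" and fin: "finite I"
    and b: "\<And>i. i \<in> I \<Longrightarrow> b i \<in> forms_deg N K"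
  shows "card I \<le> Suc K ^ N"
proof -
  let ?M = "{m. Poly_Mapping.keys m \<subseteq> {..N} \<and> (\<Sum>i\<le>N. Poly_Mapping.lookup m i) = K}"
  have zero: "c i = 0" if "(\<Sum>i\<in>I. const_form (c i) * b i) = 0" "i \<in> I" for c i
    using ind that unfolding independent_on_def vanishes_on_def by (metis peval_zero)
  have inj: "inj_on b I"
  proof (rule inj_onI, rule ccontr)
    fix i j assume ij: "i \<in> I" "j \<in> I" "b i = b j" "i \<noteq> j"
    \<comment> \<open>A repeated member would give the nontrivial relation with coefficients 1 and
      -1.\<close>
    let ?c = "\<lambda>l. (if l = i then 1 else 0) - (if l = j then 1 else 0 :: complex)"
    have "(\<Sum>l\<in>I. const_form (?c l) * b l) =
        (\<Sum>l\<in>I. (if l = i then b i else 0) - (if l = j then b j else 0))"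
      by (rule sum.cong) (auto simp: single_diff algebra_simps single_uminus)
    also have "\<dots> = 0"
      using ij fin by (simp add: sum_subtractf)
    finally have "?c i = 0" using zero[of ?c i] ij(1) by blast
    then show False using ij(4) by simp
  qed
  have "cpoly.independent (b ` I)"
  proof (rule cpoly.independent_if_scalars_zero)
    fix c x assume s: "(\<Sum>x\<in>b ` I. const_form (c x) * x) = 0" and x: "x \<in> b ` I"
    have "(\<Sum>i\<in>I. const_form (c (b i)) * b i) = 0"
      using s by (simp add: sum.reindex[OF inj])
    then show "c x = 0"
      using zero[of "\<lambda>i. c (b i)"] x by auto
  qed (use fin in simp)
  moreover have "b ` I \<subseteq> cpoly.span ((\<lambda>m. Poly_Mapping.single m 1) ` ?M)"
  proof
    fix f assume "f \<in> b ` I"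
    then have f: "f \<in> forms_deg N K" using b by auto
    have "(\<Sum>m\<in>Poly_Mapping.keys f. const_form (Poly_Mapping.lookup f m) * Poly_Mapping.single m 1)
        \<in> cpoly.span ((\<lambda>m. Poly_Mapping.single m 1) ` ?M)"
      by (intro cpoly.span_sum cpoly.span_scale cpoly.span_base)
        (use f in \<open>auto simp: forms_deg_iff\<close>)
    then show "f \<in> cpoly.span ((\<lambda>m. Poly_Mapping.single m 1) ` ?M)"
      by (simp add: mult_single flip: poly_mapping_expand)
  qed
  ultimately have "card (b ` I) \<le> card ((\<lambda>m. Poly_Mapping.single m (1 :: complex)) ` ?M)"
    using cpoly.independent_span_bound[of "(\<lambda>m. Poly_Mapping.single m 1) ` ?M"]
      card_monomials_le by blast
  also have "\<dots> \<le> card ?M"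
    using card_monomials_le by (intro card_image_le) blast
  also have "\<dots> \<le> Suc K ^ N"
    using card_monomials_le by blast
  finally show ?thesis by (simp add: card_image[OF inj])
qed

lemma vanishes_on_power_mult_cancel:
  assumes "irreducible_set N Z" "Z \<subseteq> proj_space N" "f \<in> forms N" "\<not> vanishes_on f Z"
    and g: "g \<in> forms N" "vanishes_on (f ^ k * g) Z"
  shows "vanishes_on g Z"
  using g
proof (induction k)
  case (Suc k)
  then have "vanishes_on (f * (f ^ k * g)) Z" by (simp add: mult.assoc)
  then have "vanishes_on (f ^ k * g) Z"
    using irreducible_set_prime[OF assms(1-3)] assms(3,4) Suc.prems(1)
    by (meson forms_mult forms_power)
  then show ?case using Suc by blast
qed simp

text \<open>A relation, grouped by powers of \<open>g\<close>, is resolved from the lowest power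
  upwards: irreducibility of \<open>Z\<close> allows cancelling \<open>g ^ a\<close>, and
  restriction to \<open>W\<close>, where \<open>g\<close> vanishes, then isolates the coefficient of
  \<open>g ^ a\<close>. The degrees \<open>K - a * e\<close> give all products degree
  \<open>K\<close>.\<close>

lemma independent_on_extend:
  assumes irr: "irreducible_set N Z" "Z \<subseteq> proj_space N" and W: "W \<subseteq> Z"
    and g: "g \<in> forms_deg N e" "vanishes_on g W" "\<not> vanishes_on g Z"
    and fin: "\<And>a. a < D \<Longrightarrow> finite (I a)" and K: "D * e \<le> K"
    and b: "\<And>a i. a < D \<Longrightarrow> i \<in> I a \<Longrightarrow> b a i \<in> forms_deg N (K - a * e)"
    and ind: "\<And>a. a < D \<Longrightarrow> independent_on W (I a) (b a)"
  shows "independent_on Z (Sigma {..<D} I) (\<lambda>(a, i). g ^ a * b a i)"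
  unfolding independent_on_def
proof (intro allI impI)
  fix c assume van: "vanishes_on
    (\<Sum>i\<in>Sigma {..<D} I. const_form (c i) * (case i of (a, i) \<Rightarrow> g ^ a * b a i)) Z"
  define Q where "Q a = (\<Sum>i\<in>I a. const_form (c (a, i)) * b a i)" for a
  have Q: "Q a \<in> forms_deg N (K - a * e)" if "a < D" for a
    unfolding Q_def using b that by (intro forms_deg_sum forms_deg_scale) auto
  have "(\<Sum>i\<in>Sigma {..<D} I. const_form (c i) * (case i of (a, i) \<Rightarrow> g ^ a * b a i)) =
      (\<Sum>a<D. g ^ a * Q a)"
  proof -
    have "(\<Sum>a<D. g ^ a * Q a) = (\<Sum>a<D. \<Sum>i\<in>I a. const_form (c (a, i)) * (g ^ a * b a i))"
      by (simp add: Q_def sum_distrib_left algebra_simps)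
    also have "\<dots> = (\<Sum>(a, i)\<in>Sigma {..<D} I. const_form (c (a, i)) * (g ^ a * b a i))"
      by (rule sum.Sigma) (use fin in auto)
    finally show ?thesis by (simp add: case_prod_beta)
  qed
  with van have van: "vanishes_on (\<Sum>a<D. g ^ a * Q a) Z" by (simp only:)
  have "\<forall>i\<in>I a. c (a, i) = 0" if "a < D" for a
    using that
  proof (induction a rule: less_induct)
    case (less a)
    \<comment> \<open>The terms beyond the power \<open>a\<close>, divided by
      \<open>g ^ Suc a\<close>.\<close>
    define R where "R = (\<Sum>a'\<in>{Suc a..<D}. g ^ (a' - Suc a) * Q a')"
    have "(\<Sum>a'<D. g ^ a' * Q a') = (\<Sum>a'<a. g ^ a' * Q a') + (\<Sum>a'\<in>{a..<D}. g ^ a' * Q a')"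
      using less.prems sum.atLeastLessThan_concat[of 0 a D "\<lambda>a'. g ^ a' * Q a'"]
      by (simp add: atLeast0LessThan)
    also have "(\<Sum>a'<a. g ^ a' * Q a') = 0"
      using less by (intro sum.neutral) (auto simp: Q_def)
    also have "(\<Sum>a'\<in>{a..<D}. g ^ a' * Q a') =
        g ^ a * Q a + (\<Sum>a'\<in>{Suc a..<D}. g ^ a' * Q a')"
      using less.prems by (simp add: sum.atLeast_Suc_lessThan)
    also have "(\<Sum>a'\<in>{Suc a..<D}. g ^ a' * Q a') = g ^ a * (g * R)"
      unfolding R_def sum_distrib_left
    proof (rule sum.cong)
      fix x assume "x \<in> {Suc a..<D}"
      then have "x = a + Suc (x - Suc a)" by auto
      then have "g ^ x = g ^ a * (g * g ^ (x - Suc a))"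
        by (metis power_Suc power_add)
      then show "g ^ x * Q x = g ^ a * (g * (g ^ (x - Suc a) * Q x))"
        by (simp add: mult.assoc)
    qed simp
    finally have "vanishes_on (g ^ a * (Q a + g * R)) Z"
      using van by (simp add: distrib_left)
    moreover have "Q a + g * R \<in> forms_deg N (K - a * e)"
    proof -
      have "g * (g ^ (a' - Suc a) * Q a') \<in> forms_deg N (K - a * e)" if "a' \<in> {Suc a..<D}" for a'
      proof -
        have "g * (g ^ (a' - Suc a) * Q a') \<in> forms_deg N (e + ((a' - Suc a) * e + (K - a' * e)))"
          using that Q g(1) by (intro forms_deg_mult forms_deg_power) auto
        moreover have "e + ((a' - Suc a) * e + (K - a' * e)) = K - a * e"
        proof -
          have "Suc a \<le> a'" using that by simp
          then obtain t where t: "a' = Suc a + t"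
            using le_Suc_ex by blast
          have "a' * e \<le> K"
            using that K by (meson atLeastLessThan_iff le_trans less_imp_le_nat mult_le_mono1)
          then show ?thesis using t by (simp add: algebra_simps)
        qed
        ultimately show ?thesis by simp
      qed
      then show ?thesis
        using Q[OF less.prems] unfolding R_def sum_distrib_left
        by (intro forms_deg_add forms_deg_sum) auto
    qed
    ultimately have "vanishes_on (Q a + g * R) Z"
      using vanishes_on_power_mult_cancel[OF irr] g by blast
    then have "vanishes_on (Q a) W"
      using W g(2) unfolding vanishes_on_def by (fastforce simp: subset_iff)
    then show ?case
      using ind[OF less.prems] by (auto simp: independent_on_def Q_def)
  qed
  then show "\<forall>i\<in>Sigma {..<D} I. c i = 0" by auto
qed

text \<open>Lets the pair indices from \<open>independent_on_extend\<close> be recoded as lists, so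
  that the index type stays fixed during the induction along a chain.\<close>

lemma independent_on_reindex:
  assumes "inj_on h I" "independent_on Z I b"
  shows "independent_on Z (h ` I) (\<lambda>x. b (inv_into I h x))"
  unfolding independent_on_def
proof (intro allI impI)
  fix c assume "vanishes_on (\<Sum>i\<in>h ` I. const_form (c i) * b (inv_into I h i)) Z"
  then have "vanishes_on (\<Sum>i\<in>I. const_form (c (h i)) * b i) Z"
    using assms(1) by (simp add: sum.reindex)
  then have "\<forall>i\<in>I. c (h i) = 0"
    using assms(2)[unfolded independent_on_def, rule_format, of "\<lambda>i. c (h i)"] by blast
  then show "\<forall>i\<in>h ` I. c i = 0" by simp
qed

text \<open>A chain of length \<open>k\<close> yields forms \<open>g\<^sub>j\<close> vanishing on \<open>C\<^sub>j\<close> but not on \<open>C\<^sub>j\<^sub>+\<^sub>1\<close>, and the products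
  of their powers are linearly independent; as there are about \<open>D\<^sup>k\<close> of them in a degree growing
  linearly with \<open>D\<close>, while only \<open>O(D\<^sup>N)\<close> monomials are available, \<open>k\<close> is at most \<open>N\<close>.\<close>

lemma closed_subvariety_chain_length:
  assumes cl: "\<And>i. i \<le> k \<Longrightarrow> closed_subvariety N (C i)"
    and chain: "\<And>i. i < k \<Longrightarrow> C i \<subset> C (Suc i)"
  shows "k \<le> N"
proof -
  have sub: "C i \<subseteq> proj_space N" and irr: "irreducible_set N (C i)" if "i \<le> k" for i
    using cl[OF that] by (auto simp: closed_subvariety_def dest: zariski_closed_subset)
  have "C 0 \<noteq> {}" using irr[of 0] by (simp add: irreducible_set_def)
  then obtain v where v: "point_of v \<in> C 0" "v \<in> coord_vectors N"
    using sub[of 0] by (auto elim: proj_spaceE)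
  \<comment> \<open>A variable not vanishing on the smallest member: its powers give one independent
    form in every degree, which starts the induction.\<close>
  then obtain l where l: "v l \<noteq> 0" "l \<le> N"
    by (auto simp: coord_vectors_def) (meson leI)
  have x: "\<not> vanishes_on (pvar l ^ K) (C 0)" for K
    using v(1) l(1) point_of_self[of v] by (auto simp: vanishes_on_def)
  have "\<exists>g e. g \<in> forms_deg N e \<and> vanishes_on g (C i) \<and> \<not> vanishes_on g (C (Suc i))" if i: "i < k" for i
  proof -
    obtain g where "g \<in> forms N" "vanishes_on g (C i)" "\<not> vanishes_on g (C (Suc i))"
      using closed_separating_form[of N "C i" "C (Suc i)" thesis] cl[of i] sub[of "Suc i"] chain[OF i] i
      by (auto simp: closed_subvariety_def)
    then show ?thesis by (meson formsE)
  qed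
  then obtain g e where g: "\<And>i. i < k \<Longrightarrow> g i \<in> forms_deg N (e i)"
      "\<And>i. i < k \<Longrightarrow> vanishes_on (g i) (C i)" "\<And>i. i < k \<Longrightarrow> \<not> vanishes_on (g i) (C (Suc i))"
    by metis
  have main: "\<exists>(I :: nat list set) b. finite I \<and> card I = D ^ j \<and>
      (\<forall>i\<in>I. b i \<in> forms_deg N K) \<and> independent_on (C j) I b"
    if "j \<le> k" "D * (\<Sum>i<j. e i) \<le> K" for j D K
    using that
  proof (induction j arbitrary: K)
    case 0
    have "independent_on (C 0) {[]} (\<lambda>_ :: nat list. pvar l ^ K)"
      using x[of K] by (auto simp: independent_on_def vanishes_on_def)
    moreover have "pvar l ^ K \<in> forms_deg N K"
      using forms_deg_power[OF forms_deg_pvar[OF l(2)], of K] by simp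
    ultimately show ?case
      by (intro exI[of _ "{[]}"] exI[of _ "\<lambda>_. pvar l ^ K"]) auto
  next
    case (Suc j)
    have "\<exists>(I :: nat list set) b. finite I \<and> card I = D ^ j \<and>
      (\<forall>i\<in>I. b i \<in> forms_deg N (K - a * e j)) \<and> independent_on (C j) I b" if "a < D" for a
    proof (rule Suc.IH)
      have "D * (\<Sum>i<j. e i) + D * e j \<le> K"
        using Suc.prems by (simp add: distrib_left)
      moreover have "a * e j \<le> D * e j"
        using that by (intro mult_le_mono1) simp
      ultimately show "D * (\<Sum>i<j. e i) \<le> K - a * e j" by linarith
    qed (use Suc.prems in simp)
    then obtain I :: "nat \<Rightarrow> nat list set" and b where
      I: "\<And>a. a < D \<Longrightarrow> finite (I a)" "\<And>a. a < D \<Longrightarrow> card (I a) = D ^ j"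
      "\<And>a i. a < D \<Longrightarrow> i \<in> I a \<Longrightarrow> b a i \<in> forms_deg N (K - a * e j)"
      "\<And>a. a < D \<Longrightarrow> independent_on (C j) (I a) (b a)"
      by metis
    let ?I = "Sigma {..<D} I"
    let ?b = "\<lambda>(a, i). g j ^ a * b a i"
    let ?h = "\<lambda>(a, i). a # i"
    have jk: "j < k" and K: "D * e j \<le> K"
      using Suc.prems by (auto simp: algebra_simps)
    have inj: "inj_on ?h ?I" by (auto simp: inj_on_def)
    have ind: "independent_on (C (Suc j)) ?I ?b"
      by (rule independent_on_extend[OF irr sub _ g(1)[OF jk] g(2)[OF jk] g(3)[OF jk]])
        (use jk K I chain[OF jk] in auto)
    have bK: "?b i \<in> forms_deg N K" if i: "i \<in> ?I" for i
    proof -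
      obtain a i' where ai: "i = (a, i')" "a < D" "i' \<in> I a" using i by auto
      have "g j ^ a * b a i' \<in> forms_deg N (a * e j + (K - a * e j))"
        using ai I(3) g(1)[OF jk] by (intro forms_deg_mult forms_deg_power) auto
      moreover have "a * e j \<le> K"
        using ai K by (meson le_trans less_imp_le_nat mult_le_mono1)
      ultimately show ?thesis using ai by simp
    qed
    have "\<forall>x\<in>?h ` ?I. ?b (inv_into ?I ?h x) \<in> forms_deg N K"
    proof
      fix x assume "x \<in> ?h ` ?I"
      then show "?b (inv_into ?I ?h x) \<in> forms_deg N K"
        by (intro bK inv_into_into)
    qed
    moreover have "card (?h ` ?I) = D ^ Suc j"
      using I(1,2) by (simp add: card_image[OF inj])
    moreover have "finite (?h ` ?I)" using I(1) by auto
    ultimately show ?case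
      using independent_on_reindex[OF inj ind]
      by (intro exI[of _ "?h ` ?I"] exI[of _ "\<lambda>x. ?b (inv_into ?I ?h x)"] conjI)
  qed
  show "k \<le> N"
  proof (rule ccontr)
    assume "\<not> k \<le> N"
    \<comment> \<open>Degree \<open>D * E\<close> accommodates all \<open>D ^ k\<close> products,
      while at most \<open>D ^ N * Suc E ^ N\<close> forms there can be independent. The choice of
      \<open>D\<close> just above \<open>Suc E ^ N\<close> makes the latter smaller than
      \<open>D ^ Suc N\<close>.\<close>
    define E where "E = (\<Sum>i<k. e i)"
    define D where "D = Suc (Suc E ^ N)"
    obtain I :: "nat list set" and b where "finite I" "card I = D ^ k"
        "\<forall>i\<in>I. b i \<in> forms_deg N (D * E)" "independent_on (C k) I b"
      using main[of k D "D * E"] by (auto simp: E_def)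
    then have "D ^ k \<le> Suc (D * E) ^ N"
      using independent_on_card_le[of "C k" I b N "D * E"] by simp
    also have "\<dots> \<le> (D * Suc E) ^ N"
      by (rule power_mono) (auto simp: D_def)
    also have "\<dots> = D ^ N * Suc E ^ N"
      by (simp only: power_mult_distrib)
    also have "\<dots> < D ^ N * D"
      by (simp add: D_def)
    also have "\<dots> \<le> D ^ k"
    proof -
      have "D ^ Suc N \<le> D ^ k"
        by (rule power_increasing) (use \<open>\<not> k \<le> N\<close> in \<open>auto simp: D_def\<close>)
      then show ?thesis by (simp add: mult.commute)
    qed
    finally show False by simp
  qed
qed

section \<open>Polynomial functions on affine space\<close>

text \<open>Functions rather than formal polynomials: substituting the chart is then composition,
  and passing to a coordinate subspace is restriction of the argument.\<close>

inductive polyfun :: "nat \<Rightarrow> ((nat \<Rightarrow> complex) \<Rightarrow> complex) \<Rightarrow> bool" for N where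
  polyfun_const: "polyfun N (\<lambda>z. c)"
| polyfun_coord: "j < N \<Longrightarrow> polyfun N (\<lambda>z. z j)"
| polyfun_add: "polyfun N p \<Longrightarrow> polyfun N q \<Longrightarrow> polyfun N (\<lambda>z. p z + q z)"
| polyfun_mult: "polyfun N p \<Longrightarrow> polyfun N q \<Longrightarrow> polyfun N (\<lambda>z. p z * q z)"

lemma polyfun_diff:
  assumes "polyfun N p" "polyfun N q"
  shows "polyfun N (\<lambda>z. p z - q z)"
  using polyfun_add[OF assms(1) polyfun_mult[OF polyfun_const[of N "-1"] assms(2)]] by simp

lemma polyfun_power: "polyfun N p \<Longrightarrow> polyfun N (\<lambda>z. p z ^ k)"
  by (induction k) (auto intro: polyfun.intros)

lemma polyfun_sum: "(\<And>i. i \<in> S \<Longrightarrow> polyfun N (p i)) \<Longrightarrow> polyfun N (\<lambda>z. \<Sum>i\<in>S. p i z)"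
  by (induction S rule: infinite_finite_induct) (auto intro: polyfun.intros)

lemma polyfun_prod: "(\<And>i. i \<in> S \<Longrightarrow> polyfun N (p i)) \<Longrightarrow> polyfun N (\<lambda>z. \<Prod>i\<in>S. p i z)"
  by (induction S rule: infinite_finite_induct) (auto intro: polyfun.intros)

lemmas polyfun_intros =
  polyfun.intros polyfun_diff polyfun_power polyfun_sum polyfun_prod

lemma polyfun_compose:
  assumes "polyfun M p" "\<And>j. j < M \<Longrightarrow> polyfun N (\<lambda>z. g z j)"
  shows "polyfun N (\<lambda>z. p (g z))"
  using assms by (induction rule: polyfun.induct) (auto intro: polyfun.intros)

lemma polyfun_peval:
  assumes "f \<in> forms N"
  shows "polyfun (Suc N) (peval f)"
proof -
  have "polyfun (Suc N) (mono_eval m)" if "m \<in> Poly_Mapping.keys f" for m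
    unfolding mono_eval_def[abs_def] using that assms
    by (intro polyfun_intros) (auto simp: forms_def forms_deg_def subset_iff less_Suc_eq_le)
  then show ?thesis
    unfolding peval_conv_mono[abs_def] by (intro polyfun_intros)
qed

text \<open>Reduces nonvanishing in several variables to univariate polynomials, which have finitely
  many roots unless they are zero.\<close>

lemma polyfun_restrict_line:
  assumes "polyfun N p"
  shows "\<exists>P. \<forall>t. p (\<lambda>i. x i + t * y i) = poly P t"
  using assms
proof induction
  case (polyfun_const c)
  show ?case by (intro exI[of _ "[:c:]"]) simp
next
  case (polyfun_coord j)
  show ?case by (intro exI[of _ "[:x j, y j:]"]) simp
next
  case (polyfun_add p q)
  then obtain P Q where "\<And>t. p (\<lambda>i. x i + t * y i) = poly P t" "\<And>t. q (\<lambda>i. x i + t * y i) = poly Q t"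
    by blast
  then show ?case by (intro exI[of _ "P + Q"]) simp
next
  case (polyfun_mult p q)
  then obtain P Q where "\<And>t. p (\<lambda>i. x i + t * y i) = poly P t" "\<And>t. q (\<lambda>i. x i + t * y i) = poly Q t"
    by blast
  then show ?case by (intro exI[of _ "P * Q"]) simp
qed

lemma polyfun_divide:
  assumes "polyfun N p" "i < N"
  shows "\<exists>t. polyfun N t \<and> (\<forall>z. p z = p (z(i := 0)) + z i * t z)"
  using assms(1)
proof induction
  case (polyfun_const c)
  show ?case by (intro exI[of _ "\<lambda>z. 0"]) (auto intro: polyfun_intros)
next
  case (polyfun_coord j)
  then show ?case
    by (intro exI[of _ "\<lambda>z. if j = i then 1 else 0"]) (auto intro: polyfun_intros)
next
  case (polyfun_add p q)
  then obtain s t where s: "polyfun N s" and p: "\<And>z. p z = p (z(i := 0)) + z i * s z"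
    and t: "polyfun N t" and q: "\<And>z. q z = q (z(i := 0)) + z i * t z" by blast
  show ?case
  proof (intro exI[of _ "\<lambda>z. s z + t z"] conjI allI)
    show "polyfun N (\<lambda>z. s z + t z)" by (intro polyfun_intros s t)
    show "p z + q z = p (z(i := 0)) + q (z(i := 0)) + z i * (s z + t z)" for z
      using p[of z] q[of z] by (simp add: distrib_left)
  qed
next
  case (polyfun_mult p q)
  then obtain s t where s: "polyfun N s" and p: "\<And>z. p z = p (z(i := 0)) + z i * s z"
    and t: "polyfun N t" and q: "\<And>z. q z = q (z(i := 0)) + z i * t z" by blast
  \<comment> \<open>The factor \<open>p z - z i * s z\<close> is \<open>p (z(i := 0))\<close>,
    written so that the quotient is visibly a polynomial function.\<close>
  have *: "p z * q z = p (z(i := 0)) * q (z(i := 0)) + z i * (s z * q z + (p z - z i * s z) * t z)" for z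
  proof -
    have "p z - z i * s z = p (z(i := 0))" "q (z(i := 0)) = q z - z i * t z"
      using p[of z] q[of z] by auto
    then show ?thesis using p[of z] by (simp only:) (simp add: algebra_simps)
  qed
  show ?case
  proof (intro exI[of _ "\<lambda>z. s z * q z + (p z - z i * s z) * t z"] conjI allI)
    show "polyfun N (\<lambda>z. s z * q z + (p z - z i * s z) * t z)"
      by (intro polyfun_intros s t polyfun_mult.hyps assms)
  qed (rule *)
qed

text \<open>Entries from index \<open>N\<close> on are fixed to 0, so that functions on all naturals
  model affine \<open>N\<close>-space and \<open>coord_space N N\<close> is a single point.\<close>

definition coord_space :: "nat \<Rightarrow> nat \<Rightarrow> (nat \<Rightarrow> complex) set" where
  "coord_space N i = {z. \<forall>j. j < i \<or> N \<le> j \<longrightarrow> z j = 0}"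

lemma coord_space_mono: "i \<le> j \<Longrightarrow> coord_space N j \<subseteq> coord_space N i"
  by (auto simp: coord_space_def)

lemma coord_space_D: "z \<in> coord_space N i \<Longrightarrow> j < i \<or> N \<le> j \<Longrightarrow> z j = 0"
  by (auto simp: coord_space_def)

lemma coord_space_origin: "(\<lambda>_. 0) \<in> coord_space N i"
  by (simp add: coord_space_def)

lemma coord_space_full: "coord_space N N = {\<lambda>_. 0}"
  by (auto simp: coord_space_def fun_eq_iff) (meson not_le)

lemma coord_space_upd: "z \<in> coord_space N i \<Longrightarrow> z(i := 0) \<in> coord_space N (Suc i)"
  by (auto simp: coord_space_def less_Suc_eq)

text \<open>Coordinate subspaces are irreducible: two polynomial functions not vanishing at \<open>x\<close> and \<open>y\<close>
  restrict to nonzero univariate polynomials on the line through \<open>x\<close> and \<open>y\<close>.\<close>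

lemma polyfun_mult_nonvanishing:
  assumes p: "polyfun N p" "x \<in> coord_space N i" "p x \<noteq> 0"
    and q: "polyfun N q" "y \<in> coord_space N i" "q y \<noteq> 0"
  shows "\<exists>z\<in>coord_space N i. p z * q z \<noteq> 0"
proof -
  let ?l = "\<lambda>t j. x j + t * (y j - x j)"
  obtain P where P: "\<And>t. p (?l t) = poly P t"
    using polyfun_restrict_line[OF p(1), of x "\<lambda>j. y j - x j"] by blast
  obtain Q where Q: "\<And>t. q (?l t) = poly Q t"
    using polyfun_restrict_line[OF q(1), of x "\<lambda>j. y j - x j"] by blast
  have "poly P 0 \<noteq> 0" "poly Q 1 \<noteq> 0"
    using p(3) q(3) P[of 0] Q[of 1] by auto
  then have "P * Q \<noteq> 0" by auto
  then obtain t where "poly (P * Q) t \<noteq> 0"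
    using poly_all_0_iff_0 by blast
  moreover have "?l t \<in> coord_space N i"
    using p(2) q(2) by (auto simp: coord_space_def)
  ultimately show ?thesis
    using P[of t] Q[of t] by (intro bexI[of _ "?l t"]) auto
qed

section \<open>Cancellation and orders of vanishing on coordinate subspaces\<close>

abbreviation nonvanishing :: "nat \<Rightarrow> nat \<Rightarrow> ((nat \<Rightarrow> complex) \<Rightarrow> complex) \<Rightarrow> bool" where
  "nonvanishing N i p \<equiv> \<exists>z\<in>coord_space N i. p z \<noteq> 0"

lemma nonvanishing_mult:
  "polyfun N p \<Longrightarrow> polyfun N q \<Longrightarrow> nonvanishing N i p \<Longrightarrow> nonvanishing N i q \<Longrightarrow>
    nonvanishing N i (\<lambda>z. p z * q z)"
  using polyfun_mult_nonvanishing by blast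

lemma nonvanishing_power: "nonvanishing N i p \<Longrightarrow> nonvanishing N i (\<lambda>z. p z ^ k)"
  by auto

lemma nonvanishing_mono: "nonvanishing N j p \<Longrightarrow> i \<le> j \<Longrightarrow> nonvanishing N i p"
  using coord_space_mono by blast

lemma nonvanishing_coord: "i < N \<Longrightarrow> nonvanishing N i (\<lambda>z. z i)"
  by (rule bexI[of _ "\<lambda>j. if j = i then 1 else 0"]) (auto simp: coord_space_def)

text \<open>The polynomial functions on a coordinate subspace form an integral domain.\<close>

lemma polyfun_cancel:
  assumes "polyfun N p" "polyfun N q" "polyfun N r" "nonvanishing N i p"
    and "\<And>z. z \<in> coord_space N i \<Longrightarrow> p z * q z = p z * r z" "z \<in> coord_space N i"
  shows "q z = r z"
proof (rule ccontr)
  assume "q z \<noteq> r z"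
  then have "nonvanishing N i (\<lambda>z. q z - r z)" using assms(6) by auto
  then have "nonvanishing N i (\<lambda>z. p z * (q z - r z))"
    using assms by (intro nonvanishing_mult polyfun_diff)
  then show False using assms(5) by (simp add: algebra_simps)
qed

lemma coord_power_cancel:
  assumes "polyfun N p" "polyfun N q" "i < N"
    and "\<And>z. z \<in> coord_space N i \<Longrightarrow> z i ^ a * p z = z i ^ a * q z" "z \<in> coord_space N i"
  shows "p z = q z"
proof (rule polyfun_cancel[where p = "\<lambda>z. z i ^ a" and i = i and N = N and q = p and r = q and z = z])
  show "nonvanishing N i (\<lambda>z. z i ^ a)"
    using nonvanishing_power[OF nonvanishing_coord[OF assms(3)]] .
  show "polyfun N (\<lambda>z. z i ^ a)"
    using assms(3) by (intro polyfun_intros)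
qed (fact assms)+

text \<open>For \<open>b > a\<close>, cancelling \<open>z i ^ a\<close> would leave a positive power
  of \<open>z i\<close> on the right and force \<open>p\<close> to vanish on the next
  subspace.\<close>

lemma coord_power_le:
  assumes pq: "polyfun N p" "polyfun N q" "i < N"
    and eq: "\<And>z. z \<in> coord_space N i \<Longrightarrow> z i ^ a * p z = z i ^ b * q z"
    and nz: "nonvanishing N (Suc i) p"
  shows "b \<le> a"
proof (rule ccontr)
  assume "\<not> b \<le> a"
  then have b: "b = a + (b - a)" "b - a > 0" by auto
  have "p z = z i ^ (b - a) * q z" if "z \<in> coord_space N i" for z
  proof (rule coord_power_cancel[where a = a and N = N and i = i and p = p and q = "\<lambda>z. z i ^ (b - a) * q z"])
    show "z i ^ a * p z = z i ^ a * (z i ^ (b - a) * q z)" if "z \<in> coord_space N i" for z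
      using eq[OF that] b(1) by (metis mult.assoc power_add)
  qed (use pq that in \<open>auto intro!: polyfun_intros\<close>)
  moreover obtain z where "z \<in> coord_space N (Suc i)" "p z \<noteq> 0" using nz by blast
  ultimately show False
    using coord_space_mono[of i "Suc i" N] coord_space_D[of z N "Suc i" i] b(2)
    by (auto simp: subset_iff zero_power)
qed

lemma coord_power_unique:
  assumes "polyfun N p" "polyfun N q" "i < N"
    and "\<And>z. z \<in> coord_space N i \<Longrightarrow> z i ^ a * p z = z i ^ b * q z"
    and "nonvanishing N (Suc i) p" "nonvanishing N (Suc i) q"
  shows "a = b"
  using coord_power_le[OF assms(1-5)] coord_power_le[OF assms(2,1,3) assms(4)[symmetric] assms(6)]
  by simp

section \<open>Lexicographic orders of vanishing\<close>

text \<open>A polynomial has \<open>\<nu>\<close> as its lexicographically smallest exponent iff it starts such a chain.\<close>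

definition division_chain ::
  "nat \<Rightarrow> (nat \<Rightarrow> (nat \<Rightarrow> complex) \<Rightarrow> complex) \<Rightarrow> (nat \<Rightarrow> nat) \<Rightarrow> bool" where
  "division_chain N H \<nu> \<longleftrightarrow> (\<forall>i\<le>N. polyfun N (H i)) \<and>
     (\<forall>i<N. \<forall>z\<in>coord_space N i. H i z = z i ^ \<nu> i * H (Suc i) z) \<and> H N (\<lambda>_. 0) \<noteq> 0"

definition lex_order :: "nat \<Rightarrow> ((nat \<Rightarrow> complex) \<Rightarrow> complex) \<Rightarrow> (nat \<Rightarrow> nat) \<Rightarrow> bool" where
  "lex_order N h \<nu> \<longleftrightarrow> (\<exists>H. H 0 = h \<and> division_chain N H \<nu>)"

lemma division_chain_nonvanishing:
  assumes H: "division_chain N H \<nu>" and "i \<le> N"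
  shows "nonvanishing N i (H i)"
  using \<open>i \<le> N\<close>
proof (induction rule: inc_induct)
  case base
  show ?case using H by (auto simp: division_chain_def coord_space_full)
next
  case (step i)
  have "nonvanishing N i (\<lambda>z. z i ^ \<nu> i * H (Suc i) z)"
    using H step nonvanishing_mono[of N "Suc i" "H (Suc i)" i]
    by (intro nonvanishing_mult nonvanishing_power nonvanishing_coord)
      (auto simp: division_chain_def intro!: polyfun_intros)
  then show ?case
    using H step by (auto simp: division_chain_def)
qed

lemma lex_order_nonzero: "lex_order N h \<nu> \<Longrightarrow> \<exists>z. h z \<noteq> 0"
  using division_chain_nonvanishing[of N _ \<nu> 0] by (auto simp: lex_order_def)

lemma lex_order_const: "c \<noteq> 0 \<Longrightarrow> lex_order N (\<lambda>z. c) (\<lambda>i. 0)"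
  unfolding lex_order_def division_chain_def
  by (intro exI[of _ "\<lambda>i z. c"]) (auto intro: polyfun_intros)

lemma lex_order_coord:
  assumes "i < N"
  shows "lex_order N (\<lambda>z. z i) (\<lambda>j. of_bool (j = i))"
  unfolding lex_order_def division_chain_def
proof (intro exI[of _ "\<lambda>j z. if j \<le> i then z i else 1"] conjI allI impI ballI)
  fix j and z :: "nat \<Rightarrow> complex"
  show "(if j \<le> i then z i else 1) = z j ^ of_bool (j = i) * (if Suc j \<le> i then z i else 1)"
    by (cases "j = i") auto
next
  fix j
  show "polyfun N (\<lambda>z. if j \<le> i then z i else 1)"
    using assms by (cases "j \<le> i") (auto intro: polyfun_intros)
qed (use assms in auto)

text \<open>Only the restriction of \<open>h\<close> after \<open>i\<close> steps matters: the
  earlier exponents are 0, so \<open>h\<close> itself is carried along unchanged until then.\<close>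

lemma lex_order_coord_pair:
  assumes h: "polyfun N h" "\<And>z. z \<in> coord_space N i \<Longrightarrow> h z = c * (z i * z (Suc i))"
    and "c \<noteq> 0" "Suc i < N"
  shows "lex_order N h (\<lambda>j. of_bool (j = i \<or> j = Suc i))"
  unfolding lex_order_def division_chain_def
proof (intro exI[of _ "\<lambda>j z. if j \<le> i then h z else if j = Suc i then c * z (Suc i) else c"] conjI allI impI ballI)
  fix j z
  let ?H = "\<lambda>j z. if j \<le> i then h z else if j = Suc i then c * z (Suc i) else c"
  assume "j < N" "z \<in> coord_space N j"
  then show "?H j z = z j ^ of_bool (j = i \<or> j = Suc i) * ?H (Suc j) z"
    using h(2)[of z] by (cases "j = i") auto
next
  fix j
  show "polyfun N (\<lambda>z. if j \<le> i then h z else if j = Suc i then c * z (Suc i) else c)"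
    using assms by (cases "j \<le> i"; cases "j = Suc i") (auto intro!: polyfun_intros)
qed (use assms in auto)

lemma lex_order_mult:
  assumes "lex_order N h \<nu>" "lex_order N h' \<nu>'"
  shows "lex_order N (\<lambda>z. h z * h' z) (\<lambda>i. \<nu> i + \<nu>' i)"
proof -
  obtain H H' where "H 0 = h" "division_chain N H \<nu>" "H' 0 = h'" "division_chain N H' \<nu>'"
    using assms by (auto simp: lex_order_def)
  then show ?thesis
    unfolding lex_order_def
    by (intro exI[of _ "\<lambda>i z. H i z * H' i z"])
      (auto simp: division_chain_def power_add intro: polyfun_intros)
qed

lemma lex_order_power: "lex_order N h \<nu> \<Longrightarrow> lex_order N (\<lambda>z. h z ^ k) (\<lambda>i. k * \<nu> i)"
  by (induction k) (auto dest: lex_order_mult intro: lex_order_const[of 1, simplified])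

lemma lex_order_prod:
  "(\<And>s. s \<in> S \<Longrightarrow> lex_order N (h s) (\<nu> s)) \<Longrightarrow>
    lex_order N (\<lambda>z. \<Prod>s\<in>S. h s z) (\<lambda>i. \<Sum>s\<in>S. \<nu> s i)"
  by (induction S rule: infinite_finite_induct)
    (auto intro: lex_order_mult lex_order_const[of 1, simplified])

lemma lex_order_cong:
  "lex_order N h \<nu> \<Longrightarrow> (\<And>i. i < N \<Longrightarrow> \<nu> i = \<nu>' i) \<Longrightarrow> lex_order N h \<nu>'"
  by (auto simp: lex_order_def division_chain_def)

text \<open>The lexicographically smaller exponent wins. Up to step \<open>j\<close> the two chains
  are added; there the second one keeps a positive power of \<open>z j\<close>, hence it vanishes on
  all later subspaces. The extra term at \<open>Suc j\<close> is kept because the identity of step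
  \<open>j\<close> is required on the larger subspace.\<close>

lemma lex_order_add:
  assumes "lex_order N h \<nu>" "lex_order N h' \<nu>'"
    and j: "j < N" "\<nu> j < \<nu>' j" "\<And>i. i < j \<Longrightarrow> \<nu> i = \<nu>' i"
  shows "lex_order N (\<lambda>z. h z + h' z) \<nu>"
proof -
  obtain H H' where H: "H 0 = h" "division_chain N H \<nu>" and H': "H' 0 = h'" "division_chain N H' \<nu>'"
    using assms by (auto simp: lex_order_def)
  define G where "G i z = (if i \<le> j then H i z + H' i z
    else if i = Suc j then H i z + z j ^ (\<nu>' j - \<nu> j) * H' i z else H i z)" for i z
  have Hi: "polyfun N (H i)" "polyfun N (H' i)" if "i \<le> N" for i
    using H(2) H'(2) that by (auto simp: division_chain_def)
  have step: "H i z = z i ^ \<nu> i * H (Suc i) z" "H' i z = z i ^ \<nu>' i * H' (Suc i) z"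
    if "i < N" "z \<in> coord_space N i" for i z
    using H(2) H'(2) that by (auto simp: division_chain_def)
  have restr: "G i z = H i z" if "i > j" "z \<in> coord_space N i" for i z
    using that j(2) coord_space_D[of z N i j] by (auto simp: G_def zero_power)
  have "division_chain N G \<nu>"
    unfolding division_chain_def
  proof (intro conjI allI impI ballI)
    fix i assume i: "i \<le> N"
    consider "i \<le> j" | "i = Suc j" | "i > Suc j" by linarith
    then show "polyfun N (G i)"
    proof cases
      case 1
      then have "G i = (\<lambda>z. H i z + H' i z)" by (auto simp: G_def)
      then show ?thesis using i Hi by (auto intro!: polyfun_intros)
    next
      case 2
      then have "G i = (\<lambda>z. H i z + z j ^ (\<nu>' j - \<nu> j) * H' i z)" by (auto simp: G_def)
      then show ?thesis using i Hi j by (auto intro!: polyfun_intros)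
    next
      case 3
      then have "G i = H i" by (auto simp: G_def)
      then show ?thesis using i Hi by auto
    qed
  next
    fix i z assume i: "i < N" and z: "z \<in> coord_space N i"
    consider "i < j" | "i = j" | "i > j" by linarith
    then show "G i z = z i ^ \<nu> i * G (Suc i) z"
    proof cases
      case 1
      then show ?thesis using step[OF i z] j(3)[OF 1] by (simp add: G_def algebra_simps)
    next
      case 2
      have "z j ^ \<nu>' j = z j ^ \<nu> j * z j ^ (\<nu>' j - \<nu> j)"
        using j(2) by (simp flip: power_add)
      then show ?thesis using step[OF i z] 2 by (simp add: G_def algebra_simps)
    next
      case 3
      then have "G (Suc i) z = H (Suc i) z" by (simp add: G_def)
      then show ?thesis using step[OF i z] restr[OF 3 z] by simp
    qed
  next
    show "G N (\<lambda>_. 0) \<noteq> 0"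
      using restr[OF j(1), of "\<lambda>_. 0"] H(2) by (simp add: coord_space_origin division_chain_def)
  qed
  moreover have "G 0 = (\<lambda>z. h z + h' z)" using H(1) H'(1) by (auto simp: G_def)
  ultimately show ?thesis by (auto simp: lex_order_def)
qed

text \<open>Pairwise distinct exponents rule out cancellation of leading terms, so each further term
  either takes over or leaves the exponent as it is.\<close>

lemma lex_order_sum:
  assumes "finite S" "S \<noteq> {}"
    and "\<And>\<alpha>. \<alpha> \<in> S \<Longrightarrow> lex_order N (E \<alpha>) \<alpha>"
    and "\<And>\<alpha> i. \<alpha> \<in> S \<Longrightarrow> N \<le> i \<Longrightarrow> \<alpha> i = 0"
    and "\<And>\<alpha>. \<alpha> \<in> S \<Longrightarrow> c \<alpha> \<noteq> 0"
  shows "\<exists>\<nu>\<in>S. lex_order N (\<lambda>z. \<Sum>\<alpha>\<in>S. c \<alpha> * E \<alpha> z) \<nu>"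
  using assms
proof (induction S rule: finite_ne_induct)
  case (singleton \<alpha>)
  then show ?case
    using lex_order_mult[OF lex_order_const[of "c \<alpha>"], of N "E \<alpha>" \<alpha>] by simp
next
  case (insert \<beta> S)
  then obtain \<nu> where \<nu>: "\<nu> \<in> S" "lex_order N (\<lambda>z. \<Sum>\<alpha>\<in>S. c \<alpha> * E \<alpha> z) \<nu>" by auto
  have \<beta>: "lex_order N (\<lambda>z. c \<beta> * E \<beta> z) \<beta>"
    using lex_order_mult[OF lex_order_const[of "c \<beta>"], of N "E \<beta>" \<beta>] insert by simp
  define j where "j = (LEAST j. \<nu> j \<noteq> \<beta> j)"
  have "\<nu> \<noteq> \<beta>" using \<nu>(1) insert by blast
  then have "\<exists>j. \<nu> j \<noteq> \<beta> j" by auto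
  then have j: "\<nu> j \<noteq> \<beta> j" unfolding j_def by (rule LeastI_ex)
  have less: "\<nu> i = \<beta> i" if "i < j" for i
    using not_less_Least that unfolding j_def by blast
  \<comment> \<open>All exponents are 0 from \<open>N\<close> on, hence two of them differ below
    \<open>N\<close>.\<close>
  have jN: "j < N" using j insert.prems(2) \<nu>(1) by (metis insertI1 insertI2 not_le)
  consider "\<nu> j < \<beta> j" | "\<beta> j < \<nu> j" using j by linarith
  then show ?case
  proof cases
    case 1
    then have "lex_order N (\<lambda>z. (\<Sum>\<alpha>\<in>S. c \<alpha> * E \<alpha> z) + c \<beta> * E \<beta> z) \<nu>"
      using lex_order_add[OF \<nu>(2) \<beta> jN] less by blast
    then show ?thesis using \<nu>(1) insert.hyps by (auto simp: add.commute)
  next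
    case 2
    then have "lex_order N (\<lambda>z. c \<beta> * E \<beta> z + (\<Sum>\<alpha>\<in>S. c \<alpha> * E \<alpha> z)) \<beta>"
      using lex_order_add[OF \<beta> \<nu>(2) jN] less by metis
    then show ?thesis using insert.hyps by auto
  qed
qed

section \<open>The affine chart and the flag\<close>

lemma peval_F_form:
  assumes "r \<le> N"
  shows "peval (F_form N r) v = (\<Sum>i\<le>r. (- 1) ^ (r - i) * (v i * v (N - i)))"
proof -
  have "peval (F_form N r) v = (\<Sum>j\<le>r. (- 1) ^ j * (v (r - j) * v (N - r + j)))"
    by (simp add: F_form_def atLeast0AtMost mult.assoc)
  also have "\<dots> = (\<Sum>i\<le>r. (- 1) ^ (r - i) * (v i * v (N - i)))"
    by (rule sum.reindex_bij_witness[of _ "\<lambda>i. r - i" "\<lambda>i. r - i"]) (use assms in auto)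
  finally show ?thesis .
qed

lemma peval_F_form_Suc:
  assumes "Suc r \<le> N"
  shows "peval (F_form N (Suc r)) v = v (Suc r) * v (N - Suc r) - peval (F_form N r) v"
proof -
  have "(\<Sum>i\<le>r. (- 1) ^ (Suc r - i) * (v i * v (N - i))) =
      (\<Sum>i\<le>r. - ((- 1) ^ (r - i) * (v i * v (N - i))))"
    by (rule sum.cong) (auto simp: Suc_diff_le)
  then show ?thesis
    using assms by (simp add: peval_F_form sum_negf)
qed

lemma F_form_in_forms_deg:
  assumes "r \<le> N"
  shows "F_form N r \<in> forms_deg N 2"
  unfolding F_form_def
proof (rule forms_deg_sum)
  fix j assume "j \<in> {0..r}"
  then have "(- 1) ^ j * pvar (r - j) * pvar (N - r + j) \<in> forms_deg N (j * 0 + 1 + 1)"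
    using assms by (intro forms_deg_mult forms_deg_power forms_deg_uminus forms_deg_one forms_deg_pvar) auto
  then show "(- 1) ^ j * pvar (r - j) * pvar (N - r + j) \<in> forms_deg N 2" by (simp add: numeral_2_eq_2)
qed

text \<open>On the chart \<open>p\<^sub>N = 1\<close> we use the coordinates \<open>z\<^sub>0 = F\<^sub>n\<^sub>-\<^sub>1\<close> and \<open>z\<^sub>i = p\<^bsub>coord_var i\<^esub>\<close> for
  \<open>0 < i < N\<close>; the variables appear in the order \<open>p\<^sub>n\<^sub>-\<^sub>1, p\<^sub>n, p\<^sub>n\<^sub>-\<^sub>2, p\<^sub>n\<^sub>+\<^sub>1, \<dots>, p\<^sub>1, p\<^sub>N\<^sub>-\<^sub>1\<close>.
  The remaining variable \<open>p\<^sub>0\<close> is recovered from the definition of \<open>F\<^sub>n\<^sub>-\<^sub>1\<close>.\<close>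

locale quadric_chart =
  fixes n N :: nat
  assumes n_ge: "2 \<le> n" and N_def: "N = 2 * n - 1"
begin

definition coord_pos :: "nat \<Rightarrow> nat" where
  "coord_pos k = (if k < n then 2 * (n - k) - 1 else 2 * (k + 1 - n))"

text \<open>Coordinate 0 is \<open>F_(n-1)\<close> and no variable. It is paired with
  \<open>p_0\<close> because at the last point of the flag its differential is a nonzero multiple of
  that of \<open>p_0\<close>.\<close>

definition coord_var :: "nat \<Rightarrow> nat" where
  "coord_var i = (if i = 0 then 0 else if odd i then n - (i + 1) div 2 else n - 1 + i div 2)"

lemma N_props: "3 \<le> N" "0 < N" "N \<noteq> 0" "n < N" "n - 1 < N"
  using n_ge by (auto simp: N_def)

lemma coord_pos_var: "0 < i \<Longrightarrow> i < N \<Longrightarrow> coord_pos (coord_var i) = i"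
proof (cases "odd i")
  case True
  then obtain k where "i = 2 * k + 1" by (elim oddE)
  then show "i < N \<Longrightarrow> ?thesis" using n_ge by (simp add: coord_pos_def coord_var_def N_def)
next
  case False
  then obtain k where "i = 2 * k" by (auto elim: evenE)
  then show "0 < i \<Longrightarrow> i < N \<Longrightarrow> ?thesis" using n_ge by (simp add: coord_pos_def coord_var_def N_def)
qed

lemma coord_var_pos: "0 < k \<Longrightarrow> k < N \<Longrightarrow> coord_var (coord_pos k) = k"
proof (cases "k < n")
  case True
  then obtain m where m: "n = k + Suc m" using less_imp_Suc_add by fastforce
  then have "n - k = Suc m" by simp
  then have "coord_pos k = Suc (2 * m)" using True by (simp add: coord_pos_def)
  then have "coord_var (coord_pos k) = n - Suc m" by (simp add: coord_var_def)
  then show ?thesis using m by linarith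
next
  case False
  then obtain m where "k = n + m" using le_Suc_ex by fastforce
  then show ?thesis using n_ge by (simp add: coord_pos_def coord_var_def)
qed

lemma coord_pos_bounds: "0 < k \<Longrightarrow> k < N \<Longrightarrow> 0 < coord_pos k \<and> coord_pos k < N"
  using n_ge by (auto simp: coord_pos_def N_def)

lemma coord_var_bounds: "0 < i \<Longrightarrow> i < N \<Longrightarrow> 0 < coord_var i \<and> coord_var i < N"
proof (cases "odd i")
  case True
  then obtain k where "i = 2 * k + 1" by (elim oddE)
  then show "i < N \<Longrightarrow> ?thesis" using n_ge by (auto simp: coord_var_def N_def)
next
  case False
  then obtain k where "i = 2 * k" by (auto elim: evenE)
  then show "0 < i \<Longrightarrow> i < N \<Longrightarrow> ?thesis" using n_ge by (simp add: coord_var_def N_def)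
qed

lemma coord_var_0 [simp]: "coord_var 0 = 0"
  by (simp add: coord_var_def)

lemma coord_var_less: "i < N \<Longrightarrow> coord_var i < N"
  using coord_var_bounds[of i] N_props by (cases "i = 0") auto

lemma coord_var_inj: "inj_on coord_var {..<N}"
proof (rule inj_onI)
  fix i j assume ij: "i \<in> {..<N}" "j \<in> {..<N}" "coord_var i = coord_var j"
  show "i = j"
  proof (cases "i = 0 \<or> j = 0")
    case True
    then show ?thesis using ij coord_var_bounds[of i] coord_var_bounds[of j]
      by (cases "i = 0"; cases "j = 0") simp_all
  next
    case False
    then show ?thesis using ij by (metis coord_pos_var lessThan_iff neq0_conv)
  qed
qed

lemma coord_pos_mirror: "r \<in> {1..n - 1} \<Longrightarrow> coord_pos (N - r) = Suc (coord_pos r)"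
proof -
  assume "r \<in> {1..n - 1}"
  then have r: "r < n" "\<not> N - r < n" "N - r + 1 - n = n - r" "0 < n - r"
    using n_ge by (auto simp: N_def)
  then show ?thesis by (simp add: coord_pos_def)
qed

text \<open>The equation for \<open>F_(n-1)\<close> on \<open>p_N = 1\<close>, solved for
  \<open>p_0\<close>; the sign in front is its own inverse.\<close>

definition p0_fun :: "(nat \<Rightarrow> complex) \<Rightarrow> complex" where
  "p0_fun z = (- 1) ^ (n - 1) * (z 0 - (\<Sum>r\<in>{1..n - 1}. (- 1) ^ (n - 1 - r) *
     (z (coord_pos r) * z (coord_pos (N - r)))))"

definition chart :: "(nat \<Rightarrow> complex) \<Rightarrow> nat \<Rightarrow> complex" where
  "chart z k = (if k = N then 1 else if k = 0 then p0_fun z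
     else if k < N then z (coord_pos k) else 0)"

definition chart_eq :: "nat \<Rightarrow> cpoly" where
  "chart_eq i = (if i = 0 then F_form N (n - 1) else pvar (coord_var i))"

definition chart_deg :: "nat \<Rightarrow> nat" where
  "chart_deg i = (if i = 0 then 2 else 1)"

lemma chart_last [simp]: "chart z N = 1"
  by (simp add: chart_def)

lemma chart_0: "chart z 0 = p0_fun z"
  using N_props by (simp add: chart_def)

lemma chart_middle: "0 < k \<Longrightarrow> k < N \<Longrightarrow> chart z k = z (coord_pos k)"
  by (simp add: chart_def)

lemma chart_coord_vectors: "chart z \<in> coord_vectors N"
  using N_props by (auto simp: coord_vectors_def chart_def intro!: exI[of _ N])

lemma F_form_top_split:
  "peval (F_form N (n - 1)) v = (- 1) ^ (n - 1) * (v 0 * v N) +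
     (\<Sum>r\<in>{1..n - 1}. (- 1) ^ (n - 1 - r) * (v r * v (N - r)))"
proof -
  have "{..n - 1} = insert 0 {1..n - 1}" by auto
  then show ?thesis using N_props by (simp add: peval_F_form)
qed

lemma peval_chart_eq: "i < N \<Longrightarrow> peval (chart_eq i) (chart z) = z i"
proof (cases "i = 0")
  case True
  have "(\<Sum>r\<in>{1..n - 1}. (- 1) ^ (n - 1 - r) * (chart z r * chart z (N - r))) =
      (\<Sum>r\<in>{1..n - 1}. (- 1) ^ (n - 1 - r) * (z (coord_pos r) * z (coord_pos (N - r))))"
    using N_props by (intro sum.cong) (auto simp: chart_middle)
  then have "peval (F_form N (n - 1)) (chart z) = (- 1) ^ (n - 1) * (- 1) ^ (n - 1) * z 0"
    unfolding F_form_top_split chart_0 p0_fun_def chart_last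
    by (simp add: right_diff_distrib flip: mult.assoc power_add mult_2)
  then show ?thesis
    using True by (simp add: chart_eq_def flip: power_add mult_2)
next
  case False
  moreover assume "i < N"
  ultimately show ?thesis
    using coord_var_bounds[of i] by (simp add: chart_eq_def chart_middle coord_pos_var)
qed

lemma chart_eq_forms_deg: "i < N \<Longrightarrow> chart_eq i \<in> forms_deg N (chart_deg i)"
  using N_props coord_var_less[of i] forms_deg_pvar[of "coord_var i" N]
  by (auto simp: chart_eq_def chart_deg_def F_form_in_forms_deg)

lemma chart_eq_forms: "i < N \<Longrightarrow> chart_eq i \<in> forms N"
  using chart_eq_forms_deg by blast

lemma polyfun_chart: "polyfun N (\<lambda>z. chart z k)"
proof -
  have "polyfun N p0_fun"
    unfolding p0_fun_def[abs_def] using N_props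
    by (intro polyfun_intros) (auto simp: coord_pos_bounds)
  then show ?thesis
    using coord_pos_bounds[of k] unfolding chart_def
    by (cases "k = N"; cases "k = 0"; cases "k < N")
      (simp_all add: polyfun_const polyfun_coord)
qed

section \<open>Passage between forms and functions on the chart\<close>

definition pullback :: "cpoly \<Rightarrow> (nat \<Rightarrow> complex) \<Rightarrow> complex" where
  "pullback f z = peval f (chart z)"

lemma pullback_simps [simp]:
  "pullback (f + g) z = pullback f z + pullback g z"
  "pullback (f - g) z = pullback f z - pullback g z"
  "pullback (f * g) z = pullback f z * pullback g z"
  "pullback (f ^ k) z = pullback f z ^ k"
  "pullback (const_form c) z = c"
  "pullback (pvar N) z = 1"
  "pullback (pvar 0) z = p0_fun z"
  by (simp_all add: pullback_def chart_0)

lemma pullback_chart_eq [simp]: "i < N \<Longrightarrow> pullback (chart_eq i) z = z i"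
  by (simp add: pullback_def peval_chart_eq)

lemma polyfun_pullback: "f \<in> forms N \<Longrightarrow> polyfun N (pullback f)"
  unfolding pullback_def[abs_def] by (rule polyfun_compose[OF polyfun_peval polyfun_chart])

text \<open>Multiplication by \<open>pvar N\<close>, which is 1 on the chart, changes the degree and
  nothing else.\<close>

lemma pullback_raise_degree:
  assumes "f \<in> forms_deg N d" "d \<le> D"
  shows "\<exists>g\<in>forms_deg N D. \<forall>z. pullback g z = pullback f z"
proof
  have "pvar N ^ (D - d) * f \<in> forms_deg N ((D - d) * 1 + d)"
    using assms by (intro forms_deg_mult forms_deg_power forms_deg_pvar) auto
  then show "pvar N ^ (D - d) * f \<in> forms_deg N D" using assms by simp
qed simp

text \<open>Homogenization; the two parts of a sum are first lifted to a common degree.\<close>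

lemma pullback_surj:
  assumes "polyfun N h"
  shows "\<exists>d. \<exists>f\<in>forms_deg N d. \<forall>z. pullback f z = h z"
  using assms
proof induction
  case (polyfun_const c)
  show ?case by (intro exI[of _ 0] bexI[of _ "const_form c"]) (auto simp: forms_deg_const)
next
  case (polyfun_coord j)
  then show ?case
    by (intro exI[of _ "chart_deg j"] bexI[of _ "chart_eq j"]) (auto simp: chart_eq_forms_deg)
next
  case (polyfun_add p q)
  then obtain d f e g where f: "f \<in> forms_deg N d" "\<forall>z. pullback f z = p z"
    and g: "g \<in> forms_deg N e" "\<forall>z. pullback g z = q z" by blast
  obtain f' where "f' \<in> forms_deg N (max d e)" "\<forall>z. pullback f' z = p z"
    using pullback_raise_degree[OF f(1), of "max d e"] f(2) by auto
  moreover obtain g' where "g' \<in> forms_deg N (max d e)" "\<forall>z. pullback g' z = q z"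
    using pullback_raise_degree[OF g(1), of "max d e"] g(2) by auto
  ultimately show ?case
    by (intro exI[of _ "max d e"] bexI[of _ "f' + g'"]) (auto intro: forms_deg_add)
next
  case (polyfun_mult p q)
  then obtain d f e g where "f \<in> forms_deg N d" "\<forall>z. pullback f z = p z"
    and "g \<in> forms_deg N e" "\<forall>z. pullback g z = q z" by blast
  then show ?case
    by (intro exI[of _ "d + e"] bexI[of _ "f * g"]) (auto intro: forms_deg_mult)
qed

lemma chart_surj:
  assumes "w N = 1" "\<And>k. N < k \<Longrightarrow> w k = 0"
  shows "\<exists>z\<in>coord_space N 0. chart z = w"
proof
  define z where "z j = (if j = 0 then peval (F_form N (n - 1)) w else if j < N then w (coord_var j) else 0)" for j
  show "z \<in> coord_space N 0" using N_props by (auto simp: coord_space_def z_def)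
  have z: "z (coord_pos k) = w k" if "0 < k" "k < N" for k
    using coord_pos_bounds[OF that] coord_var_pos[OF that] by (simp add: z_def)
  have z0: "z 0 = peval (F_form N (n - 1)) w" by (simp add: z_def)
  have "(\<Sum>r\<in>{1..n - 1}. (- 1) ^ (n - 1 - r) * (z (coord_pos r) * z (coord_pos (N - r)))) =
      (\<Sum>r\<in>{1..n - 1}. (- 1) ^ (n - 1 - r) * (w r * w (N - r)))"
    using N_props by (intro sum.cong arg_cong2[where f = "(*)"] z refl) auto
  then have "p0_fun z = (- 1) ^ (n - 1) * ((- 1) ^ (n - 1) * w 0)"
    unfolding p0_fun_def z0 F_form_top_split using assms(1) by simp
  also have "\<dots> = w 0" by (simp flip: mult.assoc power_add mult_2)
  finally have "p0_fun z = w 0" .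
  then show "chart z = w"
    using z assms by (auto simp: chart_def fun_eq_iff)
qed

text \<open>Homogeneity covers all vectors with nonzero last entry. The line through
  \<open>v\<close> in the direction of that entry leaves this set at one point only, so the
  restriction of \<open>f\<close> to it has infinitely many roots.\<close>

lemma pullback_zero_imp_peval_zero:
  assumes f: "f \<in> forms N" and 0: "\<And>z. z \<in> coord_space N 0 \<Longrightarrow> pullback f z = 0"
  shows "peval f v = 0"
proof -
  obtain d where d: "f \<in> forms_deg N d" using f by (rule formsE)
  have affine: "peval f w = 0" if wN: "w N \<noteq> 0" for w
  proof -
    let ?u = "\<lambda>k. if k \<le> N then w k / w N else 0"
    obtain z where z: "z \<in> coord_space N 0" "chart z = ?u"
      using chart_surj[of ?u] wN by auto
    have "peval f w = peval f (\<lambda>k. w N * ?u k)"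
      by (rule peval_form_cong[OF f]) (use wN in auto)
    also have "\<dots> = w N ^ d * pullback f z"
      using z(2) by (simp only: peval_homogeneous[OF d] pullback_def)
    finally show ?thesis using 0[OF z(1)] by simp
  qed
  let ?e = "\<lambda>k. if k = N then 1 else 0 :: complex"
  obtain P where P: "\<And>t. peval f (\<lambda>i. v i + t * ?e i) = poly P t"
    using polyfun_restrict_line[OF polyfun_peval[OF f], of v ?e] by blast
  have "poly P t = 0" if "t \<noteq> - v N" for t
    using affine[of "\<lambda>i. v i + t * ?e i"] P[of t] that by (simp add: add_eq_0_iff)
  then have "P = 0"
    using infinite_super[of "UNIV - {- v N}" "{t. poly P t = 0}"] poly_roots_finite[of P]
      infinite_UNIV_char_0[where 'a = complex] by auto
  then show ?thesis using P[of 0] by simp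
qed

text \<open>The Zariski closure of the image of a coordinate subspace, cut out by all forms
  vanishing there. Vanishing on \<open>flag i\<close> thus becomes a statement about pullbacks, and
  the points at infinity never have to be described.\<close>

definition flag :: "nat \<Rightarrow> ppoint set" where
  "flag i = {P \<in> proj_space N. \<forall>f\<in>forms N.
     (\<forall>z\<in>coord_space N i. pullback f z = 0) \<longrightarrow> vanishes_on f {P}}"

lemma flag_subset: "flag i \<subseteq> proj_space N"
  by (auto simp: flag_def)

lemma chart_in_flag: "z \<in> coord_space N i \<Longrightarrow> point_of (chart z) \<in> flag i"
  by (auto simp: flag_def point_of_in_proj_space chart_coord_vectors vanishes_on_point_iff
      pullback_def)

lemma vanishes_on_flag_D: "vanishes_on f (flag i) \<Longrightarrow> z \<in> coord_space N i \<Longrightarrow> pullback f z = 0"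
  using chart_in_flag[of z i] point_of_self[of "chart z"] by (auto simp: vanishes_on_def pullback_def)

lemma vanishes_on_flag_iff:
  "f \<in> forms N \<Longrightarrow> vanishes_on f (flag i) \<longleftrightarrow> (\<forall>z\<in>coord_space N i. pullback f z = 0)"
  using vanishes_on_flag_D[of f i] vanishes_on_singletons[of f "flag i"] by (auto simp: flag_def)

lemma flag_0: "flag 0 = proj_space N"
  using pullback_zero_imp_peval_zero
  by (auto simp: flag_def vanishes_on_def)

lemma flag_mono: "i \<le> j \<Longrightarrow> flag j \<subseteq> flag i"
  using coord_space_mono[of i j N] by (auto simp: flag_def)

lemma flag_strict:
  assumes "i < N"
  shows "flag (Suc i) \<subset> flag i"
proof -
  let ?z = "\<lambda>j. if j = i then 1 else 0 :: complex"
  have "?z \<in> coord_space N i" using assms by (auto simp: coord_space_def)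
  then have "point_of (chart ?z) \<in> flag i" by (rule chart_in_flag)
  moreover have "point_of (chart ?z) \<notin> flag (Suc i)"
  proof
    assume "point_of (chart ?z) \<in> flag (Suc i)"
    moreover have "vanishes_on (chart_eq i) (flag (Suc i))"
      using assms chart_eq_forms[OF assms]
      by (auto simp: vanishes_on_flag_iff coord_space_def)
    ultimately have "peval (chart_eq i) (chart ?z) = 0"
      using point_of_self[of "chart ?z"] unfolding vanishes_on_def by blast
    then show False using peval_chart_eq[OF assms] by simp
  qed
  ultimately show ?thesis using flag_mono[of i "Suc i"] by auto
qed

lemma flag_closed_subvariety: "closed_subvariety N (flag i)"
  unfolding closed_subvariety_def
proof
  show "zariski_closed N (flag i)"
    unfolding zariski_closed_def
    by (rule exI[of _ "{f \<in> forms N. \<forall>z\<in>coord_space N i. pullback f z = 0}"])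
      (auto simp: flag_def)
  show "irreducible_set N (flag i)"
  proof (rule irreducible_setI)
    show "flag i \<noteq> {}" using chart_in_flag[OF coord_space_origin] by blast
    fix f g assume fg: "f \<in> forms N" "g \<in> forms N" "vanishes_on (f * g) (flag i)"
    show "vanishes_on f (flag i) \<or> vanishes_on g (flag i)"
    proof (rule ccontr)
      assume "\<not> (vanishes_on f (flag i) \<or> vanishes_on g (flag i))"
      then have "nonvanishing N i (\<lambda>z. pullback f z * pullback g z)"
        using fg(1,2) by (intro nonvanishing_mult polyfun_pullback) (auto simp: vanishes_on_flag_iff)
      then show False using vanishes_on_flag_D[OF fg(3)] by auto
    qed
  qed (rule flag_subset)
qed

section \<open>The last point, codimension and smoothness\<close>

lemma chart_origin: "chart (\<lambda>_. 0) = (\<lambda>k. if k = N then 1 else 0)"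
  by (auto simp: chart_def p0_fun_def)

text \<open>All variables except \<open>pvar N\<close> vanish at the image of the origin, so the
  closure acquires no further point.\<close>

lemma flag_last: "flag N = {point_of (chart (\<lambda>_. 0))}"
proof
  show "{point_of (chart (\<lambda>_. 0))} \<subseteq> flag N"
    using chart_in_flag[OF coord_space_origin] by blast
  show "flag N \<subseteq> {point_of (chart (\<lambda>_. 0))}"
  proof
    fix P assume P: "P \<in> flag N"
    then obtain v where v: "v \<in> coord_vectors N" "P = point_of v"
      using flag_subset[of N] by (auto elim: proj_spaceE)
    have "v k = 0" if "k < N" for k
    proof -
      have "vanishes_on (pvar k) (flag N)"
        using that forms_pvar[of k N]
        by (auto simp: vanishes_on_flag_iff coord_space_full pullback_def chart_origin)
      then show ?thesis
        using P v(2) point_of_self[of v] by (auto simp: vanishes_on_def)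
    qed
    then have "v k = 0" if "k \<noteq> N" for k
      using v(1) that by (cases "k < N") (auto simp: coord_vectors_def)
    moreover have "\<exists>k. v k \<noteq> 0" using v(1) by (simp add: coord_vectors_def)
    ultimately have "v = (\<lambda>k. v N * chart (\<lambda>_. 0) k)" and "v N \<noteq> 0"
      by (auto simp: chart_origin fun_eq_iff) metis
    then have c: "v = (\<lambda>k. c * chart (\<lambda>_. 0) k)" "c \<noteq> 0" if "c = v N" for c
      using that by auto
    obtain c where c: "v = (\<lambda>k. c * chart (\<lambda>_. 0) k)" "c \<noteq> 0" using c by blast
    have "point_of v = point_of (chart (\<lambda>_. 0))"
      unfolding point_of_def c(1)
    proof (intro Collect_cong iffI; elim exE conjE)
      fix w d assume "d \<noteq> 0" "w = (\<lambda>i. d * (c * chart (\<lambda>_. 0) i))"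
      then show "\<exists>c. c \<noteq> 0 \<and> w = (\<lambda>i. c * chart (\<lambda>_. 0) i)"
        using c(2) by (intro exI[of _ "d * c"]) (auto simp: mult.assoc)
    next
      fix w d assume "d \<noteq> 0" "w = (\<lambda>i. d * chart (\<lambda>_. 0) i)"
      then show "\<exists>e. e \<noteq> 0 \<and> w = (\<lambda>i. e * (c * chart (\<lambda>_. 0) i))"
        using c(2) by (intro exI[of _ "d / c"]) (auto simp: fun_eq_iff)
    qed
    then show "P \<in> {point_of (chart (\<lambda>_. 0))}" using v(2) by simp
  qed
qed

text \<open>The flag provides a chain of length \<open>i\<close>. Conversely, any chain above
  \<open>flag i\<close> is prolonged downwards by the \<open>N - i\<close> remaining steps of the
  flag, and \<open>closed_subvariety_chain_length\<close> bounds the result.\<close>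

lemma codim_flag:
  assumes "i \<le> N"
  shows "codim N (flag i) (proj_space N) = enat i"
  unfolding codim_def
proof (rule antisym)
  let ?S = "{enat k |k. \<exists>C. C 0 = flag i \<and> C k = proj_space N \<and>
     (\<forall>i\<le>k. closed_subvariety N (C i)) \<and> (\<forall>i<k. C i \<subset> C (Suc i))}"
  show "enat i \<le> Sup ?S"
  proof (rule Sup_upper, intro CollectI exI conjI)
    show "flag (i - 0) = flag i" "flag (i - i) = proj_space N" by (simp_all add: flag_0)
    show "\<forall>j\<le>i. closed_subvariety N (flag (i - j))" by (simp add: flag_closed_subvariety)
    show "\<forall>j<i. flag (i - j) \<subset> flag (i - Suc j)"
    proof (intro allI impI)
      fix j assume "j < i"
      then have "i - j = Suc (i - Suc j)" "i - Suc j < N" using assms by auto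
      then show "flag (i - j) \<subset> flag (i - Suc j)" using flag_strict[of "i - Suc j"] by simp
    qed
  qed simp
  show "Sup ?S \<le> enat i"
  proof (rule Sup_least, clarify)
    fix k and C :: "nat \<Rightarrow> ppoint set"
    assume C: "C 0 = flag i" "C k = proj_space N"
      "\<forall>i\<le>k. closed_subvariety N (C i)" "\<forall>i<k. C i \<subset> C (Suc i)"
    define C' where "C' j = (if j \<le> N - i then flag (N - j) else C (j - (N - i)))" for j
    have "N - i + k \<le> N"
    proof (rule closed_subvariety_chain_length[of _ N C'])
      show "closed_subvariety N (C' j)" if "j \<le> N - i + k" for j
        using that C(3) by (auto simp: C'_def flag_closed_subvariety)
      show "C' j \<subset> C' (Suc j)" if j: "j < N - i + k" for j
      proof -
        consider "j < N - i" | "j = N - i" | "j > N - i" by linarith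
        then show ?thesis
        proof cases
          case 1
          then have "N - j = Suc (N - Suc j)" "N - Suc j < N" by auto
          then show ?thesis using 1 flag_strict[of "N - Suc j"] by (simp add: C'_def)
        next
          case 2
          then have "k > 0" using j by simp
          then show ?thesis using 2 C(1) C(4)[rule_format, of 0] assms by (simp add: C'_def Suc_diff_le)
        next
          case 3
          then show ?thesis using C(4)[rule_format, of "j - (N - i)"] j by (simp add: C'_def Suc_diff_le)
        qed
      qed
    qed
    then show "enat k \<le> enat i" using assms by simp
  qed
qed

text \<open>Each product in \<open>p0_fun\<close> involves two different coordinates and hence
  vanishes on an axis. So an axis maps to a line along a single homogeneous coordinate, which is
  what partial derivatives require.\<close>

lemma chart_axis:
  assumes "j < N"
  obtains s where "s \<noteq> 0"
    "\<And>t. chart (\<lambda>l. if l = j then t else 0) = (\<lambda>k. if k = N then 1 else if k = coord_var j then s * t else 0)"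
proof
  let ?s = "if j = 0 then (- 1) ^ (n - 1) else 1 :: complex"
  show "?s \<noteq> 0" by simp
  fix t :: complex
  let ?z = "\<lambda>l. if l = j then t else 0"
  have "(\<Sum>r\<in>{1..n - 1}. (- 1) ^ (n - 1 - r) * (?z (coord_pos r) * ?z (coord_pos (N - r)))) = 0"
    using coord_pos_mirror by (intro sum.neutral) auto
  then have p0: "p0_fun ?z = (if j = 0 then ?s * t else 0)"
    unfolding p0_fun_def by auto
  have mid: "chart ?z k = (if k = coord_var j then ?s * t else 0)" if k: "0 < k" "k < N" for k
  proof (cases "j = 0")
    case True
    then show ?thesis using k coord_pos_bounds[OF k] by (simp add: chart_middle)
  next
    case False
    then have "coord_pos k = j \<longleftrightarrow> k = coord_var j"
      using coord_pos_var[of j] coord_var_pos[OF k] assms by auto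
    then show ?thesis using k False by (simp add: chart_middle)
  qed
  show "chart ?z = (\<lambda>k. if k = N then 1 else if k = coord_var j then ?s * t else 0)"
  proof
    fix k
    consider "k = N" | "k = 0" | "0 < k" "k < N" | "N < k" by linarith
    then show "chart ?z k = (if k = N then 1 else if k = coord_var j then ?s * t else 0)"
    proof cases
      case 2
      then show ?thesis
        using p0 N_props coord_var_bounds[of j] assms by (cases "j = 0") (simp_all add: chart_0)
    next
      case 3
      then show ?thesis using mid[OF 3] by simp
    next
      case 4
      then show ?thesis using coord_var_less[OF assms] by (simp add: chart_def)
    qed simp
  qed
qed

text \<open>Changing entry \<open>k\<close> of \<open>v\<close> moves along a chart axis inside the
  flag member, along the line spanned by the point (\<open>k = N\<close>), or in an entry that forms
  ignore (\<open>k > N\<close>). In each case \<open>f\<close> stays constant.\<close>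

lemma gradient_zero:
  assumes f: "f \<in> forms N" "vanishes_on f (flag i)"
    and v: "v = (\<lambda>k. c * chart (\<lambda>_. 0) k)" "c \<noteq> 0"
    and k: "k \<notin> coord_var ` {..<i}"
  shows "gradient f v k = 0"
proof -
  obtain d where d: "f \<in> forms_deg N d" using f(1) by (rule formsE)
  have scale: "peval f (\<lambda>k. a * chart z k) = 0" if "z \<in> coord_space N i" for a z
    using vanishes_on_flag_D[OF f(2) that] by (simp add: peval_homogeneous[OF d] pullback_def)
  have "\<exists>b. \<forall>x. peval f (v(k := x)) = b"
  proof -
    consider "k < N" | "k = N" | "N < k" by linarith
    then show ?thesis
    proof cases
      case 1
      define j where "j = (if k = 0 then 0 else coord_pos k)"
      have j: "j < N" "coord_var j = k"
        using 1 coord_pos_bounds[of k] coord_var_pos[of k] by (auto simp: j_def)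
      then have "i \<le> j" using k by (metis imageI lessThan_iff not_le)
      obtain s where s: "s \<noteq> 0"
        "\<And>t. chart (\<lambda>l. if l = j then t else 0) = (\<lambda>k. if k = N then 1 else if k = coord_var j then s * t else 0)"
        using chart_axis[OF j(1)] by blast
      have "v(k := x) = (\<lambda>l. c * chart (\<lambda>l. if l = j then x / (c * s) else 0) l)" for x
        using v s j 1 by (auto simp: chart_origin)
      moreover have "(\<lambda>l. if l = j then x / (c * s) else 0) \<in> coord_space N i" for x
        using \<open>i \<le> j\<close> j(1) by (auto simp: coord_space_def)
      ultimately show ?thesis using scale by auto
    next
      case 2
      have "v(k := x) = (\<lambda>l. x * chart (\<lambda>_. 0) l)" for x
        using v(1) 2 by (auto simp: chart_origin)
      then show ?thesis using scale[OF coord_space_origin] by auto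
    next
      case 3
      have "peval f (v(k := x)) = peval f v" for x
        by (rule peval_form_cong[OF f(1)]) (use 3 in auto)
      then show ?thesis by blast
    qed
  qed
  then obtain b where "(\<lambda>x. peval f (v(k := x))) = (\<lambda>x. b)" by auto
  then show ?thesis by (simp add: gradient_def)
qed

text \<open>For \<open>i = 0\<close>: at a vector whose only nonzero entry is the last, the products
  \<open>p_r p_(N-r)\<close> with r > 0 have zero differential, and only \<open>p_0 p_N\<close>
  contributes.\<close>

lemma gradient_chart_eq:
  assumes v: "v = (\<lambda>k. c * chart (\<lambda>_. 0) k)" "c \<noteq> 0" and i: "i < N"
  obtains a where "a \<noteq> 0" "gradient (chart_eq i) v = (\<lambda>k. if k = coord_var i then a else 0)"
proof (cases "i = 0")
  case False
  have "gradient (chart_eq i) v = (\<lambda>k. if k = coord_var i then 1 else 0)"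
  proof
    fix k
    have "(\<lambda>x. peval (chart_eq i) (v(k := x))) = (if k = coord_var i then \<lambda>x. x else (\<lambda>x. v (coord_var i)))"
      using False by (auto simp: chart_eq_def)
    then show "gradient (chart_eq i) v k = (if k = coord_var i then 1 else 0)"
      by (simp add: gradient_def)
  qed
  then show ?thesis using that[of 1] by simp
next
  case True
  have vk: "v k = (if k = N then c else 0)" for k
    using v by (simp add: chart_origin)
  let ?a = "(- 1) ^ (n - 1) * c"
  have "gradient (chart_eq i) v = (\<lambda>k. if k = coord_var i then ?a else 0)"
  proof
    fix k
    have "peval (chart_eq i) (v(k := x)) = (if k = 0 then ?a * x else 0)" for x
    proof -
      have "(\<Sum>r\<in>{1..n - 1}. (- 1) ^ (n - 1 - r) * ((v(k := x)) r * (v(k := x)) (N - r))) = 0"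
        by (intro sum.neutral) (auto simp: vk N_def)
      then have "peval (F_form N (n - 1)) (v(k := x)) =
          (- 1) ^ (n - 1) * ((v(k := x)) 0 * (v(k := x)) N)"
        by (simp only: F_form_top_split add_0_right)
      then show ?thesis
        using True N_props by (simp add: vk chart_eq_def)
    qed
    then have "(\<lambda>x. peval (chart_eq i) (v(k := x))) = (if k = 0 then (\<lambda>x. ?a * x) else (\<lambda>x. 0))"
      by auto
    then show "gradient (chart_eq i) v k = (if k = coord_var i then ?a else 0)"
      using True by (simp add: gradient_def)
  qed
  then show ?thesis using that[of ?a] v(2) by simp
qed

lemma vanishes_on_chart_eq: "j < i \<Longrightarrow> i \<le> N \<Longrightarrow> vanishes_on (chart_eq j) (flag i)"
  using chart_eq_forms[of j] by (auto simp: vanishes_on_flag_iff coord_space_def)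

text \<open>The differentials span exactly the unit vectors at \<open>coord_var j\<close> for
  \<open>j < i\<close>: \<open>gradient_chart_eq\<close> gives one inclusion and
  \<open>gradient_zero\<close> the other.\<close>

lemma smooth_at_flag:
  assumes i: "i \<le> N"
  shows "smooth_at N (flag i) (point_of (chart (\<lambda>_. 0)))"
  unfolding smooth_at_def
proof (intro conjI ballI)
  show "point_of (chart (\<lambda>_. 0)) \<in> flag i"
    by (rule chart_in_flag[OF coord_space_origin])
  fix v assume "v \<in> point_of (chart (\<lambda>_. 0))"
  then obtain c where v: "v = (\<lambda>k. c * chart (\<lambda>_. 0) k)" "c \<noteq> 0"
    by (auto simp: point_of_def)
  let ?G = "{gradient f v |f. f \<in> forms N \<and> vanishes_on f (flag i)}"
  let ?e = "\<lambda>j k. if k = coord_var j then 1 else 0 :: complex"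
  let ?B = "?e ` {..<i}"
  have inj_var: "coord_var j = coord_var l \<longleftrightarrow> j = l" if "j < i" "l < i" for j l
    using coord_var_inj that i by (auto simp: inj_on_def)
  have inj: "inj_on ?e {..<i}"
    using inj_var by (intro inj_onI) (metis lessThan_iff zero_neq_one)
  have indep: "cvec.independent ?B"
  proof (rule cvec.independent_if_scalars_zero)
    fix a x assume s: "(\<Sum>x\<in>?B. cscale (a x) x) = 0" and "x \<in> ?B"
    then obtain j where j: "j < i" "x = ?e j" by auto
    have "(\<Sum>l<i. cscale (a (?e l)) (?e l)) = 0"
      using s by (simp add: sum.reindex[OF inj])
    then have "(\<Sum>l<i. cscale (a (?e l)) (?e l)) (coord_var j) = 0" by simp
    moreover have "(\<Sum>l\<in>S. cscale (a (?e l)) (?e l)) (coord_var j) =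
        (\<Sum>l\<in>S. cscale (a (?e l)) (?e l) (coord_var j))" for S
      by (induction S rule: infinite_finite_induct) auto
    moreover have "(\<Sum>l<i. cscale (a (?e l)) (?e l) (coord_var j)) = (\<Sum>l<i. if l = j then a (?e j) else 0)"
      by (rule sum.cong) (auto simp: cscale_def inj_var j)
    ultimately show "a x = 0" using j by simp
  qed simp
  have "cvec.span ?B = cvec.span ?G"
  proof (rule cvec.span_eq[THEN iffD2], intro conjI subsetI)
    fix x assume "x \<in> ?B"
    then obtain j where j: "j < i" "x = ?e j" by auto
    obtain a where a: "a \<noteq> 0" "gradient (chart_eq j) v = (\<lambda>k. if k = coord_var j then a else 0)"
      using gradient_chart_eq[OF v, of j] j i by auto
    have "gradient (chart_eq j) v \<in> ?G"
      using j i chart_eq_forms[of j] vanishes_on_chart_eq[of j i] by auto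
    then have "cscale (1 / a) (gradient (chart_eq j) v) \<in> cvec.span ?G"
      by (intro cvec.span_scale cvec.span_base)
    moreover have "cscale (1 / a) (gradient (chart_eq j) v) = x"
      using a j by (auto simp: cscale_def)
    ultimately show "x \<in> cvec.span ?G" by simp
  next
    fix x assume "x \<in> ?G"
    then obtain f where f: "f \<in> forms N" "vanishes_on f (flag i)" "x = gradient f v" by auto
    have "x = (\<Sum>j<i. cscale (x (coord_var j)) (?e j))"
    proof
      fix k
      have "(\<Sum>j\<in>S. cscale (x (coord_var j)) (?e j)) k =
          (\<Sum>j\<in>S. if k = coord_var j then x (coord_var j) else 0)" for S
        by (induction S rule: infinite_finite_induct) (auto simp: cscale_def)
      moreover have "(\<Sum>j<i. if k = coord_var j then x (coord_var j) else 0) = x k"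
      proof (cases "k \<in> coord_var ` {..<i}")
        case True
        then obtain l where l: "l < i" "k = coord_var l" by auto
        then have "(\<Sum>j<i. if k = coord_var j then x (coord_var j) else 0) =
            (\<Sum>j<i. if j = l then x (coord_var l) else 0)"
          using inj_var by (intro sum.cong) auto
        then show ?thesis using l by simp
      next
        case False
        then have "(\<Sum>j<i. if k = coord_var j then x (coord_var j) else 0) = 0"
          by (intro sum.neutral) auto
        then show ?thesis using gradient_zero[OF f(1,2) v False] f(3) by simp
      qed
      ultimately show "x k = (\<Sum>j<i. cscale (x (coord_var j)) (?e j)) k" by simp
    qed
    also have "\<dots> \<in> cvec.span ?B"
      by (intro cvec.span_sum cvec.span_scale cvec.span_base) auto
    finally show "x \<in> cvec.span ?B" .
  qed
  then have "cvec.dim ?G = card ?B" using indep by (rule cvec.dim_eq_card)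
  also have "card ?B = i" by (simp add: card_image[OF inj])
  finally show "enat (cvec.dim ?G) = codim N (flag i) (proj_space N)"
    using codim_flag[OF i] by simp
qed

lemma admissible_flag_flag: "admissible_flag N flag"
  unfolding admissible_flag_def
  using flag_0 flag_strict flag_closed_subvariety codim_flag flag_last smooth_at_flag by auto

section \<open>The flag valuation in terms of the chart\<close>

lemma local_unit_flag_iff:
  "local_unit N (flag i) u \<longleftrightarrow> u \<in> forms N \<and> nonvanishing N i (pullback u)"
  by (auto simp: local_unit_def vanishes_on_flag_iff)

lemma nonvanishing_full: "nonvanishing N N p \<longleftrightarrow> p (\<lambda>_. 0) \<noteq> 0"
  by (simp add: coord_space_full)

lemma vanishes_on_flag_diffI:
  assumes "f \<in> forms_deg N d" "g \<in> forms_deg N d"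
    and "\<And>z. z \<in> coord_space N i \<Longrightarrow> pullback f z = pullback g z"
  shows "vanishes_on (f - g) (flag i)"
proof -
  have "f - g \<in> forms N" using forms_deg_diff[OF assms(1,2)] by blast
  then show ?thesis using assms(3) by (simp add: vanishes_on_flag_iff)
qed

lemma polyfun_divide_coord:
  assumes "polyfun N p" "i < N" "\<And>z. z \<in> coord_space N (Suc i) \<Longrightarrow> p z = 0"
  obtains q where "polyfun N q" "\<And>z. z \<in> coord_space N i \<Longrightarrow> p z = z i * q z"
proof -
  obtain q where q: "polyfun N q" "\<And>z. p z = p (z(i := 0)) + z i * q z"
    using polyfun_divide[OF assms(1,2)] by blast
  show ?thesis
  proof (rule that[OF q(1)])
    show "p z = z i * q z" if "z \<in> coord_space N i" for z
      using q(2)[of z] assms(3)[OF coord_space_upd[OF that]] by simp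
  qed
qed

text \<open>The pullback of \<open>f\<close> is divisible by \<open>z i\<close> on the subspace;
  homogenizing the quotient introduces powers of \<open>pvar N\<close> only, which are units at the
  last point.\<close>

lemma chart_eq_local_equation:
  assumes i: "i < N"
  shows "local_equation N (flag i) (flag (Suc i)) (flag N) (chart_eq i)"
  unfolding local_equation_def
proof (intro conjI ballI impI)
  show "chart_eq i \<in> forms N" "vanishes_on (chart_eq i) (flag (Suc i))"
    using i by (auto intro: chart_eq_forms vanishes_on_chart_eq)
  fix f assume f: "f \<in> forms N" "vanishes_on f (flag (Suc i))"
  obtain d where d: "f \<in> forms_deg N d" using f(1) by (rule formsE)
  obtain q where q: "polyfun N q" "\<And>z. z \<in> coord_space N i \<Longrightarrow> pullback f z = z i * q z"
    using polyfun_divide_coord[OF polyfun_pullback[OF f(1)] i] vanishes_on_flag_D[OF f(2)] by blast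
  obtain e t where "t \<in> forms_deg N e" "\<forall>z. pullback t z = q z"
    using pullback_surj[OF q(1)] by blast
  then obtain T where T: "T \<in> forms_deg N (max d e)" "\<And>z. pullback T z = q z"
    using pullback_raise_degree[of t e "max d e"] by auto
  \<comment> \<open>The power of \<open>pvar N\<close> that equates the degrees; the natural
    subtraction is exact since \<open>max d e\<close> is at least \<open>d\<close>.\<close>
  let ?M = "chart_deg i + max d e - d"
  have "pvar N ^ ?M * f \<in> forms_deg N (?M * 1 + d)"
    using d by (intro forms_deg_mult forms_deg_power forms_deg_pvar) auto
  then have "pvar N ^ ?M * f \<in> forms_deg N (chart_deg i + max d e)" by simp
  moreover have "chart_eq i * T \<in> forms_deg N (chart_deg i + max d e)"
    using T(1) i by (intro forms_deg_mult chart_eq_forms_deg)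
  ultimately have "vanishes_on (pvar N ^ ?M * f - chart_eq i * T) (flag i)"
    by (rule vanishes_on_flag_diffI) (use i T q in auto)
  moreover have "local_unit N (flag N) (pvar N ^ ?M)"
    by (simp add: local_unit_flag_iff forms_power forms_pvar coord_space_full)
  ultimately show "\<exists>u t. local_unit N (flag N) u \<and> t \<in> forms N \<and> vanishes_on (u * f - chart_eq i * t) (flag i)"
    using T(1) by blast
qed

text \<open>A unit along the smaller \<open>flag j\<close> is a unit along the larger
  \<open>flag i\<close>. This passes from equations near the last point to equations near a generic
  point.\<close>

lemma local_equation_flag_mono:
  "local_equation N Y Z (flag j) g \<Longrightarrow> i \<le> j \<Longrightarrow> local_equation N Y Z (flag i) g"
  unfolding local_equation_def local_unit_flag_iff using nonvanishing_mono by blast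

text \<open>Independence of the chosen equation. Since \<open>g\<close> generates the ideal, it
  divides a unit times \<open>chart_eq i\<close>; cancelling \<open>z i\<close> shows that the
  cofactor \<open>v\<close> divides the unit.\<close>

lemma local_equation_pullback:
  assumes g: "local_equation N (flag i) (flag (Suc i)) (flag j) g" and ij: "i < j" "i < N"
  obtains v where "polyfun N v" "nonvanishing N j v"
    "\<And>z. z \<in> coord_space N i \<Longrightarrow> pullback g z = z i * v z"
proof -
  have gf: "g \<in> forms N" "vanishes_on g (flag (Suc i))"
    using g by (auto simp: local_equation_def)
  obtain v where v: "polyfun N v" "\<And>z. z \<in> coord_space N i \<Longrightarrow> pullback g z = z i * v z"
    using polyfun_divide_coord[OF polyfun_pullback[OF gf(1)] ij(2)] vanishes_on_flag_D[OF gf(2)] by blast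
  obtain u t where ut: "local_unit N (flag j) u" "t \<in> forms N"
      "vanishes_on (u * chart_eq i - g * t) (flag i)"
    using g ij chart_eq_forms[of i] vanishes_on_chart_eq[of i "Suc i"] by (auto simp: local_equation_def)
  have u: "u \<in> forms N" "nonvanishing N j (pullback u)"
    using ut(1) by (auto simp: local_unit_flag_iff)
  have "pullback u z = v z * pullback t z" if "z \<in> coord_space N i" for z
  proof (rule coord_power_cancel[where a = 1 and N = N and i = i and p = "pullback u" and q = "\<lambda>z. v z * pullback t z" and z = z])
    show "z i ^ 1 * pullback u z = z i ^ 1 * (v z * pullback t z)" if z: "z \<in> coord_space N i" for z
      using vanishes_on_flag_D[OF ut(3) z] v(2)[OF z] ij(2) by (simp add: algebra_simps)
  qed (rule polyfun_pullback polyfun_mult that u(1) ut(2) v(1) ij(2))+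
  then have "v z \<noteq> 0" if "z \<in> coord_space N j" "pullback u z \<noteq> 0" for z
    using that coord_space_mono[of i j N] ij(1) by fastforce
  then have "nonvanishing N j v" using u(2) by blast
  then show ?thesis using v that by blast
qed

text \<open>Two presentations of \<open>s\<close> are multiplied crosswise, which eliminates
  \<open>s\<close>; the remaining factors do not vanish on the next subspace, so the powers of
  \<open>z i\<close> agree.\<close>

lemma ord_along_flag:
  assumes i: "i < N" and s: "s \<in> forms N" and u: "local_unit N (flag (Suc i)) u"
    and t: "local_unit N (flag (Suc i)) t"
    and eq: "vanishes_on (u * s - chart_eq i ^ a * t) (flag i)"
  shows "ord_along N (flag i) (flag (Suc i)) s = a"
  unfolding ord_along_def
proof (rule the_equality)
  have "local_equation N (flag i) (flag (Suc i)) (flag (Suc i)) (chart_eq i)"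
    using local_equation_flag_mono[OF chart_eq_local_equation[OF i]] i by simp
  then show "\<exists>g u t. local_equation N (flag i) (flag (Suc i)) (flag (Suc i)) g \<and>
      local_unit N (flag (Suc i)) u \<and> local_unit N (flag (Suc i)) t \<and>
      vanishes_on (u * s - g ^ a * t) (flag i)"
    using u t eq by blast
next
  fix b assume "\<exists>g u t. local_equation N (flag i) (flag (Suc i)) (flag (Suc i)) g \<and>
      local_unit N (flag (Suc i)) u \<and> local_unit N (flag (Suc i)) t \<and>
      vanishes_on (u * s - g ^ b * t) (flag i)"
  then obtain g u' t' where g: "local_equation N (flag i) (flag (Suc i)) (flag (Suc i)) g"
    and u': "local_unit N (flag (Suc i)) u'" and t': "local_unit N (flag (Suc i)) t'"
    and eq': "vanishes_on (u' * s - g ^ b * t') (flag i)" by blast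
  obtain v where v: "polyfun N v" "nonvanishing N (Suc i) v"
      "\<And>z. z \<in> coord_space N i \<Longrightarrow> pullback g z = z i * v z"
    using local_equation_pullback[OF g _ i] by blast
  have e: "pullback u z * pullback s z = z i ^ a * pullback t z"
    "pullback u' z * pullback s z = z i ^ b * (v z ^ b * pullback t' z)" if "z \<in> coord_space N i" for z
    using vanishes_on_flag_D[OF eq that] vanishes_on_flag_D[OF eq' that] v(3)[OF that] i
    by (auto simp: power_mult_distrib mult.assoc)
  have polys: "polyfun N (pullback u)" "polyfun N (pullback t)" "polyfun N (pullback u')" "polyfun N (pullback t')"
    and nz: "nonvanishing N (Suc i) (pullback u)" "nonvanishing N (Suc i) (pullback t)"
      "nonvanishing N (Suc i) (pullback u')" "nonvanishing N (Suc i) (pullback t')"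
    using u t u' t' by (simp_all add: local_unit_flag_iff polyfun_pullback)
  show "b = a"
  proof (rule coord_power_unique[symmetric, where N = N and i = i and p = "\<lambda>z. pullback u' z * pullback t z"
        and q = "\<lambda>z. pullback u z * (v z ^ b * pullback t' z)"])
    show "z i ^ a * (pullback u' z * pullback t z) = z i ^ b * (pullback u z * (v z ^ b * pullback t' z))"
      if "z \<in> coord_space N i" for z
      using e[OF that] by (metis mult.assoc mult.commute)
  qed (rule polyfun_mult polyfun_power nonvanishing_mult nonvanishing_power polys nz v(1,2) i)+
qed

text \<open>For existence the division chain is lifted to forms. For uniqueness a competing run is
  compared with the chain up to factors that are nonzero at the origin, a relation that survives
  every division and restriction.\<close>

lemma flag_valuation_eq:
  assumes s: "s \<in> forms N" and lex: "lex_order N (pullback s) \<nu>"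
  shows "flag_valuation N flag s = map \<nu> [0..<N]"
proof -
  obtain H where H0: "H 0 = pullback s" and H: "division_chain N H \<nu>"
    using lex by (auto simp: lex_order_def)
  have Hpoly: "polyfun N (H i)" if "i \<le> N" for i
    using H that by (auto simp: division_chain_def)
  have Hstep: "H i z = z i ^ \<nu> i * H (Suc i) z" if "i < N" "z \<in> coord_space N i" for i z
    using H that by (auto simp: division_chain_def)
  show ?thesis
    unfolding flag_valuation_def
  proof (rule the_equality)
    obtain d where d: "s \<in> forms_deg N d" using s by (rule formsE)
    have "\<exists>e. \<exists>f\<in>forms_deg N e. \<forall>z. pullback f z = H i z" if "i \<le> N" for i
      by (rule pullback_surj[OF Hpoly[OF that]])
    then obtain e f where f: "\<And>i. i \<le> N \<Longrightarrow> f i \<in> forms_deg N (e i)"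
      "\<And>i z. i \<le> N \<Longrightarrow> pullback (f i) z = H i z" by metis
    \<comment> \<open>A common degree for all lifts; the summand \<open>d\<close> makes the
      subtraction in \<open>?M\<close> exact also at step 0, where the section is \<open>s\<close>
      itself.\<close>
    define D where "D = d + (\<Sum>i\<le>N. e i)"
    have "\<exists>T\<in>forms_deg N D. \<forall>z. pullback T z = H i z" if "i \<le> N" for i
    proof -
      have "e i \<le> D" using member_le_sum[of i "{..N}" e] that by (simp add: D_def)
      then show ?thesis using pullback_raise_degree[OF f(1)[OF that]] f(2)[OF that] by auto
    qed
    then obtain T where T: "\<And>i. i \<le> N \<Longrightarrow> T i \<in> forms_deg N D"
      "\<And>i z. i \<le> N \<Longrightarrow> pullback (T i) z = H i z" by metis
    define t where "t i = (if i = 0 then s else T i)" for i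
    define dt where "dt i = (if i = 0 then d else D)" for i :: nat
    have t: "t i \<in> forms_deg N (dt i)" "pullback (t i) z = H i z" if "i \<le> N" for i z
      using that d T H0 by (auto simp: t_def dt_def)
    show "is_flag_valuation N flag s (map \<nu> [0..<N])"
      unfolding is_flag_valuation_def
    proof (intro conjI exI[of _ t] allI impI)
      fix i assume i: "i < N"
      let ?M = "\<nu> i * chart_deg i + D - dt i"
      have "pvar N ^ ?M * t i \<in> forms_deg N (?M * 1 + dt i)"
        using t i by (intro forms_deg_mult forms_deg_power forms_deg_pvar) auto
      moreover have "?M * 1 + dt i = \<nu> i * chart_deg i + D"
        by (simp add: dt_def D_def)
      ultimately have "pvar N ^ ?M * t i \<in> forms_deg N (\<nu> i * chart_deg i + D)" by simp
      moreover have "chart_eq i ^ \<nu> i * t (Suc i) \<in> forms_deg N (\<nu> i * chart_deg i + D)"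
        using t(1)[of "Suc i"] i by (intro forms_deg_mult forms_deg_power chart_eq_forms_deg) (auto simp: dt_def)
      ultimately have van: "vanishes_on (pvar N ^ ?M * t i - chart_eq i ^ \<nu> i * t (Suc i)) (flag i)"
        by (rule vanishes_on_flag_diffI) (use i t(2) Hstep in auto)
      have unit: "local_unit N (flag j) (pvar N ^ ?M)" for j
        using coord_space_origin[of N j] by (auto simp: local_unit_flag_iff forms_power forms_pvar)
      show unit': "local_unit N (flag (Suc i)) (t (Suc i))"
      proof -
        have "pullback (t (Suc i)) = H (Suc i)" using t(2) i by auto
        then show ?thesis
          using t(1)[of "Suc i"] i division_chain_nonvanishing[OF H, of "Suc i"]
          by (auto simp: local_unit_flag_iff)
      qed
      show "map \<nu> [0..<N] ! i = ord_along N (flag i) (flag (Suc i)) (t i)"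
      proof -
        have "t i \<in> forms N" using t(1)[of i] i by auto
        then show ?thesis using ord_along_flag[OF i _ unit unit' van] i by simp
      qed
      show "\<exists>g u. local_equation N (flag i) (flag (Suc i)) (flag N) g \<and> local_unit N (flag N) u \<and>
          vanishes_on (u * t i - g ^ (map \<nu> [0..<N] ! i) * t (Suc i)) (flag i)"
        using chart_eq_local_equation[OF i] unit van i by auto
    qed (simp_all add: t_def)
  next
    fix \<mu> assume "is_flag_valuation N flag s \<mu>"
    then obtain t where len: "length \<mu> = N" and t0: "t 0 = s"
      and t: "\<And>i. i < N \<Longrightarrow> local_unit N (flag (Suc i)) (t (Suc i)) \<and>
        (\<exists>g u. local_equation N (flag i) (flag (Suc i)) (flag N) g \<and> local_unit N (flag N) u \<and>
          vanishes_on (u * t i - g ^ (\<mu> ! i) * t (Suc i)) (flag i))"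
      unfolding is_flag_valuation_def by blast
    have tf: "t i \<in> forms N" if "i \<le> N" for i
      using that t0 s t[of "i - 1"] by (cases i) (auto simp: local_unit_def)
    \<comment> \<open>Invariant of the comparison: \<open>w\<close> and \<open>w'\<close> collect
      the denominators and the unit parts of the local equations used so far.\<close>
    have "(\<forall>j<i. \<mu> ! j = \<nu> j) \<and> (\<exists>w w'. polyfun N w \<and> polyfun N w' \<and> w (\<lambda>_. 0) \<noteq> 0 \<and> w' (\<lambda>_. 0) \<noteq> 0 \<and>
        (\<forall>z\<in>coord_space N i. w z * pullback (t i) z = w' z * H i z))" if "i \<le> N" for i
      using that
    proof (induction i)
      case 0
      show ?case
        using t0 H0 by (auto intro!: exI[of _ "\<lambda>_. 1"] polyfun_const)
    next
      case (Suc i)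
      then have i: "i < N" by simp
      obtain w w' where w: "polyfun N w" "polyfun N w'" "w (\<lambda>_. 0) \<noteq> 0" "w' (\<lambda>_. 0) \<noteq> 0"
        "\<And>z. z \<in> coord_space N i \<Longrightarrow> w z * pullback (t i) z = w' z * H i z"
        using Suc by auto
      obtain g u where g: "local_equation N (flag i) (flag (Suc i)) (flag N) g"
        and u: "local_unit N (flag N) u"
        and van: "vanishes_on (u * t i - g ^ (\<mu> ! i) * t (Suc i)) (flag i)"
        using t[OF i] by blast
      obtain v where v: "polyfun N v" "nonvanishing N N v"
          "\<And>z. z \<in> coord_space N i \<Longrightarrow> pullback g z = z i * v z"
        using local_equation_pullback[OF g i i] by blast
      define p where "p z = w z * v z ^ (\<mu> ! i)" for z
      define q where "q z = pullback u z * w' z" for z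
      have pq: "polyfun N p" "polyfun N q" "p (\<lambda>_. 0) \<noteq> 0" "q (\<lambda>_. 0) \<noteq> 0"
        using w v u unfolding p_def[abs_def] q_def[abs_def]
        by (auto simp: local_unit_flag_iff nonvanishing_full intro!: polyfun_mult polyfun_power polyfun_pullback)
      have nz: "nonvanishing N (Suc i) p" "nonvanishing N (Suc i) q"
        using pq coord_space_origin by blast+
      have eq: "z i ^ (\<mu> ! i) * (p z * pullback (t (Suc i)) z) = z i ^ \<nu> i * (q z * H (Suc i) z)"
        if "z \<in> coord_space N i" for z
      proof -
        have "z i ^ (\<mu> ! i) * (p z * pullback (t (Suc i)) z) = w z * (pullback u z * pullback (t i) z)"
          using vanishes_on_flag_D[OF van that] v(3)[OF that] by (simp add: p_def power_mult_distrib)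
        also have "\<dots> = pullback u z * (w' z * H i z)"
          using w(5)[OF that] by (simp add: mult.left_commute)
        also have "\<dots> = z i ^ \<nu> i * (q z * H (Suc i) z)"
          using Hstep[OF i that] by (simp add: q_def)
        finally show ?thesis .
      qed
      have tH: "polyfun N (pullback (t (Suc i)))" "polyfun N (H (Suc i))"
        "nonvanishing N (Suc i) (pullback (t (Suc i)))" "nonvanishing N (Suc i) (H (Suc i))"
        using t[OF i] Hpoly[of "Suc i"] division_chain_nonvanishing[OF H, of "Suc i"] i
        by (auto simp: local_unit_flag_iff polyfun_pullback)
      have \<mu>: "\<mu> ! i = \<nu> i"
        by (rule coord_power_unique[where N = N and i = i and p = "\<lambda>z. p z * pullback (t (Suc i)) z"
              and q = "\<lambda>z. q z * H (Suc i) z", OF _ _ i eq])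
          (rule polyfun_mult nonvanishing_mult pq tH nz | assumption)+
      have "p z * pullback (t (Suc i)) z = q z * H (Suc i) z" if "z \<in> coord_space N i" for z
        by (rule coord_power_cancel[where N = N and i = i and p = "\<lambda>z. p z * pullback (t (Suc i)) z"
              and q = "\<lambda>z. q z * H (Suc i) z", OF _ _ i eq[unfolded \<mu>] that])
          (rule polyfun_mult pq tH | assumption)+
      then have "\<forall>z\<in>coord_space N (Suc i). p z * pullback (t (Suc i)) z = q z * H (Suc i) z"
        using coord_space_mono[of i "Suc i" N] by auto
      then show ?case
        using Suc \<mu> pq by (auto simp: less_Suc_eq)
    qed
    from this[of N] show "\<mu> = map \<nu> [0..<N]"
      by (intro nth_equalityI) (auto simp: len)
  qed
qed

section \<open>Values of the flag valuation\<close>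

lemma coord_pos_Suc:
  assumes "r < n - 1"
  shows "coord_pos (Suc r) = Suc (2 * (n - 2 - r))"
proof -
  have "n - Suc r = Suc (n - 2 - r)" "Suc r < n" using assms by auto
  then show ?thesis by (simp add: coord_pos_def)
qed

lemma pullback_F_form_Suc:
  assumes "r < n - 1"
  shows "pullback (F_form N r) z =
    z (coord_pos (Suc r)) * z (Suc (coord_pos (Suc r))) - pullback (F_form N (Suc r)) z"
proof -
  have "Suc r \<in> {1..n - 1}" "Suc r < N" "0 < N - Suc r" using assms N_props by auto
  then show ?thesis
    using peval_F_form_Suc[of r N "chart z"] coord_pos_mirror[of "Suc r"]
    by (simp add: pullback_def chart_middle)
qed

lemma pullback_F_form_top: "pullback (F_form N (n - 1)) z = z 0"
  using pullback_chart_eq[of 0 z] N_props by (simp add: chart_eq_def)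

lemma pullback_F_form_0: "pullback (F_form N 0) z = p0_fun z"
  by (simp add: pullback_def F_form_def chart_0)

text \<open>By the recursion, \<open>F_(r+1)\<close> is a combination of \<open>z 0\<close> and of
  pair products for larger indices, all of whose coordinates precede
  \<open>coord_pos (Suc r)\<close>. The induction runs down from \<open>n - 1\<close>.\<close>

lemma pullback_F_form_vanish:
  assumes "r < n - 1" "z \<in> coord_space N (coord_pos (Suc r))"
  shows "pullback (F_form N (Suc r)) z = 0"
  using assms
proof (induction "n - 2 - r" arbitrary: r)
  case 0
  then have "Suc r = n - 1" "0 < coord_pos (Suc r)" by (auto simp: coord_pos_Suc)
  then show ?case using 0(3) pullback_F_form_top[of z] coord_space_D[of z N _ 0] by simp
next
  case (Suc k)
  then have r: "Suc r < n - 1" by simp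
  then have pos: "coord_pos (Suc (Suc r)) + 2 = coord_pos (Suc r)"
    using Suc.prems(1) by (simp add: coord_pos_Suc)
  then have "z \<in> coord_space N (coord_pos (Suc (Suc r)))"
    using Suc.prems(2) coord_space_mono[of "coord_pos (Suc (Suc r))" "coord_pos (Suc r)" N] by auto
  then have "pullback (F_form N (Suc (Suc r))) z = 0"
    using Suc.hyps(2) r by (intro Suc.hyps(1)) auto
  moreover have "z (coord_pos (Suc (Suc r))) = 0"
    by (rule coord_space_D[OF Suc.prems(2)]) (use pos in simp)
  ultimately show ?case using pullback_F_form_Suc[OF r] by simp
qed

lemma half_Suc_eq_iff: "(j + 1) div 2 = Suc k \<longleftrightarrow> j = Suc (2 * k) \<or> j = Suc (Suc (2 * k))" for j k :: nat
  by presburger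

text \<open>The value of \<open>(j + 1) div 2\<close> sorts the coordinates into the blocks {0}, {1,
  2}, {3, 4}, ...; block \<open>n - 1 - r\<close> belongs to \<open>F_r\<close>, which reduces to
  the product over its block once the earlier coordinates vanish.\<close>

lemma lex_order_F_form:
  assumes "r \<le> n - 1"
  shows "lex_order N (pullback (F_form N r)) (\<lambda>j. of_bool ((j + 1) div 2 = n - 1 - r))"
proof (cases "r = n - 1")
  case True
  have "lex_order N (\<lambda>z. z 0) (\<lambda>j. of_bool (j = 0))"
    using N_props by (intro lex_order_coord) auto
  moreover have "pullback (F_form N r) = (\<lambda>z. z 0)"
    using True pullback_F_form_top by auto
  ultimately have "lex_order N (pullback (F_form N r)) (\<lambda>j. of_bool (j = 0))" by simp
  then show ?thesis
    by (rule lex_order_cong) (use True in \<open>auto simp: div_eq_0_iff\<close>)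
next
  case False
  with assms have r: "r < n - 1" by simp
  define i where "i = coord_pos (Suc r)"
  have i: "i = Suc (2 * (n - 2 - r))" using coord_pos_Suc[OF r] by (simp add: i_def)
  have "lex_order N (pullback (F_form N r)) (\<lambda>j. of_bool (j = i \<or> j = Suc i))"
  proof (rule lex_order_coord_pair[where c = 1])
    show "polyfun N (pullback (F_form N r))"
      using r N_props by (intro polyfun_pullback forms_deg_formsI[OF F_form_in_forms_deg]) simp
    show "pullback (F_form N r) z = 1 * (z i * z (Suc i))" if "z \<in> coord_space N i" for z
      using pullback_F_form_Suc[OF r] pullback_F_form_vanish[OF r] that by (simp add: i_def)
    show "Suc i < N" using i r n_ge by (simp add: N_def)
  qed simp
  moreover have "j = i \<or> j = Suc i \<longleftrightarrow> (j + 1) div 2 = n - 1 - r" for j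
  proof -
    have "n - 1 - r = Suc (n - 2 - r)" using r by simp
    then show ?thesis unfolding i by (simp only: half_Suc_eq_iff)
  qed
  ultimately show ?thesis by simp
qed

lemma H_form_in_forms: "H_form n \<in> forms N"
proof -
  have "(\<Prod>r=1..n-1. F_form N r) \<in> forms_deg N (\<Sum>r=1..n-1. 2)"
    using N_props by (intro forms_deg_prod F_form_in_forms_deg) auto
  then show ?thesis
    unfolding H_form_def N_def[symmetric] by (intro forms_mult forms_pvar forms_deg_formsI) auto
qed

text \<open>As \<open>p_0 p_N\<close> is \<open>F_0\<close>, the form is the product of
  \<open>F_0, ..., F_(n-1)\<close>, and each coordinate lies in the block of exactly one
  factor.\<close>

lemma flag_valuation_H_form: "flag_valuation N flag (H_form n) = replicate N 1"
proof -
  have split: "{..n - 1} = insert 0 {1..n - 1}" by auto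
  have eq: "pullback (H_form n) z = (\<Prod>r\<le>n - 1. pullback (F_form N r) z)" for z
    unfolding H_form_def N_def[symmetric] split using pullback_F_form_0[of z]
    by (simp add: pullback_def chart_0)
  have "lex_order N (pullback (H_form n)) (\<lambda>i. \<Sum>r\<le>n - 1. of_bool ((i + 1) div 2 = n - 1 - r))"
    unfolding eq[abs_def] by (intro lex_order_prod lex_order_F_form) simp
  moreover have "(\<Sum>r\<le>n - 1. of_bool ((i + 1) div 2 = n - 1 - r)) = (1 :: nat)" if "i < N" for i
  proof -
    define q where "q = (i + 1) div 2"
    have "i + 1 < 2 * n" using that n_ge by (simp add: N_def)
    then have "q < n" unfolding q_def by (simp add: less_mult_imp_div_less mult.commute)
    then have "(\<Sum>r\<le>n - 1. of_bool (q = n - 1 - r)) = (\<Sum>r\<le>n - 1. if r = n - 1 - q then 1 else 0 :: nat)"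
      by (intro sum.cong) auto
    also have "\<dots> = 1" by (subst sum.delta) auto
    finally show ?thesis by (simp only: q_def)
  qed
  ultimately have "lex_order N (pullback (H_form n)) (\<lambda>i. 1)"
    by (rule lex_order_cong)
  then show ?thesis
    using flag_valuation_eq[OF H_form_in_forms] by (simp add: map_replicate_const)
qed

text \<open>The left side is the degree of the product with value \<open>\<alpha>\<close>:
  \<open>F_(n-1)\<close> counts twice, and the maximum is min + (a - min) + (c - min) for the
  exponents a, c of the last two coordinates.\<close>

definition exponents :: "nat \<Rightarrow> (nat \<Rightarrow> nat) set" where
  "exponents d = {\<alpha>. (\<forall>i\<ge>N. \<alpha> i = 0) \<and>
     2 * \<alpha> 0 + (\<Sum>i\<in>{1..<N - 2}. \<alpha> i) + max (\<alpha> (N - 2)) (\<alpha> (N - 1)) \<le> d}"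

text \<open>On the quadric surface left after the first \<open>N - 2\<close> steps, \<open>p\<^sub>0 p\<^sub>N = p\<^sub>1 p\<^sub>N\<^sub>-\<^sub>1\<close>, so \<open>p\<^sub>0\<close> has the same order
  as \<open>p\<^sub>1 p\<^sub>N\<^sub>-\<^sub>1\<close> while its degree is smaller.\<close>

definition basis_fun :: "(nat \<Rightarrow> nat) \<Rightarrow> (nat \<Rightarrow> complex) \<Rightarrow> complex" where
  "basis_fun \<alpha> z = (let a = \<alpha> (N - 2); c = \<alpha> (N - 1) in (\<Prod>i<N - 2. z i ^ \<alpha> i) *
     p0_fun z ^ min a c * z (N - 2) ^ (a - min a c) * z (N - 1) ^ (c - min a c))"

lemma N_eq_Suc: "N = Suc (Suc (N - 2))" "N - 1 = Suc (N - 2)"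
  using N_props by auto

lemma lex_order_p0: "lex_order N p0_fun (\<lambda>j. of_bool (j = N - 2 \<or> j = N - 1))"
proof -
  have "pullback (F_form N 0) = p0_fun" using pullback_F_form_0 by auto
  then have "lex_order N p0_fun (\<lambda>j. of_bool ((j + 1) div 2 = n - 1))"
    using lex_order_F_form[of 0] by simp
  then show ?thesis
  proof (rule lex_order_cong)
    fix j
    have "(j + 1) div 2 = n - 1 \<longleftrightarrow> j = N - 2 \<or> j = N - 1"
    proof -
      have "N - 2 = Suc (2 * (n - 2))" "N - 1 = Suc (Suc (2 * (n - 2)))" "n - 1 = Suc (n - 2)"
        using n_ge by (auto simp: N_def)
      then show ?thesis by (simp only: half_Suc_eq_iff)
    qed
    then show "of_bool ((j + 1) div 2 = n - 1) = (of_bool (j = N - 2 \<or> j = N - 1) :: nat)" by simp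
  qed
qed

text \<open>Each factor \<open>p_0\<close> contributes to both of the last two exponents; the powers
  of \<open>z (N - 2)\<close> and \<open>z (N - 1)\<close> make up the differences.\<close>

lemma lex_order_basis_fun: "lex_order N (basis_fun \<alpha>) \<alpha>"
proof -
  let ?a = "\<alpha> (N - 2)" and ?c = "\<alpha> (N - 1)"
  have "lex_order N (\<lambda>z. (\<Prod>i<N - 2. z i ^ \<alpha> i) *
     p0_fun z ^ min ?a ?c * z (N - 2) ^ (?a - min ?a ?c) * z (N - 1) ^ (?c - min ?a ?c))
     (\<lambda>j. (\<Sum>i<N - 2. \<alpha> i * of_bool (j = i)) + min ?a ?c * of_bool (j = N - 2 \<or> j = N - 1) +
       (?a - min ?a ?c) * of_bool (j = N - 2) + (?c - min ?a ?c) * of_bool (j = N - 1))"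
    using N_props
    by (intro lex_order_mult lex_order_prod lex_order_power lex_order_coord lex_order_p0) auto
  then have "lex_order N (basis_fun \<alpha>)
     (\<lambda>j. (\<Sum>i<N - 2. \<alpha> i * of_bool (j = i)) + min ?a ?c * of_bool (j = N - 2 \<or> j = N - 1) +
       (?a - min ?a ?c) * of_bool (j = N - 2) + (?c - min ?a ?c) * of_bool (j = N - 1))"
    unfolding basis_fun_def[abs_def] Let_def .
  then show ?thesis
  proof (rule lex_order_cong)
    fix j assume j: "j < N"
    have "(\<Sum>i<N - 2. \<alpha> i * of_bool (j = i)) = (\<Sum>i<N - 2. if i = j then \<alpha> j else 0)"
      by (rule sum.cong) auto
    then have s: "(\<Sum>i<N - 2. \<alpha> i * of_bool (j = i)) = (if j < N - 2 then \<alpha> j else 0)"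
      by simp
    consider "j < N - 2" | "j = N - 2" | "j = N - 1" using j by linarith
    then show "(\<Sum>i<N - 2. \<alpha> i * of_bool (j = i)) + min ?a ?c * of_bool (j = N - 2 \<or> j = N - 1) +
       (?a - min ?a ?c) * of_bool (j = N - 2) + (?c - min ?a ?c) * of_bool (j = N - 1) = \<alpha> j"
      unfolding s using N_eq_Suc(2) by cases auto
  qed
qed

lemma basis_fun_lift:
  assumes \<alpha>: "\<alpha> \<in> exponents d"
  shows "\<exists>f\<in>forms_deg N d. \<forall>z. pullback f z = basis_fun \<alpha> z"
proof -
  let ?a = "\<alpha> (N - 2)" and ?c = "\<alpha> (N - 1)"
  let ?f = "(\<Prod>i<N - 2. chart_eq i ^ \<alpha> i) * pvar 0 ^ min ?a ?c *
    chart_eq (N - 2) ^ (?a - min ?a ?c) * chart_eq (N - 1) ^ (?c - min ?a ?c)"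
  let ?d = "(\<Sum>i<N - 2. \<alpha> i * chart_deg i) + min ?a ?c * 1 +
    (?a - min ?a ?c) * chart_deg (N - 2) + (?c - min ?a ?c) * chart_deg (N - 1)"
  have f: "?f \<in> forms_deg N ?d"
    using N_props
    by (intro forms_deg_mult forms_deg_prod forms_deg_power chart_eq_forms_deg forms_deg_pvar) auto
  have d: "?d \<le> d"
  proof -
    have "{..<N - 2} = insert 0 {1..<N - 2}" using N_props by auto
    then have "(\<Sum>i<N - 2. \<alpha> i * chart_deg i) = \<alpha> 0 * 2 + (\<Sum>i\<in>{1..<N - 2}. \<alpha> i * chart_deg i)"
      by (simp add: chart_deg_def)
    also have "(\<Sum>i\<in>{1..<N - 2}. \<alpha> i * chart_deg i) = (\<Sum>i\<in>{1..<N - 2}. \<alpha> i)"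
      by (rule sum.cong) (auto simp: chart_deg_def)
    finally have s: "(\<Sum>i<N - 2. \<alpha> i * chart_deg i) = 2 * \<alpha> 0 + (\<Sum>i\<in>{1..<N - 2}. \<alpha> i)" by simp
    have deg: "chart_deg (N - 2) = 1" "chart_deg (N - 1) = 1"
      using N_props by (auto simp: chart_deg_def)
    have "min ?a ?c + (?a - min ?a ?c) + (?c - min ?a ?c) = max ?a ?c" by simp
    then have "?d = 2 * \<alpha> 0 + (\<Sum>i\<in>{1..<N - 2}. \<alpha> i) + max ?a ?c"
      unfolding s deg by linarith
    then show ?thesis using \<alpha> unfolding exponents_def by simp
  qed
  have eq: "pullback ?f z = basis_fun \<alpha> z" for z
  proof -
    have "pullback (\<Prod>i<N - 2. chart_eq i ^ \<alpha> i) z = (\<Prod>i<N - 2. z i ^ \<alpha> i)"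
      by (simp add: pullback_def peval_chart_eq)
    moreover have "N - 2 < N" "N - 1 < N" using N_props by auto
    ultimately show ?thesis by (simp add: basis_fun_def Let_def)
  qed
  show ?thesis using pullback_raise_degree[OF f d] unfolding eq .
qed

section \<open>Every form is a combination of the distinguished products\<close>

definition basis_span :: "nat \<Rightarrow> ((nat \<Rightarrow> complex) \<Rightarrow> complex) set" where
  "basis_span d = {h. \<exists>c. \<forall>z. h z = (\<Sum>\<alpha>\<in>exponents d. c \<alpha> * basis_fun \<alpha> z)}"

lemma finite_exponents: "finite (exponents d)"
proof (rule finite_subset)
  show "finite {\<alpha>. \<forall>i. (i \<in> {..<N} \<longrightarrow> \<alpha> i \<in> {..d}) \<and> (i \<notin> {..<N} \<longrightarrow> \<alpha> i = 0)}"
    by (rule finite_set_of_finite_funs) auto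
  show "exponents d \<subseteq> {\<alpha>. \<forall>i. (i \<in> {..<N} \<longrightarrow> \<alpha> i \<in> {..d}) \<and> (i \<notin> {..<N} \<longrightarrow> \<alpha> i = 0)}"
  proof clarify
    fix \<alpha> i assume \<alpha>: "\<alpha> \<in> exponents d"
    have "\<alpha> i \<le> d" if i: "i < N"
    proof -
      have "i = 0 \<or> i \<in> {1..<N - 2} \<or> i = N - 2 \<or> i = N - 1" using i by auto
      then consider "i = 0" | "i \<in> {1..<N - 2}" | "i = N - 2" | "i = N - 1" by blast
      then show ?thesis
        using \<alpha> member_le_sum[of i "{1..<N - 2}" \<alpha>] by cases (auto simp: exponents_def)
    qed
    then show "(i \<in> {..<N} \<longrightarrow> \<alpha> i \<in> {..d}) \<and> (i \<notin> {..<N} \<longrightarrow> \<alpha> i = 0)"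
      using \<alpha> by (auto simp: exponents_def)
  qed
qed

lemma basis_span_base:
  assumes "\<alpha> \<in> exponents d"
  shows "basis_fun \<alpha> \<in> basis_span d"
proof -
  have "basis_fun \<alpha> z = (\<Sum>\<beta>\<in>exponents d. (if \<beta> = \<alpha> then 1 else 0) * basis_fun \<beta> z)" for z
  proof -
    have "(\<Sum>\<beta>\<in>exponents d. (if \<beta> = \<alpha> then 1 else 0) * basis_fun \<beta> z) =
        (\<Sum>\<beta>\<in>exponents d. if \<beta> = \<alpha> then basis_fun \<alpha> z else 0)"
      by (rule sum.cong) auto
    then show ?thesis using assms finite_exponents by simp
  qed
  then show ?thesis unfolding basis_span_def by (auto intro!: exI[of _ "\<lambda>\<beta>. if \<beta> = \<alpha> then 1 else 0"])
qed

lemma basis_span_add: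
  assumes "h \<in> basis_span d" "h' \<in> basis_span d"
  shows "(\<lambda>z. h z + h' z) \<in> basis_span d"
proof -
  obtain c c' where "\<And>z. h z = (\<Sum>\<alpha>\<in>exponents d. c \<alpha> * basis_fun \<alpha> z)"
    "\<And>z. h' z = (\<Sum>\<alpha>\<in>exponents d. c' \<alpha> * basis_fun \<alpha> z)"
    using assms by (auto simp: basis_span_def)
  then show ?thesis
    unfolding basis_span_def
    by (intro CollectI exI[of _ "\<lambda>\<alpha>. c \<alpha> + c' \<alpha>"]) (simp add: sum.distrib distrib_right)
qed

lemma basis_span_scale:
  assumes "h \<in> basis_span d"
  shows "(\<lambda>z. a * h z) \<in> basis_span d"
proof -
  obtain c where "\<And>z. h z = (\<Sum>\<alpha>\<in>exponents d. c \<alpha> * basis_fun \<alpha> z)"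
    using assms by (auto simp: basis_span_def)
  then show ?thesis
    unfolding basis_span_def
    by (intro CollectI exI[of _ "\<lambda>\<alpha>. a * c \<alpha>"]) (simp add: sum_distrib_left mult.assoc)
qed

lemma basis_span_sum:
  assumes "\<And>i. i \<in> S \<Longrightarrow> h i \<in> basis_span d"
  shows "(\<lambda>z. \<Sum>i\<in>S. h i z) \<in> basis_span d"
proof -
  have 0: "(\<lambda>z. 0) \<in> basis_span d"
    unfolding basis_span_def by (intro CollectI exI[of _ "\<lambda>\<alpha>. 0"]) simp
  show ?thesis
    using assms by (induction S rule: infinite_finite_induct) (auto intro: 0 basis_span_add)
qed

text \<open>Here \<open>p_0\<close> is kept as a function beside the coordinates: it lifts to degree
  1, while its expression in the coordinates needs degree 2. The degree of the lift is
  \<open>i + weight \<beta>\<close>.\<close>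

definition monomial_fun :: "nat \<Rightarrow> (nat \<Rightarrow> nat) \<Rightarrow> (nat \<Rightarrow> complex) \<Rightarrow> complex" where
  "monomial_fun i \<beta> z = p0_fun z ^ i * (\<Prod>j<N. z j ^ \<beta> j)"

definition weight :: "(nat \<Rightarrow> nat) \<Rightarrow> nat" where
  "weight \<beta> = (\<Sum>j<N. chart_deg j * \<beta> j)"

abbreviation inc :: "(nat \<Rightarrow> nat) \<Rightarrow> nat \<Rightarrow> nat \<Rightarrow> nat" where
  "inc \<beta> k \<equiv> \<beta>(k := Suc (\<beta> k))"

lemma monomial_fun_inc:
  assumes "k < N"
  shows "monomial_fun i (inc \<beta> k) z = z k * monomial_fun i \<beta> z"
proof -
  have "(\<Prod>j<N. z j ^ inc \<beta> k j) = (\<Prod>j<N. (if j = k then z k else 1) * z j ^ \<beta> j)"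
    by (rule prod.cong) auto
  also have "\<dots> = z k * (\<Prod>j<N. z j ^ \<beta> j)"
    using assms by (simp add: prod.distrib)
  finally show ?thesis by (simp add: monomial_fun_def)
qed

lemma weight_inc:
  assumes "k < N"
  shows "weight (inc \<beta> k) = chart_deg k + weight \<beta>"
proof -
  have "weight (inc \<beta> k) = (\<Sum>j<N. (if j = k then chart_deg k else 0) + chart_deg j * \<beta> j)"
    unfolding weight_def by (rule sum.cong) auto
  also have "\<dots> = chart_deg k + weight \<beta>"
    using assms by (simp add: sum.distrib weight_def)
  finally show ?thesis .
qed

text \<open>The definition of \<open>p0_fun\<close>, solved for its summand with
  \<open>r = 1\<close>. No term on the right exceeds degree 2, so substituting it respects the
  degree bound.\<close>

lemma coord_relation:
  obtains a b e where "\<And>z. z (N - 2) * z (N - 1) = a * z 0 + b * p0_fun z +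
    (\<Sum>r\<in>{2..n - 1}. e r * (z (coord_pos r) * z (Suc (coord_pos r))))"
proof
  fix z :: "nat \<Rightarrow> complex"
  let ?s = "(- 1) ^ (n - 1) :: complex"
  let ?q = "\<lambda>r. z (coord_pos r) * z (Suc (coord_pos r))"
  have sq: "?s * (?s * x) = x" for x
    by (simp flip: mult.assoc power_add mult_2)
  have "(\<Sum>r\<in>{1..n - 1}. (- 1) ^ (n - 1 - r) * (z (coord_pos r) * z (coord_pos (N - r)))) =
      (\<Sum>r\<in>{1..n - 1}. (- 1) ^ (n - 1 - r) * ?q r)"
    by (rule sum.cong) (auto simp: coord_pos_mirror)
  also have "\<dots> = (- 1) ^ (n - 2) * ?q 1 + (\<Sum>r\<in>{2..n - 1}. (- 1) ^ (n - 1 - r) * ?q r)"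
  proof -
    have "{1..n - 1} = insert 1 {2..n - 1}" using n_ge by auto
    then show ?thesis by (simp add: numeral_2_eq_2)
  qed
  also have "?q 1 = z (N - 2) * z (N - 1)"
  proof -
    have "coord_pos 1 = N - 2" "Suc (N - 2) = N - 1"
      using coord_pos_Suc[of 0] n_ge by (auto simp: N_def)
    then show ?thesis by (simp only:)
  qed
  also have "(- 1) ^ (n - 2) = - ?s"
  proof -
    have "n - 1 = Suc (n - 2)" using n_ge by simp
    then show ?thesis by simp
  qed
  finally have "?s * p0_fun z = z 0 + ?s * (z (N - 2) * z (N - 1)) -
      (\<Sum>r\<in>{2..n - 1}. (- 1) ^ (n - 1 - r) * ?q r)"
    unfolding p0_fun_def sq by simp
  then have "?s * (z (N - 2) * z (N - 1)) = ?s * p0_fun z - z 0 +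
      (\<Sum>r\<in>{2..n - 1}. (- 1) ^ (n - 1 - r) * ?q r)"
    by (simp add: algebra_simps)
  then have "?s * (?s * (z (N - 2) * z (N - 1))) = ?s * (?s * p0_fun z - z 0 +
      (\<Sum>r\<in>{2..n - 1}. (- 1) ^ (n - 1 - r) * ?q r))"
    by (rule arg_cong)
  then show "z (N - 2) * z (N - 1) = - ?s * z 0 + 1 * p0_fun z +
      (\<Sum>r\<in>{2..n - 1}. (?s * (- 1) ^ (n - 1 - r)) * ?q r)"
    unfolding sq distrib_left right_diff_distrib sum_distrib_left by (simp add: mult.assoc)
qed

text \<open>The relation rewrites a monomial divisible by \<open>p\<^sub>1 p\<^sub>N\<^sub>-\<^sub>1\<close> in terms of monomials that contain this
  product to a smaller power and whose weight is not larger.\<close>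

lemma monomial_fun_in_basis_span:
  assumes "i + weight \<beta> \<le> d"
  shows "monomial_fun i \<beta> \<in> basis_span d"
  using assms
proof (induction "min (\<beta> (N - 2)) (\<beta> (N - 1))" arbitrary: i \<beta>)
  case 0
  \<comment> \<open>Without a common factor of the last two coordinates the monomial already is a
    distinguished product; the \<open>i\<close> factors \<open>p_0\<close> add \<open>i\<close> to
    both of the last exponents.\<close>
  let ?\<alpha> = "\<lambda>j. if j < N - 2 then \<beta> j else if j < N then \<beta> j + i else 0"
  have N': "0 < N - 2" "N - 2 < N" "\<not> N - 1 < N - 2" "N - 1 < N" "N - 1 \<noteq> N - 2" using N_props by auto
  have min: "min (?\<alpha> (N - 2)) (?\<alpha> (N - 1)) = i"
    using 0(1) N' by (simp add: min_def split: if_splits)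
  have top: "{..<N} = insert (N - 1) (insert (N - 2) {..<N - 2})" using N' by auto
  have split: "(\<Prod>j<N. z j ^ \<beta> j) = (\<Prod>j<N - 2. z j ^ \<beta> j) * z (N - 2) ^ \<beta> (N - 2) * z (N - 1) ^ \<beta> (N - 1)"
    for z :: "nat \<Rightarrow> complex"
    unfolding top using N' by (simp add: mult_ac)
  have "basis_fun ?\<alpha> z = monomial_fun i \<beta> z" for z
    unfolding basis_fun_def Let_def min monomial_fun_def split using N' by simp
  then have "basis_fun ?\<alpha> = monomial_fun i \<beta>" by auto
  moreover have "?\<alpha> \<in> exponents d"
  proof -
    have "weight \<beta> = (\<Sum>j<N - 2. chart_deg j * \<beta> j) + \<beta> (N - 2) + \<beta> (N - 1)"
      unfolding weight_def top using N' by (simp add: chart_deg_def)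
    moreover have "{..<N - 2} = insert 0 {1..<N - 2}" using N' by auto
    then have "(\<Sum>j<N - 2. chart_deg j * \<beta> j) = 2 * \<beta> 0 + (\<Sum>j\<in>{1..<N - 2}. chart_deg j * \<beta> j)"
      by (simp add: chart_deg_def)
    moreover have "(\<Sum>j\<in>{1..<N - 2}. chart_deg j * \<beta> j) = (\<Sum>j\<in>{1..<N - 2}. ?\<alpha> j)"
      by (rule sum.cong) (auto simp: chart_deg_def)
    ultimately have "i + (2 * \<beta> 0 + (\<Sum>j\<in>{1..<N - 2}. ?\<alpha> j) + \<beta> (N - 2) + \<beta> (N - 1)) \<le> d"
      using 0(2) by simp
    then show ?thesis
      unfolding exponents_def using N' by (auto simp: max_def)
  qed
  ultimately show ?case using basis_span_base[of ?\<alpha> d] by simp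
next
  case (Suc k)
  let ?\<gamma> = "\<beta>(N - 2 := \<beta> (N - 2) - 1, N - 1 := \<beta> (N - 1) - 1)"
  have N': "0 < N - 2" "N - 2 < N" "N - 2 \<noteq> N - 1" "N - 1 < N" "0 < N" "N - 1 \<noteq> 0" using N_props by auto
  have gt: "0 < \<beta> (N - 2)" "0 < \<beta> (N - 1)"
    using Suc.hyps(2) by linarith+
  have \<beta>: "\<beta> = inc (inc ?\<gamma> (N - 2)) (N - 1)"
    using gt N' by (simp add: fun_eq_iff)
  have "k = min (\<beta> (N - 2) - 1) (\<beta> (N - 1) - 1)"
    using Suc.hyps(2) by (metis diff_Suc_1 min_diff)
  then have min: "k = min (?\<gamma> (N - 2)) (?\<gamma> (N - 1))"
    using N' by simp
  have w: "weight \<beta> = weight ?\<gamma> + 2"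
    using weight_inc[of "N - 2" ?\<gamma>] weight_inc[of "N - 1" "inc ?\<gamma> (N - 2)"] \<beta> N'
    by (simp add: chart_deg_def)
  have step: "monomial_fun i' \<delta> \<in> basis_span d"
    if "i' + weight \<delta> \<le> d" "\<delta> (N - 2) = ?\<gamma> (N - 2)" "\<delta> (N - 1) = ?\<gamma> (N - 1)" for i' \<delta>
    by (rule Suc.hyps(1)) (use that min in simp_all)
  obtain a b e where rel: "\<And>z. z (N - 2) * z (N - 1) = a * z 0 + b * p0_fun z +
      (\<Sum>r\<in>{2..n - 1}. e r * (z (coord_pos r) * z (Suc (coord_pos r))))"
    using coord_relation by blast
  \<comment> \<open>The pairs brought in by the relation lie before position \<open>N - 2\<close>,
    so rewriting never restores the last pair and the induction measure drops.\<close>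
  have pos: "0 < coord_pos r" "Suc (coord_pos r) < N - 2" if r: "r \<in> {2..n - 1}" for r
  proof -
    obtain r' where r': "r = Suc r'" "0 < r'" "r' < n - 1" using r by (cases r) auto
    then have "coord_pos r = Suc (2 * (n - 2 - r'))" using coord_pos_Suc by simp
    then show "0 < coord_pos r" "Suc (coord_pos r) < N - 2"
      using r' by (auto simp: N_def)
  qed
  have "monomial_fun i \<beta> z = a * monomial_fun i (inc ?\<gamma> 0) z + b * monomial_fun (Suc i) ?\<gamma> z +
      (\<Sum>r\<in>{2..n - 1}. e r * monomial_fun i (inc (inc ?\<gamma> (coord_pos r)) (Suc (coord_pos r))) z)" for z
  proof -
    have "monomial_fun i \<beta> z = monomial_fun i (inc (inc ?\<gamma> (N - 2)) (N - 1)) z"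
      by (rule arg_cong[OF \<beta>])
    also have "\<dots> = (z (N - 2) * z (N - 1)) * monomial_fun i ?\<gamma> z"
      using N' by (simp only: monomial_fun_inc) (simp add: mult.assoc mult.left_commute)
    also have "\<dots> = a * (z 0 * monomial_fun i ?\<gamma> z) + b * (p0_fun z * monomial_fun i ?\<gamma> z) +
        (\<Sum>r\<in>{2..n - 1}. e r * (z (Suc (coord_pos r)) * (z (coord_pos r) * monomial_fun i ?\<gamma> z)))"
      unfolding rel by (simp add: distrib_right sum_distrib_right mult.assoc mult.left_commute)
    also have "z 0 * monomial_fun i ?\<gamma> z = monomial_fun i (inc ?\<gamma> 0) z"
      using N' by (simp only: monomial_fun_inc)
    also have "p0_fun z * monomial_fun i ?\<gamma> z = monomial_fun (Suc i) ?\<gamma> z"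
      by (simp add: monomial_fun_def mult.assoc)
    also have "(\<Sum>r\<in>{2..n - 1}. e r * (z (Suc (coord_pos r)) * (z (coord_pos r) * monomial_fun i ?\<gamma> z))) =
        (\<Sum>r\<in>{2..n - 1}. e r * monomial_fun i (inc (inc ?\<gamma> (coord_pos r)) (Suc (coord_pos r))) z)"
    proof (rule sum.cong)
      fix r assume "r \<in> {2..n - 1}"
      then have "coord_pos r < N" "Suc (coord_pos r) < N" using pos[of r] by auto
      then show "e r * (z (Suc (coord_pos r)) * (z (coord_pos r) * monomial_fun i ?\<gamma> z)) =
          e r * monomial_fun i (inc (inc ?\<gamma> (coord_pos r)) (Suc (coord_pos r))) z"
        by (simp only: monomial_fun_inc)
    qed simp
    finally show ?thesis .
  qed
  then have eq: "monomial_fun i \<beta> = (\<lambda>z. a * monomial_fun i (inc ?\<gamma> 0) z + b * monomial_fun (Suc i) ?\<gamma> z +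
      (\<Sum>r\<in>{2..n - 1}. e r * monomial_fun i (inc (inc ?\<gamma> (coord_pos r)) (Suc (coord_pos r))) z))"
    by auto
  show ?case
    unfolding eq
  proof (intro basis_span_add basis_span_sum basis_span_scale step)
    show "i + weight (inc ?\<gamma> 0) \<le> d"
      using Suc.prems w N' by (simp only: weight_inc) (simp add: chart_deg_def)
    show "inc ?\<gamma> 0 (N - 2) = ?\<gamma> (N - 2)" "inc ?\<gamma> 0 (N - 1) = ?\<gamma> (N - 1)"
      using N' by auto
    show "Suc i + weight ?\<gamma> \<le> d" using Suc.prems w by simp
    fix r assume r: "r \<in> {2..n - 1}"
    let ?\<delta> = "inc (inc ?\<gamma> (coord_pos r)) (Suc (coord_pos r))"
    have "coord_pos r < N" "Suc (coord_pos r) < N" using pos[OF r] by auto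
    then have "weight ?\<delta> = chart_deg (Suc (coord_pos r)) + (chart_deg (coord_pos r) + weight ?\<gamma>)"
      by (simp only: weight_inc)
    then show "i + weight ?\<delta> \<le> d"
      using Suc.prems w pos(1)[OF r] by (simp add: chart_deg_def)
    show "?\<delta> (N - 2) = ?\<gamma> (N - 2)" "?\<delta> (N - 1) = ?\<gamma> (N - 1)"
      using pos[OF r] by auto
  qed simp_all
qed

lemma pullback_in_basis_span:
  assumes f: "f \<in> forms_deg N d"
  shows "pullback f \<in> basis_span d"
proof -
  have "(\<lambda>z. mono_eval m (chart z)) \<in> basis_span d" if m: "m \<in> Poly_Mapping.keys f" for m
  proof -
    let ?m = "Poly_Mapping.lookup m"
    \<comment> \<open>A monomial in the variables has no factor \<open>F_(n-1)\<close>, hence the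
      entry 0 at index 0; the exponent of \<open>p_0\<close> is passed separately, and that of
      \<open>p_N\<close> is lost on the chart.\<close>
    let ?\<beta> = "\<lambda>j. if j = 0 then 0 else ?m (coord_var j)"
    have m': "Poly_Mapping.keys m \<subseteq> {..N}" "(\<Sum>i\<le>N. ?m i) = d"
      using f m by (auto simp: forms_deg_iff)
    have split: "{..N} = insert N (insert 0 {1..<N})" "{..<N} = insert 0 {1..<N}" using N_props by auto
    have bounds: "0 < coord_pos k" "0 < coord_var k" "coord_pos k \<noteq> 0" "coord_var k \<noteq> 0" "coord_pos k < N" "coord_var k < N" if "0 < k" "k < N" for k
      using coord_pos_bounds[OF that] coord_var_bounds[OF that] by auto
    have N0: "N \<notin> insert 0 {1..<N}" using N_props by simp
    have "mono_eval m (chart z) = monomial_fun (?m 0) ?\<beta> z" for z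
    proof -
      have "mono_eval m (chart z) = p0_fun z ^ ?m 0 * (\<Prod>k\<in>{1..<N}. chart z k ^ ?m k)"
        unfolding mono_eval_superset[OF finite_atMost m'(1)] split(1)
        using N0 by (simp add: chart_0)
      also have "(\<Prod>k\<in>{1..<N}. chart z k ^ ?m k) = (\<Prod>j\<in>{1..<N}. z j ^ ?\<beta> j)"
        by (rule prod.reindex_bij_witness[of _ coord_var coord_pos])
          (auto simp: coord_var_pos coord_pos_var chart_middle Suc_le_eq bounds)
      finally show ?thesis unfolding monomial_fun_def split(2) by simp
    qed
    then have "(\<lambda>z. mono_eval m (chart z)) = monomial_fun (?m 0) ?\<beta>" by auto
    moreover have "?m 0 + weight ?\<beta> \<le> d"
    proof -
      have "weight ?\<beta> = (\<Sum>j\<in>{1..<N}. ?m (coord_var j))"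
        unfolding weight_def split(2) by (auto simp: chart_deg_def intro!: sum.cong)
      also have "\<dots> = (\<Sum>k\<in>{1..<N}. ?m k)"
        by (rule sum.reindex_bij_witness[of _ coord_pos coord_var])
          (auto simp: coord_var_pos coord_pos_var Suc_le_eq bounds)
      finally show ?thesis using m'(2) N0 unfolding split(1) by simp
    qed
    ultimately show ?thesis using monomial_fun_in_basis_span by simp
  qed
  then have "(\<lambda>z. \<Sum>m\<in>Poly_Mapping.keys f. Poly_Mapping.lookup f m * mono_eval m (chart z)) \<in> basis_span d"
    by (intro basis_span_sum basis_span_scale)
  then show ?thesis by (simp add: pullback_def[abs_def] peval_conv_mono)
qed

lemma flag_valuation_values:
  "{flag_valuation N flag s |s. s \<in> forms_deg N d \<and> s \<noteq> 0} = (\<lambda>\<alpha>. map \<alpha> [0..<N]) ` exponents d"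
proof (intro equalityI subsetI)
  fix \<nu> assume "\<nu> \<in> {flag_valuation N flag s |s. s \<in> forms_deg N d \<and> s \<noteq> 0}"
  then obtain s where s: "s \<in> forms_deg N d" "s \<noteq> 0" "\<nu> = flag_valuation N flag s" by blast
  obtain c where c: "\<And>z. pullback s z = (\<Sum>\<alpha>\<in>exponents d. c \<alpha> * basis_fun \<alpha> z)"
    using pullback_in_basis_span[OF s(1)] by (auto simp: basis_span_def)
  let ?S = "{\<alpha> \<in> exponents d. c \<alpha> \<noteq> 0}"
  have c': "pullback s z = (\<Sum>\<alpha>\<in>?S. c \<alpha> * basis_fun \<alpha> z)" for z
    unfolding c by (rule sum.mono_neutral_right) (auto simp: finite_exponents)
  \<comment> \<open>Otherwise the pullback is zero, so the form vanishes as a function and then as a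
    polynomial.\<close>
  have "?S \<noteq> {}"
  proof
    assume "?S = {}"
    then have "peval s v = 0" for v
      using pullback_zero_imp_peval_zero[of s v] s(1) c' by auto
    then show False using form_eq_zeroI[OF s(1)] s(2) by blast
  qed
  have "\<exists>\<alpha>\<in>?S. lex_order N (\<lambda>z. \<Sum>\<alpha>\<in>?S. c \<alpha> * basis_fun \<alpha> z) \<alpha>"
  proof (rule lex_order_sum)
    show "finite ?S" using finite_exponents by simp
    show "\<alpha> i = 0" if "\<alpha> \<in> ?S" "N \<le> i" for \<alpha> i
      using that by (simp add: exponents_def)
  qed (use \<open>?S \<noteq> {}\<close> lex_order_basis_fun in simp_all)
  then obtain \<alpha> where \<alpha>: "\<alpha> \<in> ?S" "lex_order N (pullback s) \<alpha>"
    unfolding c'[abs_def, symmetric] by blast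
  then show "\<nu> \<in> (\<lambda>\<alpha>. map \<alpha> [0..<N]) ` exponents d"
    using flag_valuation_eq[of s \<alpha>] s \<alpha>(1) by auto
next
  fix \<nu> assume "\<nu> \<in> (\<lambda>\<alpha>. map \<alpha> [0..<N]) ` exponents d"
  then obtain \<alpha> where \<alpha>: "\<alpha> \<in> exponents d" "\<nu> = map \<alpha> [0..<N]" by blast
  obtain s where s: "s \<in> forms_deg N d" "\<And>z. pullback s z = basis_fun \<alpha> z"
    using basis_fun_lift[OF \<alpha>(1)] by blast
  then have "pullback s = basis_fun \<alpha>" by auto
  then have lex: "lex_order N (pullback s) \<alpha>" using lex_order_basis_fun by simp
  then have "s \<noteq> 0" using lex_order_nonzero by (fastforce simp: pullback_def)
  then show "\<nu> \<in> {flag_valuation N flag s |s. s \<in> forms_deg N d \<and> s \<noteq> 0}"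
    using s(1) flag_valuation_eq[OF forms_deg_formsI[OF s(1)] lex] \<alpha>(2) by (auto intro!: exI[of _ s])
qed

end

section \<open>Lattice points of the polytope\<close>

text \<open>Exchanges the pair at positions 2m - 1, 2m with the pair for n - m. As an involution it
  describes the coordinate permutation and its inverse alike.\<close>

definition perm_index :: "nat \<Rightarrow> nat \<Rightarrow> nat" where
  "perm_index n i = (if i = 0 then 0 else if odd i then 2 * n - 2 - i else 2 * n - i)"

lemma concat_pairs:
  "concat (map (\<lambda>m. [f m, g m]) [1..<Suc k]) =
    map (\<lambda>i. if odd i then f ((i + 1) div 2) else g (i div 2)) [1..<2 * k + 1]"
  by (induction k) auto

lemma coord_perm_conv:
  assumes "n \<ge> 2"
  shows "coord_perm n x = map (\<lambda>i. x ! perm_index n i) [0..<2 * n - 1]"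
proof -
  obtain k where k: "n = Suc k" using assms by (cases n) auto
  have "coord_perm n x = x ! 0 # map (\<lambda>i. if odd i then x ! (2 * (n - (i + 1) div 2) - 1)
      else x ! (2 * (n - i div 2))) [1..<2 * k + 1]"
    unfolding coord_perm_def k concat_pairs ..
  also have "\<dots> = x ! perm_index n 0 # map (\<lambda>i. x ! perm_index n i) [1..<2 * k + 1]"
  proof -
    have "2 * (n - (i + 1) div 2) - 1 = 2 * n - 2 - i" if "odd i" for i
      using that by (auto elim!: oddE)
    moreover have "2 * (n - i div 2) = 2 * n - i" if "even i" for i
      using that by (auto elim!: evenE)
    ultimately show ?thesis by (auto simp: perm_index_def)
  qed
  also have "\<dots> = map (\<lambda>i. x ! perm_index n i) [0..<2 * n - 1]"
    using assms by (simp add: k upt_conv_Cons)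
  finally show ?thesis .
qed

lemma perm_index_less: "n \<ge> 2 \<Longrightarrow> i < 2 * n - 1 \<Longrightarrow> perm_index n i < 2 * n - 1"
  by (auto simp: perm_index_def)

lemma perm_index_involution: "n \<ge> 2 \<Longrightarrow> i < 2 * n - 1 \<Longrightarrow> perm_index n (perm_index n i) = i"
proof (cases "odd i")
  case True
  assume i: "i < 2 * n - 1"
  obtain b where b: "i = 2 * b + 1" using True by (rule oddE)
  then have "b + 2 \<le> n" using i by linarith
  then obtain c where "n = b + 2 + c" using le_Suc_ex by blast
  then show ?thesis by (simp add: perm_index_def b)
next
  case False
  assume i: "i < 2 * n - 1"
  obtain b where b: "i = 2 * b" using False by auto
  then have "b + 1 \<le> n" using i by linarith
  then obtain c where "n = b + 1 + c" using le_Suc_ex by blast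
  then show ?thesis by (simp add: perm_index_def b)
qed

text \<open>Apart from position 0, the positions below \<open>2 * n - 3\<close> carry all pairs but
  \<open>A_1, C_1\<close> in the order of the valuation; they are matched with the pairs for m >= 2,
  over which the polytope inequalities sum.\<close>

lemma perm_index_range:
  assumes "0 < i"
  shows "i < 2 * n - 3 \<Longrightarrow> 3 \<le> perm_index n i \<and> perm_index n i < 2 * n - 1"
    and "3 \<le> i \<Longrightarrow> i < 2 * n - 1 \<Longrightarrow> 0 < perm_index n i \<and> perm_index n i < 2 * n - 3"
proof -
  show "3 \<le> perm_index n i \<and> perm_index n i < 2 * n - 1" if i: "i < 2 * n - 3"
  proof (cases "odd i")
    case True
    then obtain b where b: "i = 2 * b + 1" by (rule oddE)
    then have "b + 2 < n" using i by simp
    then show ?thesis by (auto simp: perm_index_def b)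
  next
    case False
    then obtain b where b: "i = 2 * b" by auto
    then have "b + 1 < n" "0 < b" using i assms by simp_all
    then show ?thesis by (auto simp: perm_index_def b)
  qed
  show "0 < perm_index n i \<and> perm_index n i < 2 * n - 3" if i: "3 \<le> i" "i < 2 * n - 1"
  proof (cases "odd i")
    case True
    then obtain b where b: "i = 2 * b + 1" by (rule oddE)
    then have "b + 1 < n" "1 \<le> b" using i by simp_all
    then show ?thesis by (auto simp: perm_index_def b)
  next
    case False
    then obtain b where b: "i = 2 * b" by auto
    then have "b < n" "2 \<le> b" using i by simp_all
    then show ?thesis by (auto simp: perm_index_def b)
  qed
qed

lemma sum_perm_index:
  assumes "n \<ge> 2"
  shows "(\<Sum>i\<in>{3..<2 * n - 1}. f (perm_index n i)) = (\<Sum>i\<in>{1..<2 * n - 3}. f i)"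
proof (rule sum.reindex_bij_witness[of _ "perm_index n" "perm_index n"])
  fix i assume "i \<in> {3..<2 * n - 1}"
  then show "perm_index n (perm_index n i) = i" "perm_index n i \<in> {1..<2 * n - 3}"
    using perm_index_involution[OF assms, of i] perm_index_range(2)[of i n] by auto
next
  fix i assume i: "i \<in> {1..<2 * n - 3}"
  then show "perm_index n (perm_index n i) = i" "perm_index n i \<in> {3..<2 * n - 1}"
    using perm_index_involution[OF assms, of i] perm_index_range(1)[of i n] by auto
qed simp

section \<open>The polytope and its dilates by inequalities\<close>

lemma sum_odd_even_pairs:
  fixes f :: "nat \<Rightarrow> real"
  assumes "2 \<le> n"
  shows "(\<Sum>m=2..n - 1. f (2 * m - 1) + f (2 * m)) = (\<Sum>i\<in>{3..<2 * n - 1}. f i)"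
  using assms
proof (induction n rule: dec_induct)
  case (step n)
  obtain k where k: "n = Suc (Suc k)" using le_Suc_ex[OF step.hyps(1)] by auto
  show ?case using step.IH by (simp add: k algebra_simps)
qed simp

lemma P_dual_iff:
  assumes "2 \<le> n"
  shows "p \<in> P_dual n \<longleftrightarrow> length p = 2 * n - 1 \<and> (\<forall>i<2 * n - 1. - 1 \<le> p ! i) \<and>
    p ! 1 + 2 * p ! 0 + (\<Sum>i\<in>{3..<2 * n - 1}. p ! i) \<le> 1 \<and>
    p ! 2 + 2 * p ! 0 + (\<Sum>i\<in>{3..<2 * n - 1}. p ! i) \<le> 1"
proof -
  have "(- 1 \<le> p ! 0 \<and> (\<forall>m\<in>{1..n - 1}. - 1 \<le> p ! (2 * m - 1) \<and> - 1 \<le> p ! (2 * m))) \<longleftrightarrow>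
      (\<forall>i<2 * n - 1. - 1 \<le> p ! i)" (is "?L \<longleftrightarrow> ?R")
  proof
    assume L: ?L
    show ?R
    proof (intro allI impI)
      fix i assume i: "i < 2 * n - 1"
      consider "i = 0" | m where "i = 2 * m - 1" "m \<in> {1..n - 1}" | m where "i = 2 * m" "m \<in> {1..n - 1}"
      proof (cases "even i")
        case True
        then obtain m where "i = 2 * m" by blast
        then show ?thesis using i \<open>2 \<le> n\<close> that(1) that(3)[of m] by (cases m) auto
      next
        case False
        then obtain m where "i = 2 * m + 1" by (blast elim: oddE)
        then show ?thesis using i \<open>2 \<le> n\<close> that(2)[of "m + 1"] by auto
      qed
      then show "- 1 \<le> p ! i" using L by cases auto
    qed
  next
    assume R: ?R
    have "2 * m - 1 < 2 * n - 1" "2 * m < 2 * n - 1" if "m \<in> {1..n - 1}" for m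
      using that by auto
    then show ?L using R assms by auto
  qed
  then show ?thesis
    unfolding P_dual_def Let_def using sum_odd_even_pairs[OF assms, of "\<lambda>i. p ! i"] by auto
qed

lemma dilate_P_dual_iff:
  assumes n: "2 \<le> n"
  shows "map real_of_int x \<in> dilate k (P_dual n) \<longleftrightarrow> length x = 2 * n - 1 \<and>
    (\<forall>i<2 * n - 1. - int k \<le> x ! i) \<and>
    x ! 1 + 2 * x ! 0 + (\<Sum>i\<in>{3..<2 * n - 1}. x ! i) \<le> int k \<and>
    x ! 2 + 2 * x ! 0 + (\<Sum>i\<in>{3..<2 * n - 1}. x ! i) \<le> int k" (is "?L \<longleftrightarrow> ?R")
proof -
  have le: "0 < 2 * n - 1" "1 < 2 * n - 1" "2 < 2 * n - 1" using n by auto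
  show ?thesis
  proof
    assume ?L
    then obtain p where p: "p \<in> P_dual n" "map real_of_int x = map (\<lambda>a. real k * a) p"
      by (auto simp: dilate_def)
    have len: "length p = 2 * n - 1" using p(1) by (simp add: P_dual_iff[OF n])
    then have lenx: "length x = 2 * n - 1" using p(2) by (metis length_map)
    have x: "real_of_int (x ! i) = real k * p ! i" if "i < 2 * n - 1" for i
      using arg_cong[OF p(2), of "\<lambda>l. l ! i"] that len lenx by simp
    have bound: "- int k \<le> x ! i" if "i < 2 * n - 1" for i
    proof -
      have "real k * (- 1) \<le> real k * p ! i"
        using p(1) that by (intro mult_left_mono) (auto simp: P_dual_iff[OF n])
      then have "real_of_int (- int k) \<le> real_of_int (x ! i)" using x[OF that] by simp
      then show ?thesis by (simp only: of_int_le_iff)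
    qed
    have upper: "x ! j + 2 * x ! 0 + (\<Sum>i\<in>{3..<2 * n - 1}. x ! i) \<le> int k"
      if "j < 2 * n - 1" "p ! j + 2 * p ! 0 + (\<Sum>i\<in>{3..<2 * n - 1}. p ! i) \<le> 1" for j
    proof -
      have "real_of_int (x ! j + 2 * x ! 0 + (\<Sum>i\<in>{3..<2 * n - 1}. x ! i)) =
          real k * (p ! j + 2 * p ! 0 + (\<Sum>i\<in>{3..<2 * n - 1}. p ! i))"
        using x le that(1) by (simp add: algebra_simps sum_distrib_left)
      also have "\<dots> \<le> real k * 1" by (rule mult_left_mono[OF that(2)]) simp
      finally have "real_of_int (x ! j + 2 * x ! 0 + (\<Sum>i\<in>{3..<2 * n - 1}. x ! i)) \<le> real_of_int (int k)"
        by simp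
      then show ?thesis by (simp only: of_int_le_iff)
    qed
    show ?R using lenx bound upper[of 1] upper[of 2] p(1) le by (simp add: P_dual_iff[OF n])
  next
    assume R: ?R
    show ?L
    \<comment> \<open>Division by \<open>k\<close> needs \<open>k > 0\<close>. For
      \<open>k = 0\<close> the inequalities say that all entries are nonnegative with sums at most
      0, which leaves the origin.\<close>
    proof (cases "k = 0")
      case True
      have nonneg: "0 \<le> x ! i" if "i < 2 * n - 1" for i using R True that by auto
      have s: "0 \<le> (\<Sum>i\<in>{3..<2 * n - 1}. x ! i)" using nonneg by (intro sum_nonneg) auto
      have "x ! i = 0" if i: "i < 2 * n - 1" for i
      proof -
        have "i = 0 \<or> i = 1 \<or> i = 2 \<or> i \<in> {3..<2 * n - 1}" using i by auto
        moreover have "x ! i \<le> (\<Sum>i\<in>{3..<2 * n - 1}. x ! i)" if "i \<in> {3..<2 * n - 1}"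
          using nonneg that by (intro member_le_sum) auto
        ultimately show ?thesis
          using R True s nonneg[OF i] nonneg[OF le(1)] nonneg[OF le(2)] nonneg[OF le(3)] by auto
      qed
      then have "map real_of_int x = map (\<lambda>a. real k * a) (replicate (2 * n - 1) 0)"
        using R by (intro nth_equalityI) auto
      moreover have "replicate (2 * n - 1) 0 \<in> P_dual n"
        using le by (simp add: P_dual_iff[OF n])
      ultimately show ?thesis unfolding dilate_def by (rule image_eqI)
    next
      case False
      let ?p = "map (\<lambda>a. real_of_int a / real k) x"
      have p: "?p ! i = real_of_int (x ! i) / real k" if "i < 2 * n - 1" for i
        using that R by simp
      have upper: "?p ! j + 2 * ?p ! 0 + (\<Sum>i\<in>{3..<2 * n - 1}. ?p ! i) \<le> 1"
        if j: "j < 2 * n - 1" "x ! j + 2 * x ! 0 + (\<Sum>i\<in>{3..<2 * n - 1}. x ! i) \<le> int k" for j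
      proof -
        have "?p ! j + 2 * ?p ! 0 + (\<Sum>i\<in>{3..<2 * n - 1}. ?p ! i) =
            real_of_int (x ! j + 2 * x ! 0 + (\<Sum>i\<in>{3..<2 * n - 1}. x ! i)) / real k"
          using p le(1) j(1) by (simp add: add_divide_distrib sum_divide_distrib)
        also have "\<dots> \<le> real_of_int (int k) / real k"
          by (intro divide_right_mono iffD2[OF of_int_le_iff] j(2)) simp
        finally show ?thesis using False by simp
      qed
      have lower: "- 1 \<le> ?p ! i" if "i < 2 * n - 1" for i
      proof -
        have "real_of_int (- int k) / real k \<le> real_of_int (x ! i) / real k"
          using R that by (intro divide_right_mono iffD2[OF of_int_le_iff]) auto
        then show ?thesis using p[OF that] False by simp
      qed
      have "?p \<in> P_dual n"
        unfolding P_dual_iff[OF n] using R lower upper[of 1] upper[of 2] le by auto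
      moreover have "map real_of_int x = map (\<lambda>a. real k * a) ?p"
        using False by simp
      ultimately show ?thesis unfolding dilate_def by blast
    qed
  qed
qed

context quadric_chart
begin

text \<open>The shift by \<open>k\<close> lowers each left side by (2 + (N - 3) + 1) k = N k, so the
  degree (N + 1) k leaves the bound \<open>k\<close>. The two inequalities are the two cases of the
  maximum.\<close>

lemma exponents_shift_iff:
  assumes supp: "\<And>i. N \<le> i \<Longrightarrow> \<alpha> i = 0" and y: "\<And>i. i < N \<Longrightarrow> y i = int (\<alpha> i) - int k"
  shows "\<alpha> \<in> exponents ((N + 1) * k) \<longleftrightarrow>
    y (N - 2) + 2 * y 0 + (\<Sum>i\<in>{1..<N - 2}. y i) \<le> int k \<and>
    y (N - 1) + 2 * y 0 + (\<Sum>i\<in>{1..<N - 2}. y i) \<le> int k"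
proof -
  have "(\<Sum>i\<in>{1..<N - 2}. y i) = (\<Sum>i\<in>{1..<N - 2}. int (\<alpha> i) - int k)"
    using y by (intro sum.cong) auto
  also have "\<dots> = int (\<Sum>i\<in>{1..<N - 2}. \<alpha> i) - (int N - 3) * int k"
    using N_props by (simp add: sum_subtractf of_nat_diff)
  finally have s: "(\<Sum>i\<in>{1..<N - 2}. y i) = int (\<Sum>i\<in>{1..<N - 2}. \<alpha> i) - (int N - 3) * int k" .
  have *: "y j + 2 * y 0 + (\<Sum>i\<in>{1..<N - 2}. y i) \<le> int k \<longleftrightarrow>
      2 * \<alpha> 0 + (\<Sum>i\<in>{1..<N - 2}. \<alpha> i) + \<alpha> j \<le> (N + 1) * k" if "j < N" for j
  proof -
    have eqn: "y j + 2 * y 0 + (\<Sum>i\<in>{1..<N - 2}. y i) =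
        int (2 * \<alpha> 0 + (\<Sum>i\<in>{1..<N - 2}. \<alpha> i) + \<alpha> j) - int (N * k)"
      unfolding s using y[OF that] y[of 0] N_props by (simp add: algebra_simps)
    have c: "int ((N + 1) * k) = int (N * k) + int k" by simp
    have "y j + 2 * y 0 + (\<Sum>i\<in>{1..<N - 2}. y i) \<le> int k \<longleftrightarrow>
        int (2 * \<alpha> 0 + (\<Sum>i\<in>{1..<N - 2}. \<alpha> i) + \<alpha> j) \<le> int ((N + 1) * k)"
      unfolding eqn c by linarith
    then show ?thesis by (simp only: of_nat_le_iff)
  qed
  have "N - 2 < N" "N - 1 < N" using N_props by auto
  then show ?thesis
    unfolding *[OF \<open>N - 2 < N\<close>] *[OF \<open>N - 1 < N\<close>] exponents_def using supp by auto
qed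

text \<open>The lower bounds \<open>- int k\<close> express that exponents are nonnegative; the
  upper bounds come from \<open>exponents_shift_iff\<close>.\<close>

lemma coord_perm_values:
  "coord_perm n ` {map (\<lambda>a. int a - int k) (flag_valuation N flag s) |s.
      s \<in> forms_deg N ((N + 1) * k) \<and> s \<noteq> 0} =
    {x. map real_of_int x \<in> dilate k (P_dual n)}"
proof -
  let ?d = "(N + 1) * k"
  let ?f = "\<lambda>\<alpha>. map (\<lambda>i. int (\<alpha> (perm_index n i)) - int k) [0..<N]"
  have less: "perm_index n i < N" if "i < N" for i
    using perm_index_less[OF n_ge] that unfolding N_def .
  have inv: "perm_index n (perm_index n i) = i" if "i < N" for i
    using perm_index_involution[OF n_ge] that unfolding N_def .
  have pos: "perm_index n 0 = 0" "perm_index n 1 = N - 2" "perm_index n 2 = N - 1"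
    using n_ge by (auto simp: perm_index_def N_def)
  have sum: "(\<Sum>i\<in>{3..<N}. g (perm_index n i)) = (\<Sum>i\<in>{1..<N - 2}. g i)" for g :: "nat \<Rightarrow> int"
    using sum_perm_index[OF n_ge, of g] by (simp add: N_def numeral_3_eq_3 numeral_2_eq_2)
  have lt: "0 < N" "1 < N" "2 < N" using N_props by auto
  have cp: "coord_perm n x = map (\<lambda>i. x ! perm_index n i) [0..<N]" for x
    using coord_perm_conv[OF n_ge] unfolding N_def .
  have "{map (\<lambda>a. int a - int k) (flag_valuation N flag s) |s. s \<in> forms_deg N ?d \<and> s \<noteq> 0} =
      map (\<lambda>a. int a - int k) ` {flag_valuation N flag s |s. s \<in> forms_deg N ?d \<and> s \<noteq> 0}"
    by blast
  then have "coord_perm n ` {map (\<lambda>a. int a - int k) (flag_valuation N flag s) |s.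
      s \<in> forms_deg N ?d \<and> s \<noteq> 0} =
      (\<lambda>\<alpha>. coord_perm n (map (\<lambda>a. int a - int k) (map \<alpha> [0..<N]))) ` exponents ?d"
    by (simp only: flag_valuation_values image_image)
  also have "\<dots> = ?f ` exponents ?d"
    using less by (intro image_cong refl) (simp add: cp)
  also have "\<dots> = {x. map real_of_int x \<in> dilate k (P_dual n)}"
    unfolding dilate_P_dual_iff[OF n_ge] N_def[symmetric]
  proof (intro equalityI subsetI)
    fix x assume "x \<in> ?f ` exponents ?d"
    then obtain \<alpha> where \<alpha>: "\<alpha> \<in> exponents ?d" "x = ?f \<alpha>" by blast
    define y where "y i = int (\<alpha> i) - int k" for i
    have x: "x ! i = y (perm_index n i)" if "i < N" for i
      using that \<alpha>(2) by (simp add: y_def)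
    have "(\<Sum>i\<in>{3..<N}. x ! i) = (\<Sum>i\<in>{1..<N - 2}. y i)"
      unfolding sum[symmetric] using x by (intro sum.cong) auto
    moreover have "x ! 0 = y 0" "x ! 1 = y (N - 2)" "x ! 2 = y (N - 1)"
      using x[OF lt(1)] x[OF lt(2)] x[OF lt(3)] unfolding pos .
    moreover have "length x = N" using \<alpha>(2) by simp
    moreover have "y (N - 2) + 2 * y 0 + (\<Sum>i\<in>{1..<N - 2}. y i) \<le> int k \<and>
        y (N - 1) + 2 * y 0 + (\<Sum>i\<in>{1..<N - 2}. y i) \<le> int k"
      using exponents_shift_iff[of \<alpha> y k] \<alpha>(1) by (auto simp: y_def exponents_def)
    moreover have "- int k \<le> x ! i" if "i < N" for i using x[OF that] by (simp add: y_def)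
    ultimately show "x \<in> {x. length x = N \<and> (\<forall>i<N. - int k \<le> x ! i) \<and>
        x ! 1 + 2 * x ! 0 + (\<Sum>i\<in>{3..<N}. x ! i) \<le> int k \<and>
        x ! 2 + 2 * x ! 0 + (\<Sum>i\<in>{3..<N}. x ! i) \<le> int k}"
      by simp
  next
    fix x :: "int list" assume "x \<in> {x. length x = N \<and> (\<forall>i<N. - int k \<le> x ! i) \<and>
        x ! 1 + 2 * x ! 0 + (\<Sum>i\<in>{3..<N}. x ! i) \<le> int k \<and>
        x ! 2 + 2 * x ! 0 + (\<Sum>i\<in>{3..<N}. x ! i) \<le> int k}"
    then have x: "length x = N" "\<And>i. i < N \<Longrightarrow> - int k \<le> x ! i"
        "x ! 1 + 2 * x ! 0 + (\<Sum>i\<in>{3..<N}. x ! i) \<le> int k"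
        "x ! 2 + 2 * x ! 0 + (\<Sum>i\<in>{3..<N}. x ! i) \<le> int k" by auto
    define y where "y i = x ! perm_index n i" for i
    \<comment> \<open>The lower bounds make \<open>nat\<close> exact here, and the value 0 from
      \<open>N\<close> on is demanded by \<open>exponents\<close>.\<close>
    define \<alpha> where "\<alpha> i = (if i < N then nat (y i + int k) else 0)" for i
    have y: "y i = int (\<alpha> i) - int k" if "i < N" for i
      using x(2)[OF less[OF that]] that by (simp add: \<alpha>_def y_def)
    have xy: "x ! i = y (perm_index n i)" if "i < N" for i
      using inv[OF that] by (simp add: y_def)
    have "(\<Sum>i\<in>{3..<N}. x ! i) = (\<Sum>i\<in>{1..<N - 2}. y i)"
      unfolding sum[symmetric] using xy by (intro sum.cong) auto
    moreover have "x ! 0 = y 0" "x ! 1 = y (N - 2)" "x ! 2 = y (N - 1)"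
      using xy[OF lt(1)] xy[OF lt(2)] xy[OF lt(3)] unfolding pos .
    moreover have "\<alpha> i = 0" if "N \<le> i" for i using that by (simp add: \<alpha>_def)
    ultimately have "\<alpha> \<in> exponents ?d"
      using exponents_shift_iff[of \<alpha> y k] y x(3,4) by simp
    moreover have "x = ?f \<alpha>"
      by (rule nth_equalityI) (use x(1) xy y less in auto)
    ultimately show "x \<in> ?f ` exponents ?d" by blast
  qed
  finally show ?thesis .
qed

end

theorem theorem1p2:
  fixes n N :: nat
  assumes "n \<ge> 2" and "N = 2 * n - 1"
  shows "\<exists>Y. admissible_flag N Y \<and>
    flag_valuation N Y (H_form n) = replicate N 1 \<and>
    (\<forall>k::nat.
      coord_perm n ` {map (\<lambda>a. int a - int k) (flag_valuation N Y s) | s.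
                   s \<in> forms_deg N ((N + 1) * k) \<and> s \<noteq> 0}
      = {x :: int list. map real_of_int x \<in> dilate k (P_dual n)})"
proof -
  interpret quadric_chart n N
    using assms by unfold_locales
  show ?thesis
    using admissible_flag_flag flag_valuation_H_form coord_perm_values by blast
qed

end
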